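(* Let $C$ be an acyclic topological category whose space of objects $C_0$ has the discrete topology. Suppose further that the space of morphisms $C(x,y)$ is compact Hausdorff for each pair $x,y\in C_0$, and that the set $P(C)_{<x}=\{y\in C_0 \mid C(y,x)\neq\emptyset \text{ and } y\neq x\}$ is finite for each $x\in C_0$. Then there exists a structure of cylindrically normal stellar stratified space (CNSSS) on the classifying space $BC$ whose face category is isomorphic to $C$ as topological categories.
   Context: **Topological categories.** A topological category $C$ has spaces $C_0$, $C_1$ of objects and morphisms with continuous source, target, identity and composition maps; $C(x,y)\subset C_1$ is the space of morphisms from $x$ to $y$. $C$ is acyclic if (1) for distinct objects $x,y$, either $C(x,y)$ or $C(y,x)$ is empty; (2) $C(x,x)=\{1_x\}$ for every object $x$; (3) $C_1=C_0\amalg(C_1\setminus C_0)$ as topological spaces, where $C_0$ is regarded as the subspace of identity morphisms. Then $C_0$ is a poset $P(C)$ with $x\le y$ iff $C(x,y)\ne\emptyset$. The classifying space $BC$ is the geometric realization of the simplicial space $N(C)$, where $N_k(C)\subset C_1^k$ is the space of $k$-chains $x_0\to x_1\to\cdots\to x_k$. **Stratifications.** Posets carry the Alexandroff topology in which the open sets are the upward closed sets (so $\overline{\{\lambda\}}=\{\mu\mid\mu\le\lambda\}$). A stratification of a space $X$ by a poset $\Lambda$ is an open continuous map $\pi:X\to\Lambda$ such that $\pi^{-1}(\lambda)$ is connected and locally closed for each $\lambda\in\operatorname{Im}\pi$. The face poset is $P(X)=\operatorname{Im}\pi$ with the order induced from $\Lambda$; the strata are $e_\lambda=\pi^{-1}(\lambda)$,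 $\lambda\in P(X)$, and $\partial e_\lambda=\overline{e_\lambda}\setminus e_\lambda$. A morphism of stratified spaces $X\to Y$ is a continuous map $f:X\to Y$ with an order-preserving map $P(f):P(X)\to P(Y)$ such that $\pi_Y f=P(f)\pi_X$; it is strict if $f(e_\lambda)=e_{P(f)(\lambda)}$. A stratification is normal if $e_\mu\cap\overline{e_\lambda}\ne\emptyset$ implies $e_\mu\subset\overline{e_\lambda}$. **Cones and asters.** For a stratified space $S$ with face poset $\Lambda$, $\mathrm{cone}(S)=\{*\}\star S$ is the join with a point, with points written $(1-t)*+ty$ ($0\le t\le1$, $y\in S$), $S$ being identified with the points with $t=1$ (and $\mathrm{cone}(\emptyset)=\{*\}$). It is stratified by the poset $\Lambda\times\{b<i\}\amalg\{*\}$ (product order on $\Lambda\times\{b,i\}$, $*<(\lambda,i)$ for all $\lambda$, $*$ unrelated to the $(\lambda,b)$) via $(1-t)*+ty\mapsto *$, $(\pi_S(y),i)$, $(\pi_S(y),b)$ for $t=0$, $0<t<1$, $t=1$ respectively. A subset $D\subset\mathrm{cone}(S)$ is an aster if $(1-t)*+ty\in D$ implies $(1-t')*+t'y\in D$ for all $0\le t'\le t$. Put $\partial D=S\cap D$ and $\operatorname{Int}(D)=D\setminus\partial D$. **Stellar stratified spaces.** A stellar structure on a stratum $e_\lambda$ is a morphism of stratified spaces $\varphi_\lambda:D_\lambda\to\overline{e_\lambda}$, for an aster $D_\lambda\subset\mathrm{cone}(S_\lambda)$ on some stratified space $S_\lambda$, which is a quotient map and restricts to a homeomorphism $\operatorname{Int}(D_\lambda)\to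 e_\lambda$ (this restriction need not be an isomorphism of stratified spaces). A stellar stratified space is a space $X$ with a stratification and a stellar structure $\varphi_\lambda$ on each stratum, such that each $\partial e_\lambda$ is covered by strata indexed by $\{\mu\in P(X)\mid\mu<\lambda\}$. **CNSSS.** A cylindrically normal stellar stratified space (CNSSS) is a normal stellar stratified space equipped with a cylindrical structure, consisting of: a space $P_{\mu,\lambda}$ (parameter space) and a strict morphism of stratified spaces $b_{\mu,\lambda}:P_{\mu,\lambda}\times D_\mu\to\partial D_\lambda$ for each pair of strata $e_\mu\subset\partial e_\lambda$ (where $P_{\mu,\lambda}$ is regarded as having a single stratum), and a map $c_{\lambda_0,\lambda_1,\lambda_2}:P_{\lambda_1,\lambda_2}\times P_{\lambda_0,\lambda_1}\to P_{\lambda_0,\lambda_2}$ for each sequence $\overline{e_{\lambda_0}}\subset\overline{e_{\lambda_1}}\subset\overline{e_{\lambda_2}}$ (with $P_{\lambda,\lambda}$ a single point), such that (1) the restriction of $b_{\mu,\lambda}$ to $P_{\mu,\lambda}\times\operatorname{Int}(D_\mu)$ is a homeomorphism onto its image; (2) $\varphi_\lambda\circ b_{\mu,\lambda}=\varphi_\mu\circ\mathrm{pr}_2$; $b_{\lambda_1,\lambda_2}\circ(1\times b_{\lambda_0,\lambda_1})=b_{\lambda_0,\lambda_2}\circ(c_{\lambda_0,\lambda_1,\lambda_2}\times1)$; and the maps $c$ are associative, i.e. $c_{\lambda_0,\lambda_1,\lambda_3}\circ(c_{\lambda_1,\lambda_2,\lambda_3}\times1)=c_{\lambda_0,\lambda_2,\lambda_3}\circ(1\times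 c_{\lambda_0,\lambda_1,\lambda_2})$; (3) $\partial D_\lambda=\bigcup_{e_\mu\subset\partial e_\lambda}b_{\mu,\lambda}(P_{\mu,\lambda}\times\operatorname{Int}(D_\mu))$ as a stratified space. **Face category.** The face category $C(X)$ of a CNSSS $X$ is the topological category whose objects are the strata of $X$ (a discrete space), with $C(X)(e_\mu,e_\lambda)=P_{\mu,\lambda}$ for $e_\mu\subset\overline{e_\lambda}$ (and empty otherwise), and with composition given by the maps $c_{\lambda_0,\lambda_1,\lambda_2}$.
   Formalization: Each b is strict only onto its image, not into all of ∂D_λ (literal strictness forces every composition map c to be surjective, so the claim fails); (3) is read as: the strata of ∂D_λ are exactly the sets b(P×e), e a stratum of Int(D_μ). Strata of D, ∂D, P×D need not be connected. *)

theory Defs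
  imports "HOL-Homology.Simplices"
begin

definition coinduced_topology :: "'b set \<Rightarrow> 'a topology \<Rightarrow> ('a \<Rightarrow> 'b) \<Rightarrow> 'b topology" where
  "coinduced_topology Y X f =
     topology (\<lambda>U. U \<subseteq> Y \<and> openin X {x \<in> topspace X. f x \<in> U})"

lemma openin_coinduced_topology:
  "openin (coinduced_topology Y X f) U \<longleftrightarrow> U \<subseteq> Y \<and> openin X {x \<in> topspace X. f x \<in> U}"
proof -
  have 1: "{x \<in> topspace X. f x \<in> S \<inter> T} =
      {x \<in> topspace X. f x \<in> S} \<inter> {x \<in> topspace X. f x \<in> T}" for S T
    by auto
  have 2: "{x \<in> topspace X. f x \<in> \<Union> \<K>} = (\<Union>K\<in>\<K>. {x \<in> topspace X. f x \<in> K})" for \<K>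
    by auto
  have "istopology (\<lambda>U. U \<subseteq> Y \<and> openin X {x \<in> topspace X. f x \<in> U})"
    unfolding istopology_def 1 2 by blast
  then show ?thesis
    by (simp add: coinduced_topology_def)
qed


section \<open>Topological categories\<close>

text \<open>\<open>cmp C g f\<close> is the composite "first \<open>f\<close>, then \<open>g\<close>".\<close>

record ('o, 'm) topcat =
  Obj :: "'o topology"
  Mor :: "'m topology"
  src :: "'m \<Rightarrow> 'o"
  tgt :: "'m \<Rightarrow> 'o"
  ident :: "'o \<Rightarrow> 'm"
  cmp :: "'m \<Rightarrow> 'm \<Rightarrow> 'm"

definition Hom :: "('o, 'm, 'z) topcat_scheme \<Rightarrow> 'o \<Rightarrow> 'o \<Rightarrow> 'm set" where
  "Hom C x y = {f \<in> topspace (Mor C). src C f = x \<and> tgt C f = y}"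

definition topological_category :: "('o, 'm, 'z) topcat_scheme \<Rightarrow> bool" where
  "topological_category C \<longleftrightarrow>
     continuous_map (Mor C) (Obj C) (src C) \<and>
     continuous_map (Mor C) (Obj C) (tgt C) \<and>
     continuous_map (Obj C) (Mor C) (ident C) \<and>
     continuous_map (subtopology (prod_topology (Mor C) (Mor C)) {(g, f). src C g = tgt C f}) (Mor C)
       (\<lambda>(g, f). cmp C g f) \<and>
     (\<forall>x \<in> topspace (Obj C). src C (ident C x) = x \<and> tgt C (ident C x) = x) \<and>
     (\<forall>f \<in> topspace (Mor C). \<forall>g \<in> topspace (Mor C). src C g = tgt C f \<longrightarrow>
        src C (cmp C g f) = src C f \<and> tgt C (cmp C g f) = tgt C g) \<and>
     (\<forall>f \<in> topspace (Mor C). cmp C f (ident C (src C f)) = f \<and> cmp C (ident C (tgt C f)) f = f) \<and>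
     (\<forall>f \<in> topspace (Mor C). \<forall>g \<in> topspace (Mor C). \<forall>h \<in> topspace (Mor C).
        src C g = tgt C f \<longrightarrow> src C h = tgt C g \<longrightarrow>
        cmp C h (cmp C g f) = cmp C (cmp C h g) f)"

definition identities :: "('o, 'm, 'z) topcat_scheme \<Rightarrow> 'm set" where
  "identities C = ident C ` topspace (Obj C)"

text \<open>The last clause says that the morphism space is the topological disjoint union of the
  subspace of identities and its complement.\<close>

definition acyclic_category :: "('o, 'm, 'z) topcat_scheme \<Rightarrow> bool" where
  "acyclic_category C \<longleftrightarrow>
     topological_category C \<and>
     (\<forall>x \<in> topspace (Obj C). \<forall>y \<in> topspace (Obj C). x \<noteq> y \<longrightarrow> Hom C x y = {} \<or> Hom C y x = {}) \<and>
     (\<forall>x \<in> topspace (Obj C). Hom C x x = {ident C x}) \<and>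
     homeomorphic_map
       (sum_topology
          (\<lambda>b. subtopology (Mor C) (if b then identities C else topspace (Mor C) - identities C)) UNIV)
       (Mor C) snd"

definition strictly_below :: "('o, 'm, 'z) topcat_scheme \<Rightarrow> 'o \<Rightarrow> 'o set" where
  "strictly_below C x = {y \<in> topspace (Obj C). Hom C y x \<noteq> {} \<and> y \<noteq> x}"

definition topcat_isomorphic ::
    "('o, 'm, 'z) topcat_scheme \<Rightarrow> ('p, 'n, 'w) topcat_scheme \<Rightarrow> bool" where
  "topcat_isomorphic C D \<longleftrightarrow>
     (\<exists>F0 F1. homeomorphic_map (Obj C) (Obj D) F0 \<and> homeomorphic_map (Mor C) (Mor D) F1 \<and>
        (\<forall>f \<in> topspace (Mor C). src D (F1 f) = F0 (src C f) \<and> tgt D (F1 f) = F0 (tgt C f)) \<and>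
        (\<forall>x \<in> topspace (Obj C). F1 (ident C x) = ident D (F0 x)) \<and>
        (\<forall>f \<in> topspace (Mor C). \<forall>g \<in> topspace (Mor C). src C g = tgt C f \<longrightarrow>
           F1 (cmp C g f) = cmp D (F1 g) (F1 f)))"


section \<open>Classifying space\<close>

text \<open>A \<open>k\<close>-chain \<open>x\<^sub>0 \<rightarrow> \<dots> \<rightarrow> x\<^sub>k\<close> is encoded as \<open>(x\<^sub>0, f)\<close> with \<open>f i : x\<^sub>i \<rightarrow> x\<^sub>i\<^sub>+\<^sub>1\<close>
  for \<open>i < k\<close>. Recording \<open>x\<^sub>0\<close> only matters for \<open>k = 0\<close>, where it makes the space of chains
  the space of objects; for \<open>k > 0\<close> it is determined continuously by \<open>f\<close>.\<close>

type_synonym ('o, 'm) chain = "'o \<times> (nat \<Rightarrow> 'm)"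

definition chain_obj :: "('o, 'm, 'z) topcat_scheme \<Rightarrow> ('o, 'm) chain \<Rightarrow> nat \<Rightarrow> 'o" where
  "chain_obj C c i = (case i of 0 \<Rightarrow> fst c | Suc j \<Rightarrow> tgt C (snd c j))"

text \<open>\<open>chain_mor C c i n\<close> is the composite morphism \<open>x\<^sub>i \<rightarrow> x\<^sub>i\<^sub>+\<^sub>n\<close> of the chain.\<close>

fun chain_mor :: "('o, 'm, 'z) topcat_scheme \<Rightarrow> ('o, 'm) chain \<Rightarrow> nat \<Rightarrow> nat \<Rightarrow> 'm" where
  "chain_mor C c i 0 = ident C (chain_obj C c i)"
| "chain_mor C c i (Suc n) = cmp C (snd c (i + n)) (chain_mor C c i n)"

definition nerve :: "('o, 'm, 'z) topcat_scheme \<Rightarrow> nat \<Rightarrow> ('o, 'm) chain topology" where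
  "nerve C k =
     subtopology (prod_topology (Obj C) (product_topology (\<lambda>_. Mor C) {..<k}))
       {c. \<forall>i<k. src C (snd c i) = chain_obj C c i}"

text \<open>The simplicial operator \<open>\<theta>\<^sup>*\<close> of a monotone map \<open>\<theta> : [m] \<rightarrow> [k]\<close>; it covers faces
  and degeneracies.\<close>

definition nerve_op ::
    "('o, 'm, 'z) topcat_scheme \<Rightarrow> nat \<Rightarrow> (nat \<Rightarrow> nat) \<Rightarrow> ('o, 'm) chain \<Rightarrow> ('o, 'm) chain" where
  "nerve_op C m \<theta> c =
     (chain_obj C c (\<theta> 0), \<lambda>l\<in>{..<m}. chain_mor C c (\<theta> l) (\<theta> (Suc l) - \<theta> l))"

text \<open>The affine map \<open>\<Delta>\<^sup>m \<rightarrow> \<Delta>\<^sup>k\<close> induced by \<open>\<theta>\<close> on vertices.\<close>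

definition simplex_map :: "nat \<Rightarrow> (nat \<Rightarrow> nat) \<Rightarrow> (nat \<Rightarrow> real) \<Rightarrow> (nat \<Rightarrow> real)" where
  "simplex_map m \<theta> t = (\<lambda>j. \<Sum>i | i \<le> m \<and> \<theta> i = j. t i)"

definition realization_rel ::
    "(nat \<Rightarrow> 'c topology) \<Rightarrow> (nat \<Rightarrow> (nat \<Rightarrow> nat) \<Rightarrow> 'c \<Rightarrow> 'c) \<Rightarrow> (nat \<times> 'c \<times> (nat \<Rightarrow> real)) rel" where
  "realization_rel N opr =
     {((m, opr m \<theta> c, t), (k, c, simplex_map m \<theta> t)) | m k \<theta> c t.
        \<theta> \<in> {..m} \<rightarrow> {..k} \<and> mono_on {..m} \<theta> \<and> c \<in> topspace (N k) \<and> t \<in> standard_simplex m}"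

text \<open>Geometric realization of the simplicial space with levels \<open>N k\<close> and operators \<open>opr m \<theta>\<close>:
  the quotient of the disjoint union of the \<open>N k \<times> \<Delta>\<^sup>k\<close> by the equivalence relation generated by
  \<open>(\<theta>\<^sup>* c, t) \<sim> (c, \<theta>\<^sub>* t)\<close>.\<close>

definition realization ::
    "(nat \<Rightarrow> 'c topology) \<Rightarrow> (nat \<Rightarrow> (nat \<Rightarrow> nat) \<Rightarrow> 'c \<Rightarrow> 'c) \<Rightarrow>
     (nat \<times> 'c \<times> (nat \<Rightarrow> real)) set topology" where
  "realization N opr =
     (let T = sum_topology
                (\<lambda>k. prod_topology (N k) (subtopology (powertop_real UNIV) (standard_simplex k))) UNIV;
          R = realization_rel N opr;
          cls = (\<lambda>p. (R \<union> R\<inverse>)\<^sup>* `` {p})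
      in coinduced_topology (cls ` topspace T) T cls)"

type_synonym ('o, 'm) bpoint = "(nat \<times> ('o, 'm) chain \<times> (nat \<Rightarrow> real)) set"

definition classifying_space :: "('o, 'm, 'z) topcat_scheme \<Rightarrow> ('o, 'm) bpoint topology" where
  "classifying_space C = realization (nerve C) (nerve_op C)"


section \<open>Stratified spaces\<close>

text \<open>A poset is a relation \<open>r\<close> with \<open>Partial_order r\<close>; its underlying set is \<open>Field r\<close>.\<close>

definition alexandroff :: "'l rel \<Rightarrow> 'l topology" where
  "alexandroff r = topology (\<lambda>U. U \<subseteq> Field r \<and> (\<forall>x y. x \<in> U \<longrightarrow> (x, y) \<in> r \<longrightarrow> y \<in> U))"

lemma openin_alexandroff:
  "openin (alexandroff r) U \<longleftrightarrow> U \<subseteq> Field r \<and> (\<forall>x y. x \<in> U \<longrightarrow> (x, y) \<in> r \<longrightarrow> y \<in> U)"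
proof -
  have "istopology (\<lambda>U. U \<subseteq> Field r \<and> (\<forall>x y. x \<in> U \<longrightarrow> (x, y) \<in> r \<longrightarrow> y \<in> U))"
    unfolding istopology_def by blast
  then show ?thesis
    by (simp add: alexandroff_def)
qed

definition locally_closedin :: "'a topology \<Rightarrow> 'a set \<Rightarrow> bool" where
  "locally_closedin X S \<longleftrightarrow> (\<exists>U F. openin X U \<and> closedin X F \<and> S = U \<inter> F)"

text \<open>The data of a space with a map to a poset. The axioms of a stratification are in
  \<open>stratified_space\<close>; they are not imposed on subspaces with the restricted map, nor on products
  with a parameter space. In particular strata of these need not be connected, as has to be allowed
  if the parameter spaces below are to be arbitrary.\<close>

record ('a, 'l) strat =
  sspace :: "'a topology"
  sposet :: "'l rel"
  smap :: "'a \<Rightarrow> 'l"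

definition faces :: "('a, 'l, 'z) strat_scheme \<Rightarrow> 'l set" where
  "faces X = smap X ` topspace (sspace X)"

definition face_poset :: "('a, 'l, 'z) strat_scheme \<Rightarrow> 'l rel" where
  "face_poset X = Restr (sposet X) (faces X)"

definition stratum :: "('a, 'l, 'z) strat_scheme \<Rightarrow> 'l \<Rightarrow> 'a set" where
  "stratum X l = {x \<in> topspace (sspace X). smap X x = l}"

definition closed_stratum :: "('a, 'l, 'z) strat_scheme \<Rightarrow> 'l \<Rightarrow> 'a set" where
  "closed_stratum X l = sspace X closure_of stratum X l"

definition stratum_boundary :: "('a, 'l, 'z) strat_scheme \<Rightarrow> 'l \<Rightarrow> 'a set" where
  "stratum_boundary X l = closed_stratum X l - stratum X l"

definition stratified_space :: "('a, 'l, 'z) strat_scheme \<Rightarrow> bool" where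
  "stratified_space X \<longleftrightarrow>
     Partial_order (sposet X) \<and>
     continuous_map (sspace X) (alexandroff (sposet X)) (smap X) \<and>
     open_map (sspace X) (alexandroff (sposet X)) (smap X) \<and>
     (\<forall>l \<in> faces X. connectedin (sspace X) (stratum X l) \<and> locally_closedin (sspace X) (stratum X l))"

definition normal_stratification :: "('a, 'l, 'z) strat_scheme \<Rightarrow> bool" where
  "normal_stratification X \<longleftrightarrow>
     (\<forall>m \<in> faces X. \<forall>l \<in> faces X.
        stratum X m \<inter> closed_stratum X l \<noteq> {} \<longrightarrow> stratum X m \<subseteq> closed_stratum X l)"

definition substrat :: "('a, 'l, 'z) strat_scheme \<Rightarrow> 'a set \<Rightarrow> ('a, 'l) strat" where
  "substrat X A = \<lparr>sspace = subtopology (sspace X) A, sposet = sposet X, smap = smap X\<rparr>"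

text \<open>The product \<open>P \<times> X\<close> with \<open>P\<close> regarded as a single stratum.\<close>

definition cylinder :: "'p topology \<Rightarrow> ('a, 'l, 'z) strat_scheme \<Rightarrow> ('p \<times> 'a, 'l) strat" where
  "cylinder P X = \<lparr>sspace = prod_topology P (sspace X), sposet = sposet X, smap = smap X \<circ> snd\<rparr>"

definition strat_morphism_over ::
    "('a, 'l, 'z) strat_scheme \<Rightarrow> ('b, 'k, 'w) strat_scheme \<Rightarrow> ('a \<Rightarrow> 'b) \<Rightarrow> ('l \<Rightarrow> 'k) \<Rightarrow> bool" where
  "strat_morphism_over X Y f p \<longleftrightarrow>
     continuous_map (sspace X) (sspace Y) f \<and>
     (\<forall>l m. (l, m) \<in> face_poset X \<longrightarrow> (p l, p m) \<in> face_poset Y) \<and>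
     (\<forall>x \<in> topspace (sspace X). smap Y (f x) = p (smap X x))"

definition strat_morphism ::
    "('a, 'l, 'z) strat_scheme \<Rightarrow> ('b, 'k, 'w) strat_scheme \<Rightarrow> ('a \<Rightarrow> 'b) \<Rightarrow> bool" where
  "strat_morphism X Y f \<longleftrightarrow> (\<exists>p. strat_morphism_over X Y f p)"

definition strict_morphism ::
    "('a, 'l, 'z) strat_scheme \<Rightarrow> ('b, 'k, 'w) strat_scheme \<Rightarrow> ('a \<Rightarrow> 'b) \<Rightarrow> bool" where
  "strict_morphism X Y f \<longleftrightarrow>
     (\<exists>p. strat_morphism_over X Y f p \<and> (\<forall>l \<in> faces X. f ` stratum X l = stratum Y (p l)))"


section \<open>Cones and asters\<close>

text \<open>The point \<open>(1-t)* + ty\<close> of a cone is \<open>cone_pt t y\<close>, normalized so that equal points are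
  represented by equal terms.\<close>

datatype 'a cone_point = Tip | Ray real 'a

definition cone_pt :: "real \<Rightarrow> 'a \<Rightarrow> 'a cone_point" where
  "cone_pt t y = (if t = 0 then Tip else Ray t y)"

text \<open>The quotient topology from \<open>[0,1] \<times> S\<close>. If \<open>S\<close> is empty this is the one-point space.\<close>

definition cone_topology :: "'a topology \<Rightarrow> 'a cone_point topology" where
  "cone_topology S =
     coinduced_topology (insert Tip {cone_pt t y | t y. t \<in> {0..1} \<and> y \<in> topspace S})
       (prod_topology (top_of_set {0..1}) S) (\<lambda>(t, y). cone_pt t y)"

lemma topspace_cone_topology:
  "topspace (cone_topology S) = insert Tip {cone_pt t y | t y. t \<in> {0..1} \<and> y \<in> topspace S}"
  (is "_ = ?Y")
proof
  show "topspace (cone_topology S) \<subseteq> ?Y"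
    using openin_topspace[of "cone_topology S"] unfolding cone_topology_def openin_coinduced_topology
    by blast
  have "{x \<in> topspace (prod_topology (top_of_set {0..1}) S). (case x of (t, y) \<Rightarrow> cone_pt t y) \<in> ?Y} =
      topspace (prod_topology (top_of_set {0..1}) S)"
    by auto
  then have "openin (cone_topology S) ?Y"
    unfolding cone_topology_def openin_coinduced_topology by (simp only: openin_topspace order_refl simp_thms)
  then show "?Y \<subseteq> topspace (cone_topology S)"
    by (rule openin_subset)
qed

text \<open>\<open>Base l\<close> and \<open>Inner l\<close> stand for \<open>(l, b)\<close> and \<open>(l, i)\<close>.\<close>

datatype 'l cone_face = Apex | Base 'l | Inner 'l

definition cone_poset :: "'l rel \<Rightarrow> 'l cone_face rel" where
  "cone_poset r =
     {(Apex, Apex)} \<union> {(Apex, Inner l) | l. l \<in> Field r} \<union>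
     {(Base l, Base m) | l m. (l, m) \<in> r} \<union> {(Base l, Inner m) | l m. (l, m) \<in> r} \<union>
     {(Inner l, Inner m) | l m. (l, m) \<in> r}"

definition strat_cone :: "('a, 'l, 'z) strat_scheme \<Rightarrow> ('a cone_point, 'l cone_face) strat" where
  "strat_cone S =
     \<lparr>sspace = cone_topology (sspace S),
      sposet = cone_poset (face_poset S),
      smap = (\<lambda>d. case d of Tip \<Rightarrow> Apex
                | Ray t y \<Rightarrow> if t < 1 then Inner (smap S y) else Base (smap S y))\<rparr>"

definition aster :: "('a, 'l, 'z) strat_scheme \<Rightarrow> 'a cone_point set \<Rightarrow> bool" where
  "aster S D \<longleftrightarrow>
     D \<subseteq> topspace (sspace (strat_cone S)) \<and>
     (\<forall>y \<in> topspace (sspace S). \<forall>t \<in> {0..1}. \<forall>t' \<in> {0..t}. cone_pt t y \<in> D \<longrightarrow> cone_pt t' y \<in> D)"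

definition aster_boundary :: "'a cone_point set \<Rightarrow> 'a cone_point set" where
  "aster_boundary D = D \<inter> range (cone_pt 1)"

definition aster_interior :: "'a cone_point set \<Rightarrow> 'a cone_point set" where
  "aster_interior D = D - aster_boundary D"


section \<open>Stellar stratified spaces\<close>

record ('a, 'l, 's, 'k) stellar = "('a, 'l) strat" +
  sph :: "'l \<Rightarrow> ('s, 'k) strat"
  ast :: "'l \<Rightarrow> 's cone_point set"
  char_map :: "'l \<Rightarrow> 's cone_point \<Rightarrow> 'a"

definition ast_strat :: "('a, 'l, 's, 'k, 'z) stellar_scheme \<Rightarrow> 'l \<Rightarrow> ('s cone_point, 'k cone_face) strat" where
  "ast_strat X l = substrat (strat_cone (sph X l)) (ast X l)"

definition ast_bd_strat :: "('a, 'l, 's, 'k, 'z) stellar_scheme \<Rightarrow> 'l \<Rightarrow> ('s cone_point, 'k cone_face) strat" where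
  "ast_bd_strat X l = substrat (strat_cone (sph X l)) (aster_boundary (ast X l))"

definition ast_int_strat :: "('a, 'l, 's, 'k, 'z) stellar_scheme \<Rightarrow> 'l \<Rightarrow> ('s cone_point, 'k cone_face) strat" where
  "ast_int_strat X l = substrat (strat_cone (sph X l)) (aster_interior (ast X l))"

definition stellar_structure_at :: "('a, 'l, 's, 'k, 'z) stellar_scheme \<Rightarrow> 'l \<Rightarrow> bool" where
  "stellar_structure_at X l \<longleftrightarrow>
     stratified_space (sph X l) \<and> aster (sph X l) (ast X l) \<and>
     strat_morphism (ast_strat X l) (substrat X (closed_stratum X l)) (char_map X l) \<and>
     quotient_map (sspace (ast_strat X l)) (subtopology (sspace X) (closed_stratum X l)) (char_map X l) \<and>
     homeomorphic_map (sspace (ast_int_strat X l)) (subtopology (sspace X) (stratum X l)) (char_map X l)"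

definition stellar_stratified_space :: "('a, 'l, 's, 'k, 'z) stellar_scheme \<Rightarrow> bool" where
  "stellar_stratified_space X \<longleftrightarrow>
     stratified_space X \<and>
     (\<forall>l \<in> faces X. stellar_structure_at X l) \<and>
     (\<forall>l \<in> faces X. stratum_boundary X l \<subseteq> (\<Union>m \<in> {m. (m, l) \<in> face_poset X \<and> m \<noteq> l}. stratum X m))"


section \<open>Cylindrically normal stellar stratified spaces\<close>

record ('a, 'l, 's, 'k, 'p) cyl = "('a, 'l, 's, 'k) stellar" +
  par :: "'l \<Rightarrow> 'l \<Rightarrow> 'p topology"
  bmap :: "'l \<Rightarrow> 'l \<Rightarrow> 'p \<times> 's cone_point \<Rightarrow> 's cone_point"
  cmap :: "'l \<Rightarrow> 'l \<Rightarrow> 'l \<Rightarrow> 'p \<times> 'p \<Rightarrow> 'p"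

definition bd_face :: "('a, 'l, 'z) strat_scheme \<Rightarrow> 'l \<Rightarrow> 'l \<Rightarrow> bool" where
  "bd_face X m l \<longleftrightarrow> m \<in> faces X \<and> l \<in> faces X \<and> stratum X m \<subseteq> stratum_boundary X l"

text \<open>Equivalently, the closed stratum of \<open>m\<close> is contained in that of \<open>l\<close>.\<close>

definition cl_face :: "('a, 'l, 'z) strat_scheme \<Rightarrow> 'l \<Rightarrow> 'l \<Rightarrow> bool" where
  "cl_face X m l \<longleftrightarrow> m \<in> faces X \<and> l \<in> faces X \<and> stratum X m \<subseteq> closed_stratum X l"

text \<open>\<open>bmap\<close> extended to \<open>m = l\<close> by the projection \<open>P\<^sub>l\<^sub>l \<times> D\<^sub>l \<cong> D\<^sub>l\<close>. With this convention the
  compatibility of \<open>bmap\<close> and \<open>cmap\<close> makes the points of the \<open>P\<^sub>l\<^sub>l\<close> units for \<open>cmap\<close>, so that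
  the face category has identities.\<close>

definition bmap' ::
    "('a, 'l, 's, 'k, 'p, 'z) cyl_scheme \<Rightarrow> 'l \<Rightarrow> 'l \<Rightarrow> 'p \<times> 's cone_point \<Rightarrow> 's cone_point" where
  "bmap' X m l = (if m = l then snd else bmap X m l)"

text \<open>Strictness of \<open>bmap X m l\<close> is strictness as a morphism onto its image, a subspace of the
  boundary of \<open>D\<^sub>l\<close>. Strictness as a morphism to the whole boundary would force all composition maps
  \<open>cmap\<close> to be surjective (lemma \<open>strict_imp_cmap_surj\<close> below), which face categories do not
  satisfy in general. That the strata in the image of \<open>P\<^sub>m\<^sub>l \<times> Int D\<^sub>m\<close> are entire strata of the boundary
  is part of the last clause, which spells out that the decomposition
  \<open>\<partial>D\<^sub>l = \<Union>\<^sub>m bmap X m l (P\<^sub>m\<^sub>l \<times> Int D\<^sub>m)\<close> is one of stratified spaces: the strata on the left are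
  exactly the images of the strata on the right.\<close>

definition cylindrical_structure :: "('a, 'l, 's, 'k, 'p, 'z) cyl_scheme \<Rightarrow> bool" where
  "cylindrical_structure X \<longleftrightarrow>
     (\<forall>l \<in> faces X. \<exists>p. topspace (par X l l) = {p}) \<and>
     (\<forall>m l. bd_face X m l \<longrightarrow>
        bmap X m l ` (topspace (par X m l) \<times> ast X m) \<subseteq> aster_boundary (ast X l) \<and>
        strict_morphism (cylinder (par X m l) (ast_strat X m))
          (substrat (ast_bd_strat X l) (bmap X m l ` (topspace (par X m l) \<times> ast X m)))
          (bmap X m l)) \<and>
     (\<forall>l0 l1 l2. cl_face X l0 l1 \<longrightarrow> cl_face X l1 l2 \<longrightarrow>
        continuous_map (prod_topology (par X l1 l2) (par X l0 l1)) (par X l0 l2) (cmap X l0 l1 l2)) \<and>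
     (\<forall>m l. bd_face X m l \<longrightarrow>
        embedding_map (prod_topology (par X m l) (sspace (ast_int_strat X m))) (sspace (ast_bd_strat X l))
          (bmap X m l)) \<and>
     (\<forall>m l. bd_face X m l \<longrightarrow>
        (\<forall>p \<in> topspace (par X m l). \<forall>d \<in> ast X m. char_map X l (bmap X m l (p, d)) = char_map X m d)) \<and>
     (\<forall>l0 l1 l2. cl_face X l0 l1 \<longrightarrow> cl_face X l1 l2 \<longrightarrow>
        (\<forall>q \<in> topspace (par X l1 l2). \<forall>p \<in> topspace (par X l0 l1). \<forall>d \<in> ast X l0.
           bmap' X l1 l2 (q, bmap' X l0 l1 (p, d)) = bmap' X l0 l2 (cmap X l0 l1 l2 (q, p), d))) \<and>
     (\<forall>l0 l1 l2 l3. cl_face X l0 l1 \<longrightarrow> cl_face X l1 l2 \<longrightarrow> cl_face X l2 l3 \<longrightarrow>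
        (\<forall>r \<in> topspace (par X l2 l3). \<forall>q \<in> topspace (par X l1 l2). \<forall>p \<in> topspace (par X l0 l1).
           cmap X l0 l1 l3 (cmap X l1 l2 l3 (r, q), p) = cmap X l0 l2 l3 (r, cmap X l0 l1 l2 (q, p)))) \<and>
     (\<forall>l \<in> faces X.
        aster_boundary (ast X l) =
          (\<Union>m \<in> {m. bd_face X m l}. bmap X m l ` (topspace (par X m l) \<times> aster_interior (ast X m))) \<and>
        stratum (ast_bd_strat X l) ` faces (ast_bd_strat X l) =
          (\<Union>m \<in> {m. bd_face X m l}.
             (\<lambda>k. bmap X m l ` stratum (cylinder (par X m l) (ast_int_strat X m)) k) `
               faces (cylinder (par X m l) (ast_int_strat X m))))"

definition CNSSS :: "('a, 'l, 's, 'k, 'p, 'z) cyl_scheme \<Rightarrow> bool" where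
  "CNSSS X \<longleftrightarrow>
     stellar_stratified_space X \<and> normal_stratification X \<and> cylindrical_structure X"

lemma strict_imp_cmap_surj:
  fixes X :: "('a, 'l, 's, 'k, 'p, 'z) cyl_scheme"
  assumes X: "CNSSS X"
    and strict: "\<And>m l. bd_face X m l \<Longrightarrow>
      strict_morphism (cylinder (par X m l) (ast_strat X m)) (ast_bd_strat X l) (bmap X m l)"
    and bd: "bd_face X l0 l1" "bd_face X l1 l2" "bd_face X l0 l2"
    and ne: "topspace (par X l0 l1) \<noteq> {}" "topspace (par X l1 l2) \<noteq> {}"
  shows "cmap X l0 l1 l2 ` (topspace (par X l1 l2) \<times> topspace (par X l0 l1)) = topspace (par X l0 l2)"
proof
  have cyl: "cylindrical_structure X" and st: "stellar_stratified_space X"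
    using X by (auto simp: CNSSS_def)
  note r2 = cyl[unfolded cylindrical_structure_def, THEN conjunct2, THEN conjunct2]
  note c_cont = r2[THEN conjunct1] and r3 = r2[THEN conjunct2]
  note b_emb = r3[THEN conjunct1] and r4 = r3[THEN conjunct2]
  note b_char = r4[THEN conjunct1] and r5 = r4[THEN conjunct2]
  note b_comp = r5[THEN conjunct1] and b_cover = r5[THEN conjunct2, THEN conjunct2]
  have cl: "cl_face X m l" if "bd_face X m l" for m l
    using that by (auto simp: bd_face_def cl_face_def stratum_boundary_def)
  have in_int: "char_map X l ` aster_interior (ast X l) = stratum X l"
    and ast_sub: "ast X l \<subseteq> topspace (sspace (strat_cone (sph X l)))" if "l \<in> faces X" for l
  proof -
    have l: "stellar_structure_at X l" using st that by (auto simp: stellar_stratified_space_def)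
    then show "ast X l \<subseteq> topspace (sspace (strat_cone (sph X l)))"
      by (simp add: stellar_structure_at_def aster_def)
    then have "topspace (sspace (ast_int_strat X l)) = aster_interior (ast X l)"
      by (auto simp: ast_int_strat_def substrat_def aster_interior_def)
    then show "char_map X l ` aster_interior (ast X l) = stratum X l"
      using homeomorphic_imp_surjective_map[of "sspace (ast_int_strat X l)"
          "subtopology (sspace X) (stratum X l)" "char_map X l"] l
      by (simp add: stellar_structure_at_def stratum_def Int_absorb1 Collect_mono)
  qed
  have fac: "l0 \<in> faces X" "l1 \<in> faces X" "l2 \<in> faces X"
    using bd by (auto simp: bd_face_def)
  have neq: "m \<noteq> l" if "bd_face X m l" for m l
    using that by (auto simp: bd_face_def stratum_boundary_def stratum_def faces_def)
  have phi: "char_map X l (bmap X m l (p, d)) = char_map X m d"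
    if "bd_face X m l" "p \<in> topspace (par X m l)" "d \<in> ast X m" for m l p d
    using b_char that by blast
  have comp: "bmap X l1 l2 (q, bmap X l0 l1 (p, d)) = bmap X l0 l2 (cmap X l0 l1 l2 (q, p), d)"
    if "q \<in> topspace (par X l1 l2)" "p \<in> topspace (par X l0 l1)" "d \<in> ast X l0" for q p d
  proof -
    have "bmap' X l1 l2 (q, bmap' X l0 l1 (p, d)) = bmap' X l0 l2 (cmap X l0 l1 l2 (q, p), d)"
      using b_comp[rule_format, OF cl[OF bd(1)] cl[OF bd(2)]] that by blast
    then show ?thesis using neq bd by (simp add: bmap'_def)
  qed
  have cmap: "cmap X l0 l1 l2 (q, p) \<in> topspace (par X l0 l2)"
    if "q \<in> topspace (par X l1 l2)" "p \<in> topspace (par X l0 l1)" for q p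
  proof -
    have "continuous_map (prod_topology (par X l1 l2) (par X l0 l1)) (par X l0 l2) (cmap X l0 l1 l2)"
      using c_cont[rule_format, OF cl[OF bd(1)] cl[OF bd(2)]] .
    then show ?thesis using that by (auto simp: continuous_map_def)
  qed
  then show "cmap X l0 l1 l2 ` (topspace (par X l1 l2) \<times> topspace (par X l0 l1)) \<subseteq> topspace (par X l0 l2)"
    by auto
  have bdry: "aster_boundary (ast X l) =
      (\<Union>m \<in> {m. bd_face X m l}. bmap X m l ` (topspace (par X m l) \<times> aster_interior (ast X m)))"
    if "l \<in> faces X" for l
    using b_cover[rule_format, OF that] by (rule conjunct1)
  have tip: "Tip \<notin> aster_boundary A" for A :: "'s cone_point set"
    by (auto simp: aster_boundary_def cone_pt_def)
  have tip0: "Tip \<in> aster_interior (ast X l0)"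
  proof -
    have "stratum X l0 \<noteq> {}" using fac by (auto simp: faces_def stratum_def)
    then obtain d where d: "d \<in> ast X l0" using in_int[OF fac(1)] by (auto simp: aster_interior_def)
    have a: "aster (sph X l0) (ast X l0)"
      using st fac by (auto simp: stellar_stratified_space_def stellar_structure_at_def)
    from a d have "d \<in> insert Tip {cone_pt t y | t y. t \<in> {0..1} \<and> y \<in> topspace (sspace (sph X l0))}"
      by (auto simp: aster_def strat_cone_def topspace_cone_topology)
    then have "Tip \<in> ast X l0"
    proof (elim insertE CollectE exE conjE)
      fix t y assume "d = cone_pt t y" "t \<in> {0..1}" "y \<in> topspace (sspace (sph X l0))"
      then have "cone_pt 0 y \<in> ast X l0"
        using a d unfolding aster_def by auto
      then show ?thesis by (simp add: cone_pt_def)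
    qed (use d in simp)
    with tip show ?thesis by (simp add: aster_interior_def)
  qed
  have topA: "topspace (sspace (ast_strat X l)) = ast X l" if "l \<in> faces X" for l
    using ast_sub[OF that] by (auto simp: ast_strat_def substrat_def)
  have cyl_stratum: "stratum (cylinder (par X m l) (ast_strat X m)) k =
      topspace (par X m l) \<times> {d \<in> ast X m. smap (strat_cone (sph X m)) d = k}"
    if "m \<in> faces X" for m l k
    using topA[OF that] by (auto simp: stratum_def cylinder_def ast_strat_def substrat_def)
  have Tip_ast: "Tip \<in> ast X l0" using tip0 by (simp add: aster_interior_def)
  have int_b: "d \<in> aster_boundary A \<longleftrightarrow> (\<exists>k. smap (strat_cone S) d = Base k)"
    if "d \<in> A" "A \<subseteq> topspace (sspace (strat_cone S))" for d A and S :: "('s, 'k) strat"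
  proof (cases d)
    case Tip
    then show ?thesis using tip by (auto simp: strat_cone_def)
  next
    case (Ray t y)
    have "d \<in> insert Tip {cone_pt t y | t y. t \<in> {0..1} \<and> y \<in> topspace (sspace S)}"
      using that by (auto simp: strat_cone_def topspace_cone_topology)
    then have "t \<le> 1" "t \<noteq> 0" using Ray by (auto simp: cone_pt_def split: if_splits)
    then show ?thesis using Ray that by (auto simp: strat_cone_def aster_boundary_def cone_pt_def)
  qed
  show "topspace (par X l0 l2) \<subseteq> cmap X l0 l1 l2 ` (topspace (par X l1 l2) \<times> topspace (par X l0 l1))"
  proof
    fix r assume r: "r \<in> topspace (par X l0 l2)"
    obtain p q where p: "p \<in> topspace (par X l0 l1)" and q: "q \<in> topspace (par X l1 l2)"
      using ne by blast
    define d1 where "d1 = bmap X l0 l1 (p, Tip)"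
    have d1: "d1 \<in> aster_boundary (ast X l1)"
      using bdry[OF fac(2)] bd(1) p tip0 unfolding d1_def by blast
    then have d1A: "d1 \<in> ast X l1" by (simp add: aster_boundary_def)
    let ?k = "smap (strat_cone (sph X l1)) d1"
    let ?s1 = "stratum (cylinder (par X l1 l2) (ast_strat X l1)) ?k"
    let ?s0 = "stratum (cylinder (par X l0 l2) (ast_strat X l0)) (smap (strat_cone (sph X l0)) Tip)"
    have str: "\<exists>t. bmap X m l ` stratum (cylinder (par X m l) (ast_strat X m)) k = stratum (ast_bd_strat X l) t"
      if "bd_face X m l" "k \<in> faces (cylinder (par X m l) (ast_strat X m))" for m l k
      using strict[OF that(1)] that(2) unfolding strict_morphism_def by blast
    have in_s1: "(q, d1) \<in> ?s1" using cyl_stratum fac q d1A by auto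
    have in_s0: "(r', Tip) \<in> ?s0" if "r' \<in> topspace (par X l0 l2)" for r'
      using cyl_stratum fac that Tip_ast by auto
    have face: "k \<in> faces Z" if "z \<in> stratum Z k" for z k and Z :: "('b, 'c) strat"
      using that by (auto simp: stratum_def faces_def)
    obtain t1 where t1: "bmap X l1 l2 ` ?s1 = stratum (ast_bd_strat X l2) t1"
      using str[OF bd(2)] face[OF in_s1] by blast
    obtain t0 where t0: "bmap X l0 l2 ` ?s0 = stratum (ast_bd_strat X l2) t0"
      using str[OF bd(3)] face[OF in_s0[OF r]] by blast
    have "bmap X l1 l2 (q, d1) = bmap X l0 l2 (cmap X l0 l1 l2 (q, p), Tip)"
      using comp[OF q p Tip_ast] by (simp add: d1_def)
    then have "bmap X l1 l2 (q, d1) \<in> stratum (ast_bd_strat X l2) t1 \<inter> stratum (ast_bd_strat X l2) t0"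
      using in_s1 in_s0[OF cmap[OF q p]] t1 t0 by (metis IntI imageI)
    then have "t1 = t0" by (auto simp: stratum_def)
    then obtain z where z: "z \<in> ?s1" "bmap X l0 l2 (r, Tip) = bmap X l1 l2 z"
      using t0 t1 in_s0[OF r] by (metis (no_types, lifting) imageE imageI)
    then obtain q' d' where z': "z = (q', d')" "q' \<in> topspace (par X l1 l2)" "d' \<in> ast X l1"
        "smap (strat_cone (sph X l1)) d' = ?k"
      using cyl_stratum[OF fac(2)] by auto
    then have "d' \<in> aster_boundary (ast X l1)"
      using d1 d1A int_b ast_sub[OF fac(2)] by metis
    then obtain m p' d'' where m: "bd_face X m l1" "p' \<in> topspace (par X m l1)"
        "d'' \<in> aster_interior (ast X m)" "d' = bmap X m l1 (p', d'')"
      using bdry[OF fac(2)] by auto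
    have mf: "m \<in> faces X" using m by (simp add: bd_face_def)
    have "char_map X l0 Tip = char_map X l2 (bmap X l0 l2 (r, Tip))"
      using phi[OF bd(3) r Tip_ast] by simp
    also have "\<dots> = char_map X l1 d'" using phi[OF bd(2)] z z' by simp
    also have "\<dots> = char_map X m d''" using phi m by (simp add: aster_interior_def)
    finally have "stratum X l0 \<inter> stratum X m \<noteq> {}"
      using in_int[OF fac(1)] in_int[OF mf] tip0 m(3) by blast
    then have "m = l0" by (auto simp: stratum_def)
    with m have p': "p' \<in> topspace (par X l0 l1)" and d'': "d'' \<in> aster_interior (ast X l0)"
      and d': "d' = bmap X l0 l1 (p', d'')" by auto
    have "bmap X l0 l2 (r, Tip) = bmap X l0 l2 (cmap X l0 l1 l2 (q', p'), d'')"
      using z z' d' comp[OF z'(2) p'] d'' by (simp add: aster_interior_def)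
    moreover have "inj_on (bmap X l0 l2) (topspace (par X l0 l2) \<times> aster_interior (ast X l0))"
    proof -
      have "embedding_map (prod_topology (par X l0 l2) (sspace (ast_int_strat X l0)))
          (sspace (ast_bd_strat X l2)) (bmap X l0 l2)"
        using b_emb[rule_format, OF bd(3)] .
      moreover have "topspace (sspace (ast_int_strat X l0)) = aster_interior (ast X l0)"
        using ast_sub[OF fac(1)] by (auto simp: ast_int_strat_def substrat_def aster_interior_def)
      ultimately show ?thesis
        by (auto simp: embedding_map_def dest!: homeomorphic_imp_injective_map)
    qed
    ultimately have "r = cmap X l0 l1 l2 (q', p')"
      using r tip0 d'' cmap[OF z'(2) p'] by (auto dest!: inj_onD)
    then show "r \<in> cmap X l0 l1 l2 ` (topspace (par X l1 l2) \<times> topspace (par X l0 l1))"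
      using z' p' by auto
  qed
qed

text \<open>The stratum \<open>stratum X l\<close> is represented by its index \<open>l \<in> faces X\<close>.\<close>

definition face_category ::
    "('a, 'l, 's, 'k, 'p, 'z) cyl_scheme \<Rightarrow> ('l, ('l \<times> 'l) \<times> 'p) topcat" where
  "face_category X =
     \<lparr>Obj = discrete_topology (faces X),
      Mor = sum_topology (\<lambda>(m, l). par X m l) {(m, l). cl_face X m l},
      src = (\<lambda>((m, l), p). m),
      tgt = (\<lambda>((m, l), p). l),
      ident = (\<lambda>l. ((l, l), THE p. p \<in> topspace (par X l l))),
      cmp = (\<lambda>((l1, l2), q) ((l0, l1'), p). ((l0, l2), cmap X l0 l1 l2 (q, p)))\<rparr>"

end

theory Submission
  imports Defs "HOL-Analysis.Analysis"
begin

text \<open>A point of the classifying space is a finite chain of objects with positive weights together with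
  all the morphisms that the chain determines between these objects. Its stratum is the top object of
  the chain. For an object \<open>x\<close> let the star of \<open>x\<close> be the space of weighted chains in the objects below
  \<open>x\<close> that are also equipped with morphisms to \<open>x\<close>, even if \<open>x\<close> has weight 0, and let the link of \<open>x\<close> be
  the subspace where \<open>x\<close> has weight 0. Moving weight to \<open>x\<close> shows that the star is the cone over the link,
  and forgetting the morphisms to \<open>x\<close> of an element of the link gives the characteristic map. A morphism
  \<open>m \<rightarrow> l\<close> attaches the star of \<open>m\<close> to the link of \<open>l\<close> by composition, and every element of the link of \<open>l\<close>
  arises in this way from the interior of the star of its top object \<open>m\<close> and a unique \<open>m \<rightarrow> l\<close>.

  Weights and morphisms are continuous invariants that separate points, so the classifying space and
  the stars are Hausdorff. Since only finitely many objects lie below \<open>x\<close>, stars are compact. Hence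
  every continuous map in sight is closed, which yields the quotient maps and embeddings.\<close>

section \<open>Quotients, compactness and sums\<close>

text \<open>Equality in the realization is generated by zigzags of simplicial operators. A complete
  invariant exists because acyclicity makes every composite in a chain depend only on its two end
  objects: a set of morphisms, without any positions, records everything. Quotient topologies behave
  badly under products. This is why compactness is arranged for the spaces of representatives
  already, and not only for the stars. A star cannot be taken inside the classifying space, since
  points of the link of \<open>x\<close> that differ only in their morphisms to \<open>x\<close>
  have the same image there. The mark at \<open>x\<close> keeps them apart. The strata of a link are
  indexed by supports rather than by top objects. The interior of a star is already divided into its
  tip and the open rays over the faces of its link, and the images of these pieces have to be strata
  of the boundary of the larger star. The support of a point determines both its top object and the
  piece of the star of that object in which it lies.\<close>

lemma topspace_coinduced_topology:
  assumes "f \<in> topspace X \<rightarrow> Y"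
  shows "topspace (coinduced_topology Y X f) = Y"
proof -
  have "{x \<in> topspace X. f x \<in> Y} = topspace X" using assms by auto
  then have "openin (coinduced_topology Y X f) Y" by (simp add: openin_coinduced_topology)
  then show ?thesis
    by (metis openin_coinduced_topology openin_subset openin_topspace subset_antisym)
qed

lemma quotient_map_coinduced_topology:
  "quotient_map X (coinduced_topology (f ` topspace X) X f) f"
proof -
  have "topspace (coinduced_topology (f ` topspace X) X f) = f ` topspace X"
    by (rule topspace_coinduced_topology) auto
  then show ?thesis
    unfolding quotient_map_def by (auto simp: openin_coinduced_topology)
qed

text \<open>\<open>q\<close> and \<open>i\<close> have the same fibres, so the preimage of any set
  under \<open>i\<close> is saturated for \<open>q\<close>, and its image under \<open>q\<close> is
  open as soon as it is open itself. Separation in the quotient thus reduces to separating values of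
  the invariant \<open>i\<close>, whose type carries no topology.\<close>

lemma Hausdorff_quotient:
  assumes q: "quotient_map X Y q"
    and eq: "\<And>a b. a \<in> topspace X \<Longrightarrow> b \<in> topspace X \<Longrightarrow> q a = q b \<longleftrightarrow> i a = i b"
    and sep: "\<And>a b. a \<in> topspace X \<Longrightarrow> b \<in> topspace X \<Longrightarrow> i a \<noteq> i b \<Longrightarrow>
      \<exists>P Q. openin X {x \<in> topspace X. i x \<in> P} \<and> openin X {x \<in> topspace X. i x \<in> Q} \<and>
        i a \<in> P \<and> i b \<in> Q \<and> P \<inter> Q = {}"
  shows "Hausdorff_space Y"
  unfolding Hausdorff_space_def
proof (intro allI impI, elim conjE)
  fix y z assume y: "y \<in> topspace Y" and z: "z \<in> topspace Y" and ne: "y \<noteq> z"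
  have surj: "q ` topspace X = topspace Y" using q by (simp add: quotient_map_def)
  obtain a b where a: "a \<in> topspace X" "q a = y" and b: "b \<in> topspace X" "q b = z"
    using y z surj by (metis imageE)
  with ne eq have "i a \<noteq> i b" by metis
  then obtain P Q where PQ: "openin X {x \<in> topspace X. i x \<in> P}" "openin X {x \<in> topspace X. i x \<in> Q}"
    "i a \<in> P" "i b \<in> Q" "P \<inter> Q = {}"
    using sep a b by meson
  have op: "openin Y (q ` {x \<in> topspace X. i x \<in> R})" if R: "openin X {x \<in> topspace X. i x \<in> R}" for R
  proof -
    let ?U = "q ` {x \<in> topspace X. i x \<in> R}"
    have "{x \<in> topspace X. q x \<in> ?U} = {x \<in> topspace X. i x \<in> R}"
      by (auto simp: eq)
    then have "openin X {x \<in> topspace X. q x \<in> ?U}" using R by (simp only:)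
    moreover have "?U \<subseteq> topspace Y" using surj by auto
    ultimately show ?thesis using q by (simp only: quotient_map_def)
  qed
  have "disjnt (q ` {x \<in> topspace X. i x \<in> P}) (q ` {x \<in> topspace X. i x \<in> Q})"
    using PQ(5) by (auto simp: disjnt_def eq)
  then show "\<exists>U V. openin Y U \<and> openin Y V \<and> y \<in> U \<and> z \<in> V \<and> disjnt U V"
    using op PQ a b by blast
qed

text \<open>A closed map stays closed when it is restricted to a full preimage. The set
  \<open>A\<close> will be an open part such as the interior of a cone, which need not be compact;
  saturation takes the place of its compactness.\<close>

lemma compact_Hausdorff_restriction:
  assumes X: "compact_space X" and Y: "Hausdorff_space Y" and f: "continuous_map X Y f"
    and A: "A \<subseteq> topspace X" and inj: "inj_on f A"
    and sat: "\<And>x. x \<in> topspace X \<Longrightarrow> f x \<in> f ` A \<Longrightarrow> x \<in> A"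
  shows "homeomorphic_map (subtopology X A) (subtopology Y (f ` A)) f"
proof -
  have "closed_map X Y f" using X Y f by (simp add: T1_Spaces.continuous_imp_closed_map)
  moreover have "{x \<in> topspace X. f x \<in> f ` A} = A" using A sat by auto
  ultimately have cl: "closed_map (subtopology X A) (subtopology Y (f ` A)) f"
    by (rule closed_map_restriction)
  have co: "continuous_map (subtopology X A) (subtopology Y (f ` A)) f"
    using A f by (auto simp: continuous_map_in_subtopology continuous_map_from_subtopology)
  have "f ` A \<subseteq> topspace Y" using A f by (auto simp: continuous_map_def)
  then have "f ` topspace (subtopology X A) = topspace (subtopology Y (f ` A))"
    using A by (auto simp: Int_absorb1)
  moreover have "inj_on f (topspace (subtopology X A))"
    using inj A by (simp add: Int_absorb1)
  ultimately show ?thesis by (rule bijective_closed_imp_homeomorphic_map[OF co cl])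
qed

lemma continuous_map_from_sum:
  assumes "\<And>k. continuous_map (X k) Y (\<lambda>p. f (k, p))"
  shows "continuous_map (sum_topology X UNIV) Y f"
  unfolding continuous_map_def
proof (intro conjI allI impI)
  show "f \<in> topspace (sum_topology X UNIV) \<rightarrow> topspace Y"
  proof
    fix x assume "x \<in> topspace (sum_topology X UNIV)"
    then have "snd x \<in> topspace (X (fst x))" by auto
    from funcset_mem[OF continuous_map_funspace[OF assms] this] show "f x \<in> topspace Y" by simp
  qed
  fix U assume U: "openin Y U"
  have "{p. (k, p) \<in> {p \<in> topspace (sum_topology X UNIV). f p \<in> U}} = {p \<in> topspace (X k). f (k, p) \<in> U}" for k
    by auto
  then show "openin (sum_topology X UNIV) {p \<in> topspace (sum_topology X UNIV). f p \<in> U}"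
    unfolding openin_sum_topology using openin_continuous_map_preimage[OF assms U] by auto
qed

lemma image_Times_snd: "(\<lambda>(a, b). (a, f b)) ` (A \<times> B) = A \<times> f ` B"
proof (intro equalityI subsetI)
  fix z assume "z \<in> A \<times> f ` B"
  then obtain a b where "a \<in> A" "b \<in> B" "z = (a, f b)" by blast
  then show "z \<in> (\<lambda>(a, b). (a, f b)) ` (A \<times> B)" by (intro image_eqI[of _ _ "(a, b)"]) auto
qed auto

section \<open>Alexandroff spaces and generic points\<close>

lemma topspace_alexandroff: "topspace (alexandroff r) = Field r"
proof
  show "topspace (alexandroff r) \<subseteq> Field r"
    using openin_topspace[of "alexandroff r"] unfolding openin_alexandroff by blast
  have "openin (alexandroff r) (Field r)" by (auto simp: openin_alexandroff Field_def)
  then show "Field r \<subseteq> topspace (alexandroff r)" by (rule openin_subset)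
qed

lemma continuous_map_alexandroff:
  "continuous_map X (alexandroff r) f \<longleftrightarrow>
     f \<in> topspace X \<rightarrow> Field r \<and>
     (\<forall>U. U \<subseteq> Field r \<longrightarrow> (\<forall>x y. x \<in> U \<longrightarrow> (x, y) \<in> r \<longrightarrow> y \<in> U) \<longrightarrow> openin X {x \<in> topspace X. f x \<in> U})"
  unfolding continuous_map_def openin_alexandroff topspace_alexandroff imp_conjL by (rule refl)

text \<open>A point of a poset is its up-set, which is open, intersected with its down-set, which is
  closed, and both pull back along \<open>f\<close>.\<close>

lemma locally_closedin_alexandroff_fibre:
  assumes f: "continuous_map X (alexandroff r) f" and r: "Partial_order r" and l: "l \<in> Field r"
  shows "locally_closedin X {x \<in> topspace X. f x = l}"
proof -
  have tr: "trans r" and an: "antisym r" and re: "\<And>x. x \<in> Field r \<Longrightarrow> (x, x) \<in> r"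
    using r by (auto simp: partial_order_on_def preorder_on_def refl_on_def)
  let ?U = "{x \<in> topspace X. f x \<in> {k. (l, k) \<in> r}}"
  let ?V = "{x \<in> topspace X. f x \<in> {k \<in> Field r. (k, l) \<notin> r}}"
  have U: "openin X ?U"
  proof -
    have "\<forall>x y. x \<in> {k. (l, k) \<in> r} \<longrightarrow> (x, y) \<in> r \<longrightarrow> y \<in> {k. (l, k) \<in> r}"
      using tr by (auto dest: transD)
    moreover have "{k. (l, k) \<in> r} \<subseteq> Field r" by (auto simp: FieldI2)
    ultimately show ?thesis using f unfolding continuous_map_alexandroff by presburger
  qed
  have "openin X ?V"
  proof -
    have "\<forall>x y. x \<in> {k \<in> Field r. (k, l) \<notin> r} \<longrightarrow> (x, y) \<in> r \<longrightarrow> y \<in> {k \<in> Field r. (k, l) \<notin> r}"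
      using tr by (auto simp: FieldI2 dest: transD)
    moreover have "{k \<in> Field r. (k, l) \<notin> r} \<subseteq> Field r" by auto
    ultimately show ?thesis using f unfolding continuous_map_alexandroff by presburger
  qed
  then have F: "closedin X (topspace X - ?V)" by blast
  have mem: "f x \<in> Field r" if "x \<in> topspace X" for x
    using f that unfolding continuous_map_alexandroff by auto
  have "{x \<in> topspace X. f x = l} = ?U \<inter> (topspace X - ?V)"
    using mem re[OF l] an by (auto dest: antisymD)
  with U F show ?thesis unfolding locally_closedin_def by blast
qed

text \<open>The pieces \<open>P\<^sub>m\<^sub>l \<times> Int D\<^sub>m\<close> of the boundary of \<open>D\<^sub>l\<close> are disconnected if the space of morphisms
  \<open>P\<^sub>m\<^sub>l\<close> is, whereas the strata of the stratified space \<open>S\<^sub>l\<close> with \<open>D\<^sub>l \<subseteq> cone S\<^sub>l\<close> have to be connected. So the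
  intended sphere \<open>S\<close> is enlarged by one generic point \<open>w k\<close> for each stratum \<open>k\<close>, which lies in every open
  set that meets the stratum. This makes the strata connected and the map to the poset open, and the
  cone over \<open>S\<close> is still an aster in the cone over the enlarged space.\<close>

definition gen_ext :: "'a topology \<Rightarrow> 'k rel \<Rightarrow> ('a \<Rightarrow> 'k) \<Rightarrow> ('k \<Rightarrow> 'a) \<Rightarrow> 'a topology" where
  "gen_ext S r p w = topology (\<lambda>U. U \<subseteq> topspace S \<union> w ` Field r \<and> openin S (U \<inter> topspace S) \<and>
     (\<forall>x \<in> U \<inter> topspace S. w (p x) \<in> U) \<and> (\<forall>(k, l) \<in> r. w k \<in> U \<longrightarrow> w l \<in> U))"

lemma openin_gen_ext:
  "openin (gen_ext S r p w) U \<longleftrightarrow> U \<subseteq> topspace S \<union> w ` Field r \<and> openin S (U \<inter> topspace S) \<and>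
     (\<forall>x \<in> U \<inter> topspace S. w (p x) \<in> U) \<and> (\<forall>(k, l) \<in> r. w k \<in> U \<longrightarrow> w l \<in> U)"
proof -
  let ?P = "\<lambda>U. U \<subseteq> topspace S \<union> w ` Field r \<and> openin S (U \<inter> topspace S) \<and>
     (\<forall>x \<in> U \<inter> topspace S. w (p x) \<in> U) \<and> (\<forall>(k, l) \<in> r. w k \<in> U \<longrightarrow> w l \<in> U)"
  have "?P (A \<inter> B)" if A: "?P A" and B: "?P B" for A B
  proof (intro conjI)
    have "A \<inter> B \<inter> topspace S = (A \<inter> topspace S) \<inter> (B \<inter> topspace S)" by auto
    with A B show "openin S (A \<inter> B \<inter> topspace S)" by (simp only: openin_Int)
    show "A \<inter> B \<subseteq> topspace S \<union> w ` Field r" using A by blast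
    show "\<forall>x\<in>A \<inter> B \<inter> topspace S. w (p x) \<in> A \<inter> B" using A B by blast
    show "\<forall>(k, l)\<in>r. w k \<in> A \<inter> B \<longrightarrow> w l \<in> A \<inter> B" using A B by blast
  qed
  moreover have "?P (\<Union>K)" if K: "\<forall>A\<in>K. ?P A" for K
  proof (intro conjI)
    have "\<Union>K \<inter> topspace S = (\<Union>A\<in>K. A \<inter> topspace S)" by auto
    moreover have "openin S (\<Union>A\<in>K. A \<inter> topspace S)" using K by blast
    ultimately show "openin S (\<Union>K \<inter> topspace S)" by simp
    show "\<Union>K \<subseteq> topspace S \<union> w ` Field r"
    proof (rule Union_least)
      fix A assume "A \<in> K"
      then have "?P A" using K by (rule bspec[rotated])
      then show "A \<subseteq> topspace S \<union> w ` Field r" by (rule conjunct1)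
    qed
    show "\<forall>x\<in>\<Union>K \<inter> topspace S. w (p x) \<in> \<Union>K"
    proof clarify
      fix x A assume x: "x \<in> topspace S" "A \<in> K" "x \<in> A"
      then have "?P A" using K by blast
      then show "w (p x) \<in> \<Union>K" using x by blast
    qed
    show "\<forall>(k, l)\<in>r. w k \<in> \<Union>K \<longrightarrow> w l \<in> \<Union>K"
    proof clarify
      fix k l A assume kl: "(k, l) \<in> r" "A \<in> K" "w k \<in> A"
      then have "?P A" using K by blast
      then show "w l \<in> \<Union>K" using kl by blast
    qed
  qed
  ultimately have "istopology ?P" unfolding istopology_def by blast
  then show ?thesis by (simp add: gen_ext_def)
qed

definition gen_strat :: "'a topology \<Rightarrow> 'k rel \<Rightarrow> ('a \<Rightarrow> 'k) \<Rightarrow> ('k \<Rightarrow> 'a) \<Rightarrow> ('a, 'k) strat" where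
  "gen_strat S r p w = \<lparr>sspace = gen_ext S r p w, sposet = r,
     smap = (\<lambda>x. if x \<in> topspace S then p x else the_inv_into (Field r) w x)\<rparr>"

locale generic_extension =
  fixes S :: "'a topology" and r :: "'k rel" and p :: "'a \<Rightarrow> 'k" and w :: "'k \<Rightarrow> 'a"
  assumes p: "continuous_map S (alexandroff r) p" and po: "Partial_order r"
    and inj: "inj_on w (Field r)" and disj: "w ` Field r \<inter> topspace S = {}"
begin

lemma p_in: "x \<in> topspace S \<Longrightarrow> p x \<in> Field r"
  using p by (auto simp: continuous_map_alexandroff)

lemma openin_generic: "openin (gen_ext S r p w) (w ` Field r)"
proof -
  have "w l \<in> w ` Field r" if "(k, l) \<in> r" for k l using that by (auto simp: FieldI2)
  then show ?thesis using disj by (auto simp: openin_gen_ext)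
qed

text \<open>Adjoining all generic points at once satisfies both closure conditions of
  \<open>gen_ext\<close>. So every open set of \<open>S\<close> is the trace of an open set, and
  \<open>S\<close> keeps its topology as a subspace.\<close>

lemma openin_Un_generic: "openin S V \<Longrightarrow> openin (gen_ext S r p w) (V \<union> w ` Field r)"
proof -
  assume V: "openin S V"
  then have "(V \<union> w ` Field r) \<inter> topspace S = V" using disj openin_subset[OF V] by auto
  moreover have "w l \<in> w ` Field r" if "(k, l) \<in> r" for k l using that by (auto simp: FieldI2)
  ultimately show ?thesis using V openin_subset[OF V] p_in by (auto simp: openin_gen_ext)
qed

lemma topspace_gen_ext: "topspace (gen_ext S r p w) = topspace S \<union> w ` Field r"
proof
  show "topspace (gen_ext S r p w) \<subseteq> topspace S \<union> w ` Field r"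
    using openin_topspace[of "gen_ext S r p w"] unfolding openin_gen_ext by blast
  show "topspace S \<union> w ` Field r \<subseteq> topspace (gen_ext S r p w)"
    using openin_subset[OF openin_Un_generic[OF openin_topspace]] .
qed

lemma continuous_map_inclusion: "continuous_map S (gen_ext S r p w) (\<lambda>x. x)"
  unfolding continuous_map_def
proof (intro conjI allI impI)
  fix U assume "openin (gen_ext S r p w) U"
  then have "openin S (U \<inter> topspace S)" by (simp add: openin_gen_ext)
  moreover have "{x \<in> topspace S. x \<in> U} = U \<inter> topspace S" by auto
  ultimately show "openin S {x \<in> topspace S. x \<in> U}" by simp
qed (simp add: topspace_gen_ext)

lemma smap_gen_strat:
  "x \<in> topspace S \<Longrightarrow> smap (gen_strat S r p w) x = p x"
  "k \<in> Field r \<Longrightarrow> smap (gen_strat S r p w) (w k) = k"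
proof -
  show "x \<in> topspace S \<Longrightarrow> smap (gen_strat S r p w) x = p x" by (simp add: gen_strat_def)
  show "smap (gen_strat S r p w) (w k) = k" if k: "k \<in> Field r"
  proof -
    have "w k \<notin> topspace S" using disj k by blast
    then show ?thesis by (simp add: gen_strat_def the_inv_into_f_f[OF inj k])
  qed
qed

lemma faces_gen_strat: "faces (gen_strat S r p w) = Field r"
proof -
  have "smap (gen_strat S r p w) ` (topspace S \<union> w ` Field r) = Field r"
    using smap_gen_strat p_in by (force simp: image_iff)
  then show ?thesis by (simp add: faces_def gen_strat_def topspace_gen_ext)
qed

lemma face_poset_gen_strat: "face_poset (gen_strat S r p w) = r"
  unfolding face_poset_def faces_gen_strat by (auto simp: gen_strat_def intro: FieldI1 FieldI2)

lemma stratified_space_gen_strat: "stratified_space (gen_strat S r p w)"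
proof -
  let ?G = "gen_ext S r p w" and ?m = "smap (gen_strat S r p w)"
  \<comment> \<open>The generic point of the stratum of \<open>x\<close> lies in every open set
    around \<open>x\<close>. So two open sets that meet a stratum meet each other inside it, and
    images of open sets are upward closed.\<close>
  have gen: "w (?m x) \<in> U" if "openin ?G U" "x \<in> U" for x U
  proof (cases "x \<in> topspace S")
    case True
    then have "w (p x) \<in> U" using that unfolding openin_gen_ext by blast
    then show ?thesis using True by (simp add: smap_gen_strat)
  next
    case False
    then obtain k where "k \<in> Field r" "x = w k"
      using openin_subset[OF \<open>openin ?G U\<close>] \<open>x \<in> U\<close> topspace_gen_ext by auto
    then show ?thesis using \<open>x \<in> U\<close> by (simp add: smap_gen_strat)
  qed
  have m_in: "?m x \<in> Field r" if "x \<in> topspace ?G" for x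
    using that faces_gen_strat by (auto simp: faces_def gen_strat_def)
  have cont: "continuous_map ?G (alexandroff r) ?m"
    unfolding continuous_map_alexandroff
  proof (intro conjI allI impI)
    show "?m \<in> topspace ?G \<rightarrow> Field r" using m_in by auto
    fix U assume U: "U \<subseteq> Field r" "\<forall>x y. x \<in> U \<longrightarrow> (x, y) \<in> r \<longrightarrow> y \<in> U"
    have "{x \<in> topspace ?G. ?m x \<in> U} \<inter> topspace S = {x \<in> topspace S. p x \<in> U}"
      using smap_gen_strat(1) topspace_gen_ext by auto
    moreover have "openin S {x \<in> topspace S. p x \<in> U}"
      using p U by (auto simp: continuous_map_alexandroff)
    moreover have wU: "w k \<in> {x \<in> topspace ?G. ?m x \<in> U} \<longleftrightarrow> k \<in> U" if "k \<in> Field r" for k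
      using smap_gen_strat(2) topspace_gen_ext that by auto
    moreover have "w (p x) \<in> {x \<in> topspace ?G. ?m x \<in> U}" if "x \<in> {x \<in> topspace ?G. ?m x \<in> U} \<inter> topspace S" for x
      using that wU[OF p_in] smap_gen_strat(1) by auto
    moreover have "\<forall>(k, l)\<in>r. w k \<in> {x \<in> topspace ?G. ?m x \<in> U} \<longrightarrow> w l \<in> {x \<in> topspace ?G. ?m x \<in> U}"
    proof clarify
      fix k l assume kl: "(k, l) \<in> r" "w k \<in> topspace ?G" "?m (w k) \<in> U"
      then have "k \<in> U" using smap_gen_strat(2)[OF FieldI1] by metis
      then have "l \<in> U" using U(2) kl by blast
      then show "w l \<in> topspace ?G \<and> ?m (w l) \<in> U" using wU[OF FieldI2[OF kl(1)]] by simp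
    qed
    ultimately show "openin ?G {x \<in> topspace ?G. ?m x \<in> U}"
      unfolding openin_gen_ext topspace_gen_ext by auto
  qed
  have opn: "open_map ?G (alexandroff r) ?m"
    unfolding open_map_def openin_alexandroff
  proof (intro allI impI conjI)
    fix U assume U: "openin ?G U"
    show "?m ` U \<subseteq> Field r" using m_in openin_subset[OF U] by auto
    fix k l assume "k \<in> ?m ` U" "(k, l) \<in> r"
    then have "w l \<in> U" using gen[OF U] U by (auto simp: openin_gen_ext)
    then show "l \<in> ?m ` U" using smap_gen_strat(2) FieldI2[OF \<open>(k, l) \<in> r\<close>] by force
  qed
  have str: "connectedin ?G (stratum (gen_strat S r p w) k) \<and> locally_closedin ?G (stratum (gen_strat S r p w) k)"
    if k: "k \<in> Field r" for k
  proof -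
    have st: "stratum (gen_strat S r p w) k = {x \<in> topspace ?G. ?m x = k}"
      by (auto simp: stratum_def gen_strat_def)
    have "connectedin ?G {x \<in> topspace ?G. ?m x = k}"
      unfolding connectedin
    proof (intro conjI notI)
      assume "\<exists>E1 E2. openin ?G E1 \<and> openin ?G E2 \<and> {x \<in> topspace ?G. ?m x = k} \<subseteq> E1 \<union> E2 \<and>
        E1 \<inter> E2 \<inter> {x \<in> topspace ?G. ?m x = k} = {} \<and> E1 \<inter> {x \<in> topspace ?G. ?m x = k} \<noteq> {} \<and>
        E2 \<inter> {x \<in> topspace ?G. ?m x = k} \<noteq> {}"
      then obtain E1 E2 where E: "openin ?G E1" "openin ?G E2"
        "E1 \<inter> E2 \<inter> {x \<in> topspace ?G. ?m x = k} = {}" "E1 \<inter> {x \<in> topspace ?G. ?m x = k} \<noteq> {}"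
        "E2 \<inter> {x \<in> topspace ?G. ?m x = k} \<noteq> {}" by blast
      have wk: "w k \<in> E" if "openin ?G E" "E \<inter> {x \<in> topspace ?G. ?m x = k} \<noteq> {}" for E
        using gen[OF that(1)] that(2) by blast
      have "w k \<in> E1" "w k \<in> E2" using wk E by auto
      moreover have "?m (w k) = k" "w k \<in> topspace ?G" using k smap_gen_strat(2) topspace_gen_ext by auto
      ultimately show False using E(3) by blast
    qed auto
    with locally_closedin_alexandroff_fibre[OF cont po k] show ?thesis unfolding st by simp
  qed
  have "sspace (gen_strat S r p w) = ?G" "sposet (gen_strat S r p w) = r" by (auto simp: gen_strat_def)
  then show ?thesis unfolding stratified_space_def faces_gen_strat
    using cont opn str po by simp
qed

end

section \<open>Cones\<close>

lemma openin_cone_topology: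
  "openin (cone_topology S) U \<longleftrightarrow> U \<subseteq> topspace (cone_topology S) \<and>
     openin (prod_topology (top_of_set {0..1}) S)
       {x \<in> topspace (prod_topology (top_of_set {0..1}) S). (case x of (t, y) \<Rightarrow> cone_pt t y) \<in> U}"
  unfolding topspace_cone_topology unfolding cone_topology_def openin_coinduced_topology by (rule refl)

lemma cone_pt_in_cone:
  "0 \<le> t \<Longrightarrow> t \<le> 1 \<Longrightarrow> y \<in> topspace S \<Longrightarrow> cone_pt t y \<in> topspace (cone_topology S)"
  "Tip \<in> topspace (cone_topology S)"
proof -
  show "cone_pt t y \<in> topspace (cone_topology S)" if "0 \<le> t" "t \<le> 1" "y \<in> topspace S"
    unfolding topspace_cone_topology using that by (intro insertI2 CollectI exI conjI refl) auto
  show "Tip \<in> topspace (cone_topology S)" unfolding topspace_cone_topology by (rule insertI1)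
qed

lemma cone_point_cases:
  assumes "d \<in> topspace (cone_topology S)"
  obtains "d = Tip" | t y where "0 < t" "t \<le> 1" "y \<in> topspace S" "d = Ray t y" "d = cone_pt t y"
proof (cases d)
  case Tip
  then show ?thesis by (rule that(1))
next
  case (Ray t y)
  then obtain t' y' where "d = cone_pt t' y'" "t' \<in> {0..1}" "y' \<in> topspace S"
    using assms unfolding topspace_cone_topology by blast
  moreover from this Ray have "t' \<noteq> 0" "t' = t" "y' = y" by (auto simp: cone_pt_def split: if_splits)
  ultimately show ?thesis using that(2)[of t y] Ray by (simp add: cone_pt_def)
qed

lemma continuous_map_cone_pt:
  "continuous_map (prod_topology (top_of_set {0..1}) S) (cone_topology S) (\<lambda>(t, y). cone_pt t y)"
  unfolding continuous_map_def
proof (intro conjI allI impI)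
  show "(\<lambda>(t, y). cone_pt t y) \<in> topspace (prod_topology (top_of_set {0..1}) S) \<rightarrow> topspace (cone_topology S)"
    by (auto simp: cone_pt_in_cone)
  fix U assume "openin (cone_topology S) U"
  then show "openin (prod_topology (top_of_set {0..1}) S)
      {x \<in> topspace (prod_topology (top_of_set {0..1}) S). (case x of (t, y) \<Rightarrow> cone_pt t y) \<in> U}"
    by (simp add: openin_cone_topology)
qed

lemma continuous_map_from_cone:
  assumes tip: "f Tip \<in> topspace Z"
    and ray: "continuous_map (prod_topology (top_of_set {0..1}) S) Z (\<lambda>(t, y). f (cone_pt t y))"
  shows "continuous_map (cone_topology S) Z f"
  unfolding continuous_map_def
proof (intro conjI allI impI)
  show "f \<in> topspace (cone_topology S) \<rightarrow> topspace Z"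
    using tip continuous_map_funspace[OF ray] by (auto simp: topspace_cone_topology Pi_iff)
  fix U assume U: "openin Z U"
  have "{x \<in> topspace (prod_topology (top_of_set {0..1}) S). (case x of (t, y) \<Rightarrow> cone_pt t y) \<in>
        {x \<in> topspace (cone_topology S). f x \<in> U}} =
      {x \<in> topspace (prod_topology (top_of_set {0..1}) S). (\<lambda>(t, y). f (cone_pt t y)) x \<in> U}"
    by (auto simp: cone_pt_in_cone)
  with openin_continuous_map_preimage[OF ray U]
  show "openin (cone_topology S) {x \<in> topspace (cone_topology S). f x \<in> U}"
    unfolding openin_cone_topology[of S "{x \<in> topspace (cone_topology S). f x \<in> U}"] by auto
qed

lemma compact_space_cone:
  assumes "compact_space S"
  shows "compact_space (cone_topology S)"
proof -
  let ?I = "prod_topology (top_of_set {0..1::real}) S"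
  have "compact_space ?I"
    using assms by (simp add: compact_space_prod_topology compact_space_subtopology compactin_euclidean_iff)
  then have "compactin (cone_topology S) ((\<lambda>(t, y). cone_pt t y) ` topspace ?I)"
    using continuous_map_cone_pt image_compactin compact_space_def by blast
  \<comment> \<open>The tip is added by hand because it is not in the image of the product if
    \<open>S\<close> is empty.\<close>
  moreover have "compactin (cone_topology S) {Tip}"
    by (simp add: topspace_cone_topology)
  ultimately have "compactin (cone_topology S) ({Tip} \<union> (\<lambda>(t, y). cone_pt t y) ` topspace ?I)"
    by (rule compactin_Un[rotated])
  moreover have "{Tip} \<union> (\<lambda>(t, y). cone_pt t y) ` topspace ?I = topspace (cone_topology S)"
    by (auto simp: cone_pt_in_cone image_iff elim!: cone_point_cases) fastforce
  ultimately show ?thesis by (simp add: compact_space_def)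
qed

text \<open>Forming a quotient does not commute with passing to a subspace in general. Here an open
  \<open>V\<close> of the smaller cone extends to an open set of the larger one, because product
  neighbourhoods can be extended by all generic points in the second factor.\<close>

lemma (in generic_extension) subtopology_cone_gen_ext:
  "subtopology (cone_topology (gen_ext S r p w)) (topspace (cone_topology S)) = cone_topology S"
proof -
  let ?G = "gen_ext S r p w" and ?I = "top_of_set {0..1::real}"
  have sub: "topspace (cone_topology S) \<subseteq> topspace (cone_topology ?G)"
    by (auto simp: topspace_cone_topology topspace_gen_ext)
  have tt: "topspace (cone_topology ?G) \<inter> topspace (cone_topology S) = topspace (cone_topology S)"
    using sub by auto
  show ?thesis
    unfolding topology_eq
  proof (intro allI iffI)
    fix V assume "openin (subtopology (cone_topology ?G) (topspace (cone_topology S))) V"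
    then obtain U where U: "openin (cone_topology ?G) U" "V = U \<inter> topspace (cone_topology S)"
      by (auto simp: openin_subtopology)
    have "continuous_map (prod_topology ?I S) (prod_topology ?I ?G) (\<lambda>(t, y). (t, y))"
      using continuous_map_inclusion
      by (auto simp: case_prod_unfold continuous_map_pairwise o_def continuous_map_fst
          intro: continuous_map_compose[OF continuous_map_snd, unfolded o_def])
    from continuous_map_compose[OF this continuous_map_cone_pt]
    have "continuous_map (cone_topology S) (cone_topology ?G) (\<lambda>x. x)"
      by (intro continuous_map_from_cone) (auto simp: topspace_cone_topology o_def case_prod_unfold)
    from openin_continuous_map_preimage[OF this U(1)]
    show "openin (cone_topology S) V" by (simp add: U(2) Collect_conj_eq Int_commute)
  next
    fix V assume V: "openin (cone_topology S) V"
    then have Vs: "V \<subseteq> topspace (cone_topology S)" by (rule openin_subset)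
    define A where "A = {x \<in> topspace (prod_topology ?I S). (case x of (t, y) \<Rightarrow> cone_pt t y) \<in> V}"
    have A: "openin (prod_topology ?I S) A"
      using V unfolding A_def openin_cone_topology by blast
    \<comment> \<open>All points with positive parameter over generic points are added. The
      parameter 0 stands for the tip, so over a generic point it is allowed exactly if
      \<open>V\<close> contains the tip; this is \<open>J\<close>.\<close>
    define U where "U = V \<union> {cone_pt t y | t y. t \<in> {0<..1} \<and> y \<in> w ` Field r}"
    define J where "J = (if Tip \<in> V then {0..1::real} else {0<..1})"
    have "{0<..1::real} = {0..1} \<inter> {0<..}" by auto
    then have "openin ?I {0<..1::real}"
      by (metis open_greaterThan openin_open)
    then have J: "openin ?I J" by (simp add: J_def)
    define B where "B = {x \<in> topspace (prod_topology ?I ?G). (case x of (t, y) \<Rightarrow> cone_pt t y) \<in> U}"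
    have nw: "y \<notin> w ` Field r" if "y \<in> topspace S" for y using disj that by auto
    have ray_V: "Ray t y \<in> V \<Longrightarrow> y \<in> topspace S" for t y
      using Vs by (auto simp: topspace_cone_topology cone_pt_def split: if_splits)
    have mem1: "(t, y) \<in> B \<longleftrightarrow> (t, y) \<in> A" if "y \<in> topspace S" for t y
      using that nw[OF that] by (auto simp: A_def B_def U_def topspace_gen_ext cone_pt_def)
    have mem2: "(t, y) \<in> B \<longleftrightarrow> t \<in> J" if "y \<in> w ` Field r" for t y
      using that disj ray_V by (auto simp: B_def U_def J_def topspace_gen_ext cone_pt_def)
    have AJ: "t \<in> J" if "(t, y) \<in> A" for t y
      using that by (auto simp: A_def J_def cone_pt_def split: if_splits)
    have "openin (prod_topology ?I ?G) B"
      unfolding openin_prod_topology_alt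
    proof (intro allI impI)
      fix t y assume ty: "(t, y) \<in> B"
      then have "y \<in> topspace S \<union> w ` Field r" by (auto simp: B_def topspace_gen_ext)
      then show "\<exists>P Q. openin ?I P \<and> openin ?G Q \<and> t \<in> P \<and> y \<in> Q \<and> P \<times> Q \<subseteq> B"
      proof
        assume y: "y \<in> topspace S"
        then have tA: "(t, y) \<in> A" using ty mem1 by blast
        then obtain P Q where PQ: "openin ?I P" "openin S Q" "t \<in> P" "y \<in> Q" "P \<times> Q \<subseteq> A"
          using A unfolding openin_prod_topology_alt by meson
        have "(P \<inter> J) \<times> (Q \<union> w ` Field r) \<subseteq> B"
          using PQ(5) openin_subset[OF PQ(2)] mem1 mem2 by blast
        moreover have "openin ?I (P \<inter> J)" "openin ?G (Q \<union> w ` Field r)"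
          using PQ J openin_Un_generic by auto
        ultimately show ?thesis using PQ(3,4) AJ[OF tA] by blast
      next
        assume y: "y \<in> w ` Field r"
        then show ?thesis using J openin_generic mem2 ty by blast
      qed
    qed
    moreover have "U \<subseteq> topspace (cone_topology ?G)"
      using Vs sub unfolding U_def by (auto intro!: cone_pt_in_cone simp: topspace_gen_ext)
    ultimately have "openin (cone_topology ?G) U"
      by (simp only: openin_cone_topology B_def simp_thms)
    moreover have "V = U \<inter> topspace (cone_topology S)"
    proof -
      have "cone_pt t y \<notin> topspace (cone_topology S)" if "t \<in> {0<..1}" "y \<in> w ` Field r" for t y
        using that disj by (auto simp: cone_pt_def elim: cone_point_cases)
      then show ?thesis using Vs unfolding U_def by blast
    qed
    ultimately show "openin (subtopology (cone_topology ?G) (topspace (cone_topology S))) V"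
      unfolding openin_subtopology by blast
  qed
qed

section \<open>Acyclic topological categories\<close>

locale compact_acyclic_category =
  fixes C :: "('o, 'm) topcat"
  assumes acyclic: "acyclic_category C"
    and discrete: "Obj C = discrete_topology (topspace (Obj C))"
    and compact_Hausdorff_Hom: "\<And>x y. x \<in> topspace (Obj C) \<Longrightarrow> y \<in> topspace (Obj C) \<Longrightarrow>
           compact_space (subtopology (Mor C) (Hom C x y)) \<and>
           Hausdorff_space (subtopology (Mor C) (Hom C x y))"
    and finite_below: "\<And>x. x \<in> topspace (Obj C) \<Longrightarrow> finite (strictly_below C x)"
begin

abbreviation "Ob \<equiv> topspace (Obj C)"
abbreviation "Mo \<equiv> topspace (Mor C)"
abbreviation "obj \<equiv> chain_obj C"

lemma topcat: "topological_category C"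
  using acyclic by (simp add: acyclic_category_def)

lemma continuous_src: "continuous_map (Mor C) (Obj C) (src C)"
  and continuous_tgt: "continuous_map (Mor C) (Obj C) (tgt C)"
  and continuous_ident: "continuous_map (Obj C) (Mor C) (ident C)"
  and continuous_cmp: "continuous_map
    (subtopology (prod_topology (Mor C) (Mor C)) {(g, f). src C g = tgt C f}) (Mor C) (\<lambda>(g, f). cmp C g f)"
  using topcat by (auto simp: topological_category_def)

lemma src_in: "f \<in> Mo \<Longrightarrow> src C f \<in> Ob"
  using continuous_src by (auto simp: continuous_map_def)

lemma tgt_in: "f \<in> Mo \<Longrightarrow> tgt C f \<in> Ob"
  using continuous_tgt by (auto simp: continuous_map_def)

lemma ident_in: "x \<in> Ob \<Longrightarrow> ident C x \<in> Mo"
  using continuous_ident by (auto simp: continuous_map_def)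

lemma src_ident: "x \<in> Ob \<Longrightarrow> src C (ident C x) = x"
  and tgt_ident: "x \<in> Ob \<Longrightarrow> tgt C (ident C x) = x"
  using topcat by (auto simp: topological_category_def)

lemma cmp_in: "g \<in> Mo \<Longrightarrow> f \<in> Mo \<Longrightarrow> src C g = tgt C f \<Longrightarrow> cmp C g f \<in> Mo"
proof -
  assume "g \<in> Mo" "f \<in> Mo" "src C g = tgt C f"
  then have "(g, f) \<in> topspace (subtopology (prod_topology (Mor C) (Mor C)) {(g, f). src C g = tgt C f})"
    by simp
  from funcset_mem[OF continuous_map_funspace[OF continuous_cmp] this] show ?thesis by simp
qed

lemma src_cmp: "g \<in> Mo \<Longrightarrow> f \<in> Mo \<Longrightarrow> src C g = tgt C f \<Longrightarrow> src C (cmp C g f) = src C f"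
  and tgt_cmp: "g \<in> Mo \<Longrightarrow> f \<in> Mo \<Longrightarrow> src C g = tgt C f \<Longrightarrow> tgt C (cmp C g f) = tgt C g"
  using topcat by (auto simp: topological_category_def)

lemma cmp_ident_right: "f \<in> Mo \<Longrightarrow> src C f = x \<Longrightarrow> cmp C f (ident C x) = f"
  and cmp_ident_left: "f \<in> Mo \<Longrightarrow> tgt C f = y \<Longrightarrow> cmp C (ident C y) f = f"
  using topcat by (auto simp: topological_category_def)

lemma cmp_assoc: "f \<in> Mo \<Longrightarrow> g \<in> Mo \<Longrightarrow> h \<in> Mo \<Longrightarrow> src C g = tgt C f \<Longrightarrow> src C h = tgt C g \<Longrightarrow>
    cmp C h (cmp C g f) = cmp C (cmp C h g) f"
  using topcat by (simp add: topological_category_def)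

lemma Hom_iff: "f \<in> Hom C x y \<longleftrightarrow> f \<in> Mo \<and> src C f = x \<and> tgt C f = y"
  by (simp add: Hom_def)

lemma endo_ident: "f \<in> Mo \<Longrightarrow> src C f = x \<Longrightarrow> tgt C f = x \<Longrightarrow> f = ident C x"
proof -
  assume f: "f \<in> Mo" "src C f = x" "tgt C f = x"
  then have "x \<in> Ob" using src_in by auto
  then have "Hom C x x = {ident C x}" using acyclic by (simp add: acyclic_category_def)
  then show ?thesis using f Hom_iff by blast
qed

lemma Hom_antisym: "f \<in> Hom C x y \<Longrightarrow> g \<in> Hom C y x \<Longrightarrow> x = y"
proof (rule ccontr)
  assume f: "f \<in> Hom C x y" and g: "g \<in> Hom C y x" and ne: "x \<noteq> y"
  have "x \<in> Ob" "y \<in> Ob" using f src_in tgt_in by (auto simp: Hom_iff)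
  then have "Hom C x y = {} \<or> Hom C y x = {}" using acyclic ne by (simp add: acyclic_category_def)
  then show False using f g by blast
qed

section \<open>The partial order of the objects\<close>

definition leq :: "'o rel" where
  "leq = {(x, y). x \<in> Ob \<and> y \<in> Ob \<and> Hom C x y \<noteq> {}}"

lemma leq_iff: "(x, y) \<in> leq \<longleftrightarrow> Hom C x y \<noteq> {}"
  using src_in tgt_in by (auto simp: leq_def Hom_iff)

lemma leqI: "f \<in> Hom C x y \<Longrightarrow> (x, y) \<in> leq"
  by (auto simp: leq_iff)

lemma leq_in: "(x, y) \<in> leq \<Longrightarrow> x \<in> Ob \<and> y \<in> Ob"
  by (simp add: leq_def)

lemma leq_refl: "x \<in> Ob \<Longrightarrow> (x, x) \<in> leq"
  by (rule leqI[of "ident C x"]) (simp add: Hom_iff ident_in src_ident tgt_ident)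

lemma leq_antisym: "(x, y) \<in> leq \<Longrightarrow> (y, x) \<in> leq \<Longrightarrow> x = y"
  using Hom_antisym by (auto simp: leq_iff)

lemma cmp_Hom: "f \<in> Hom C x y \<Longrightarrow> g \<in> Hom C y z \<Longrightarrow> cmp C g f \<in> Hom C x z"
  by (simp add: Hom_iff cmp_in src_cmp tgt_cmp)

lemma leq_trans: "(x, y) \<in> leq \<Longrightarrow> (y, z) \<in> leq \<Longrightarrow> (x, z) \<in> leq"
  using cmp_Hom by (fastforce simp: leq_iff)

lemma Field_leq: "Field leq = Ob"
  using leq_refl leq_in by (auto simp: Field_def)

lemma Partial_order_leq: "Partial_order leq"
proof -
  have "refl_on Ob leq" using leq_refl by (auto simp: refl_on_def)
  moreover have "trans leq" using leq_trans by (rule transI)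
  moreover have "antisym leq" using leq_antisym by (rule antisymI)
  moreover have "leq \<subseteq> Ob \<times> Ob" using leq_in by auto
  ultimately show ?thesis
    unfolding Field_leq partial_order_on_def preorder_on_def by simp
qed

lemma strictly_below_iff: "y \<in> strictly_below C x \<longleftrightarrow> (y, x) \<in> leq \<and> y \<noteq> x"
  using leq_in leq_iff by (auto simp: strictly_below_def)

section \<open>Chains\<close>

lemma nerve_iff: "c \<in> topspace (nerve C k) \<longleftrightarrow> fst c \<in> Ob \<and> snd c \<in> extensional {..<k} \<and>
    (\<forall>i<k. snd c i \<in> Mo \<and> src C (snd c i) = obj c i)"
proof -
  have "c \<in> topspace (nerve C k) \<longleftrightarrow>
      fst c \<in> Ob \<and> snd c \<in> (\<Pi>\<^sub>E i\<in>{..<k}. Mo) \<and> (\<forall>i<k. src C (snd c i) = obj c i)"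
    by (cases c) (simp add: nerve_def)
  then show ?thesis by (auto simp: PiE_def Pi_iff)
qed

lemma chain_obj_simps [simp]: "obj c 0 = fst c" "obj c (Suc i) = tgt C (snd c i)"
  by (simp_all add: chain_obj_def)

lemma chain_obj_in: "c \<in> topspace (nerve C k) \<Longrightarrow> i \<le> k \<Longrightarrow> obj c i \<in> Ob"
  by (cases i) (auto simp: nerve_iff tgt_in)

definition hop :: "('o, 'm) chain \<Rightarrow> nat \<Rightarrow> nat \<Rightarrow> 'm" where
  "hop c i j = chain_mor C c i (j - i)"

lemma hop_refl [simp]: "hop c i i = ident C (obj c i)"
  by (simp add: hop_def)

lemma hop_step: "i \<le> j \<Longrightarrow> hop c i (Suc j) = cmp C (snd c j) (hop c i j)"
  by (simp add: hop_def Suc_diff_le)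

lemma hop_Hom:
  assumes c: "c \<in> topspace (nerve C k)" and "i \<le> j" "j \<le> k"
  shows "hop c i j \<in> Hom C (obj c i) (obj c j)"
  using assms(2,3)
proof (induction j rule: dec_induct)
  case base
  then show ?case using chain_obj_in[OF c] by (simp add: Hom_iff ident_in src_ident tgt_ident)
next
  case (step n)
  have "snd c n \<in> Hom C (obj c n) (obj c (Suc n))"
    using c step.prems by (simp add: nerve_iff Hom_iff)
  with step show ?case using cmp_Hom by (simp add: hop_step)
qed

lemma hop_Suc: "c \<in> topspace (nerve C k) \<Longrightarrow> i < k \<Longrightarrow> hop c i (Suc i) = snd c i"
  by (auto simp: hop_step nerve_iff cmp_ident_right)

lemma hop_comp:
  assumes c: "c \<in> topspace (nerve C k)" and ij: "i \<le> j" and "j \<le> l" "l \<le> k"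
  shows "cmp C (hop c j l) (hop c i j) = hop c i l"
  using assms(3,4)
proof (induction l rule: dec_induct)
  case base
  then show ?case using hop_Hom[OF c ij] by (simp add: Hom_iff cmp_ident_left)
next
  case (step n)
  have 1: "snd c n \<in> Hom C (obj c n) (obj c (Suc n))"
    using c step.prems by (simp add: nerve_iff Hom_iff)
  have 2: "hop c j n \<in> Hom C (obj c j) (obj c n)"
    and 3: "hop c i j \<in> Hom C (obj c i) (obj c j)"
    using step ij by (auto intro!: hop_Hom[OF c])
  have "cmp C (hop c j (Suc n)) (hop c i j) = cmp C (snd c n) (cmp C (hop c j n) (hop c i j))"
    using 1 2 3 step.hyps by (simp add: hop_step Hom_iff cmp_assoc)
  then show ?case using step ij by (simp add: hop_step)
qed

lemma chain_leq:
  "c \<in> topspace (nerve C k) \<Longrightarrow> i \<le> j \<Longrightarrow> j \<le> k \<Longrightarrow> (obj c i, obj c j) \<in> leq"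
  using hop_Hom leqI by blast

lemma chain_sandwich:
  assumes c: "c \<in> topspace (nerve C k)" and "i \<le> j" "j \<le> l" "l \<le> k" "obj c i = obj c l"
  shows "obj c j = obj c i"
  using chain_leq[OF c, of i j] chain_leq[OF c, of j l] assms leq_antisym by auto

text \<open>The composite between two positions with the same object is an endomorphism, hence an
  identity by \<open>endo_ident\<close>. So either end of a composite may be shifted to another
  occurrence of the same object; \<open>left\<close> and \<open>right\<close> do this
  separately.\<close>

lemma hop_unique_aux:
  assumes c: "c \<in> topspace (nerve C k)" and "i \<le> j" "j \<le> k" "i' \<le> j'" "j' \<le> k"
    and o: "obj c i = obj c i'" "obj c j = obj c j'" and ii: "i \<le> i'"
  shows "hop c i j = hop c i' j'"
proof -
  have left: "hop c i j = hop c i' j" if "i' \<le> j"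
  proof -
    have "hop c i i' \<in> Hom C (obj c i) (obj c i)"
      using hop_Hom[OF c, of i i'] assms that by simp
    then have "hop c i i' = ident C (obj c i)" by (intro endo_ident) (auto simp: Hom_iff)
    then have "hop c i j = cmp C (hop c i' j) (ident C (obj c i'))"
      using hop_comp[OF c, of i i' j] assms that by simp
    moreover have "hop c i' j \<in> Hom C (obj c i') (obj c j)"
      using hop_Hom[OF c that \<open>j \<le> k\<close>] .
    ultimately show ?thesis by (simp add: Hom_iff cmp_ident_right)
  qed
  have right: "hop c a b = hop c a b'"
    if "a \<le> b" "b \<le> b'" "b' \<le> k" "obj c b = obj c b'" for a b b'
  proof -
    have "hop c b b' \<in> Hom C (obj c b) (obj c b)"
      using hop_Hom[OF c, of b b'] that by simp
    then have "hop c b b' = ident C (obj c b)" by (intro endo_ident) (auto simp: Hom_iff)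
    then have "hop c a b' = cmp C (ident C (obj c b)) (hop c a b)"
      using hop_comp[OF c, of a b b'] that by simp
    moreover have "hop c a b \<in> Hom C (obj c a) (obj c b)"
      using hop_Hom[OF c, of a b] that by simp
    ultimately show ?thesis by (simp add: Hom_iff cmp_ident_left)
  qed
  show ?thesis
  proof (cases "i' \<le> j")
    case True
    have "hop c i' j = hop c i' j'"
    proof (cases "j \<le> j'")
      case jj: True
      show ?thesis by (rule right[OF True jj assms(5) o(2)])
    next
      case False
      then show ?thesis by (intro right[OF assms(4) _ assms(3) o(2)[symmetric], symmetric]) simp
    qed
    then show ?thesis using left[OF True] by simp
  next
    case False
    \<comment> \<open>Now \<open>j < i'\<close>, so the object at \<open>j\<close> lies between two
      occurrences of the same object and equals it; both composites are then identities.\<close>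
    then have "obj c j = obj c i"
      using chain_sandwich[OF c, of i j i'] assms by simp
    then have "hop c i j = ident C (obj c i)" "hop c i' j' = ident C (obj c i)"
      using hop_Hom[OF c, of i j] hop_Hom[OF c, of i' j'] assms
      by (auto intro!: endo_ident simp: Hom_iff)
    then show ?thesis by simp
  qed
qed

text \<open>Here acyclicity enters.\<close>

lemma hop_unique:
  assumes "c \<in> topspace (nerve C k)" "i \<le> j" "j \<le> k" "i' \<le> j'" "j' \<le> k"
    "obj c i = obj c i'" "obj c j = obj c j'"
  shows "hop c i j = hop c i' j'"
proof (cases "i \<le> i'")
  case True
  then show ?thesis using assms by (intro hop_unique_aux[of c k])
next
  case False
  then show ?thesis using assms by (intro hop_unique_aux[of c k, symmetric]) auto
qed

text \<open>The positions are forgotten on purpose: they change under simplicial operators, while by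
  \<open>hops_functional\<close> a morphism of the chain is identified by its end objects.\<close>

definition hops :: "nat \<Rightarrow> ('o, 'm) chain \<Rightarrow> 'm set" where
  "hops k c = {hop c i j | i j. i \<le> j \<and> j \<le> k}"

lemma hopsI: "i \<le> j \<Longrightarrow> j \<le> k \<Longrightarrow> hop c i j \<in> hops k c"
  by (auto simp: hops_def)

lemma hopsE:
  assumes "c \<in> topspace (nerve C k)" "f \<in> hops k c"
  obtains i j where "i \<le> j" "j \<le> k" "f = hop c i j" "f \<in> Mo" "src C f = obj c i" "tgt C f = obj c j"
proof -
  obtain i j where ij: "i \<le> j" "j \<le> k" "f = hop c i j" using assms by (auto simp: hops_def)
  then show ?thesis using that hop_Hom[OF assms(1) ij(1,2)] by (simp add: Hom_iff)
qed

lemma hops_functional: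
  assumes c: "c \<in> topspace (nerve C k)" and "f \<in> hops k c" "g \<in> hops k c"
    and "src C f = src C g" "tgt C f = tgt C g"
  shows "f = g"
proof -
  obtain i j where 1: "i \<le> j" "j \<le> k" "f = hop c i j" "src C f = obj c i" "tgt C f = obj c j"
    using hopsE[OF c assms(2)] by metis
  obtain i' j' where 2: "i' \<le> j'" "j' \<le> k" "g = hop c i' j'" "src C g = obj c i'" "tgt C g = obj c j'"
    using hopsE[OF c assms(3)] by metis
  have "hop c i j = hop c i' j'" using 1 2 assms(4,5) by (intro hop_unique[OF c]) auto
  then show ?thesis using 1 2 by simp
qed

lemma nerve_op_obj:
  assumes c: "c \<in> topspace (nerve C k)" and th: "th \<in> {..m} \<rightarrow> {..k}" "mono_on {..m} th" and i: "i \<le> m"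
  shows "obj (nerve_op C m th c) i = obj c (th i)"
proof (cases i)
  case 0
  then show ?thesis by (simp add: nerve_op_def)
next
  case (Suc j)
  have "th j \<le> th (Suc j)" "th (Suc j) \<le> k"
    using th Suc i by (auto intro: mono_onD)
  then have "hop c (th j) (th (Suc j)) \<in> Hom C (obj c (th j)) (obj c (th (Suc j)))"
    by (intro hop_Hom[OF c])
  then show ?thesis using Suc i by (simp add: nerve_op_def hop_def Hom_iff)
qed

lemma nerve_op_mor: "i < m \<Longrightarrow> snd (nerve_op C m th c) i = hop c (th i) (th (Suc i))"
  by (simp add: nerve_op_def hop_def)

lemma nerve_op_in:
  assumes c: "c \<in> topspace (nerve C k)" and th: "th \<in> {..m} \<rightarrow> {..k}" "mono_on {..m} th"
  shows "nerve_op C m th c \<in> topspace (nerve C m)"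
  unfolding nerve_iff
proof (intro conjI allI impI)
  show "fst (nerve_op C m th c) \<in> Ob"
    using chain_obj_in[OF c, of "th 0"] th by (auto simp: nerve_op_def)
  show "snd (nerve_op C m th c) \<in> extensional {..<m}" by (simp add: nerve_op_def)
  fix i assume i: "i < m"
  have "th i \<le> th (Suc i)" "th (Suc i) \<le> k"
    using th i by (auto intro: mono_onD)
  then have "hop c (th i) (th (Suc i)) \<in> Hom C (obj c (th i)) (obj c (th (Suc i)))"
    by (intro hop_Hom[OF c])
  then show "snd (nerve_op C m th c) i \<in> Mo"
    "src C (snd (nerve_op C m th c) i) = obj (nerve_op C m th c) i"
    using i nerve_op_obj[OF c th, of i] by (auto simp: nerve_op_mor Hom_iff)
qed

lemma nerve_op_hop:
  assumes c: "c \<in> topspace (nerve C k)" and th: "th \<in> {..m} \<rightarrow> {..k}" "mono_on {..m} th"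
    and "i \<le> j" "j \<le> m"
  shows "hop (nerve_op C m th c) i j = hop c (th i) (th j)"
  using assms(4,5)
proof (induction j rule: dec_induct)
  case base
  then show ?case using nerve_op_obj[OF c th] by simp
next
  case (step n)
  have "th i \<le> th n" "th n \<le> th (Suc n)" "th (Suc n) \<le> k"
    using th step by (auto intro: mono_onD)
  then have "cmp C (hop c (th n) (th (Suc n))) (hop c (th i) (th n)) = hop c (th i) (th (Suc n))"
    by (intro hop_comp[OF c])
  with step show ?case by (simp add: hop_step nerve_op_mor)
qed

text \<open>A composite of \<open>c\<close> between objects that survive in the new chain can be
  moved to surviving positions by \<open>hop_unique\<close>. Restricting to \<open>A\<close>
  discards the morphisms at objects that the operator deletes.\<close>

lemma hops_nerve_op:
  assumes c: "c \<in> topspace (nerve C k)" and th: "th \<in> {..m} \<rightarrow> {..k}" "mono_on {..m} th"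
    and A: "A \<subseteq> (\<lambda>i. obj c (th i)) ` {..m}"
  shows "{f \<in> hops m (nerve_op C m th c). src C f \<in> A \<and> tgt C f \<in> A} =
    {f \<in> hops k c. src C f \<in> A \<and> tgt C f \<in> A}"
proof -
  have "f \<in> hops k c" if f: "f \<in> hops m (nerve_op C m th c)" for f
  proof -
    obtain i j where ij: "i \<le> j" "j \<le> m" "f = hop (nerve_op C m th c) i j"
      using f by (auto simp: hops_def)
    then have "th i \<le> th j" "th j \<le> k" using th by (auto intro: mono_onD)
    then show ?thesis using nerve_op_hop[OF c th ij(1,2)] ij(3) hopsI by metis
  qed
  moreover have "f \<in> hops m (nerve_op C m th c)" if f: "f \<in> hops k c" and fA: "src C f \<in> A" "tgt C f \<in> A" for f
  proof -
    obtain i j where ij: "i \<le> j" "j \<le> k" "f = hop c i j" "src C f = obj c i" "tgt C f = obj c j"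
      using hopsE[OF c f] by metis
    obtain i' j' where 1: "i' \<le> m" "obj c i = obj c (th i')"
      and 2: "j' \<le> m" "obj c j = obj c (th j')"
      using subsetD[OF A fA(1)] subsetD[OF A fA(2)] ij by auto
    show ?thesis
    proof (cases "i' \<le> j'")
      case True
      then have "th i' \<le> th j'" "th j' \<le> k" using th 2 by (auto intro: mono_onD)
      then have "hop c i j = hop c (th i') (th j')" using ij 1 2 by (intro hop_unique[OF c]) auto
      then have "f = hop c (th i') (th j')" using ij by simp
      then show ?thesis using nerve_op_hop[OF c th True 2(1)] True 2(1) hopsI by metis
    next
      case False
      \<comment> \<open>The chosen positions can come in the wrong order only if the two objects are
        equal, by antisymmetry. The morphism is then an identity and is found at \<open>i'\<close>
        alone.\<close>
      then have ji: "th j' \<le> th i'" "th i' \<le> k" using th 1 by (auto intro: mono_onD)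
      then have "(obj c j, obj c i) \<in> leq" using chain_leq[OF c ji] 1 2 by simp
      moreover have "(obj c i, obj c j) \<in> leq" using chain_leq[OF c ij(1,2)] .
      ultimately have "obj c i = obj c j" by (rule leq_antisym[rotated])
      then have "hop c i j = hop c (th i') (th i')" using ij 1 2 ji by (intro hop_unique[OF c]) auto
      then have "f = hop c (th i') (th i')" using ij by simp
      moreover have "hop (nerve_op C m th c) i' i' = hop c (th i') (th i')"
        by (rule nerve_op_hop[OF c th order_refl 1(1)])
      ultimately show ?thesis using hopsI[OF order_refl 1(1)] by metis
    qed
  qed
  ultimately show ?thesis by blast
qed

lemma simplex_map_in:
  assumes th: "th \<in> {..m} \<rightarrow> {..k}" and t: "t \<in> standard_simplex m"
  shows "simplex_map m th t \<in> standard_simplex k"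
proof -
  have t0: "\<And>i. 0 \<le> t i" and t1: "(\<Sum>i\<le>m. t i) = 1" using t by (auto simp: standard_simplex_def)
  have "(\<Sum>j\<le>k. \<Sum>i | i \<in> {..m} \<and> th i = j. t i) = (\<Sum>i\<le>m. t i)"
    using th by (intro sum.group) auto
  then have s: "(\<Sum>j\<le>k. simplex_map m th t j) = 1" using t1 by (simp add: simplex_map_def)
  have p: "0 \<le> simplex_map m th t j" for j
    using t0 by (auto simp: simplex_map_def intro: sum_nonneg)
  have z: "simplex_map m th t j = 0" if "j > k" for j
  proof -
    have "th i \<le> k" if "i \<le> m" for i using th that by auto
    then have "{i. i \<le> m \<and> th i = j} = {}" using that by fastforce
    then show ?thesis by (simp only: simplex_map_def sum.empty)
  qed
  have "simplex_map m th t j \<le> 1" for j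
  proof (cases "j \<le> k")
    case True
    then have "simplex_map m th t j \<le> (\<Sum>j\<le>k. simplex_map m th t j)"
      using p by (intro member_le_sum) auto
    then show ?thesis using s by simp
  qed (simp add: z)
  then show ?thesis using p z s by (simp add: standard_simplex_def)
qed

lemma simplex_map_id: "t \<in> standard_simplex m \<Longrightarrow> simplex_map m (\<lambda>i. i) t = t"
proof
  fix j assume t: "t \<in> standard_simplex m"
  have "{i. i \<le> m \<and> i = j} = (if j \<le> m then {j} else {})" by auto
  then show "simplex_map m (\<lambda>i. i) t j = t j" using t by (auto simp: simplex_map_def standard_simplex_def)
qed

section \<open>The invariant of a weighted chain\<close>

text \<open>Weights at repeated objects are added, because a degeneracy may split the weight of one
  vertex among several copies of it.\<close>

definition wt :: "nat \<Rightarrow> ('o, 'm) chain \<Rightarrow> (nat \<Rightarrow> real) \<Rightarrow> 'o \<Rightarrow> real" where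
  "wt k c t y = (\<Sum>i | i \<le> k \<and> obj c i = y. t i)"

definition supp :: "('o \<Rightarrow> real) \<Rightarrow> 'o set" where
  "supp w = {y. 0 < w y}"

text \<open>The objects in \<open>B\<close> are taken into account even if their weight is 0: \<open>B\<close> is empty for points of the
  classifying space and \<open>{x}\<close> for points of the star of \<open>x\<close>.\<close>

definition shape :: "'o set \<Rightarrow> nat \<times> ('o, 'm) chain \<times> (nat \<Rightarrow> real) \<Rightarrow> ('o \<Rightarrow> real) \<times> 'm set" where
  "shape B p = (case p of (k, c, t) \<Rightarrow> (wt k c t,
     {f \<in> hops k c. src C f \<in> B \<union> supp (wt k c t) \<and> tgt C f \<in> B \<union> supp (wt k c t)}))"

lemma supp_wt:
  assumes t: "t \<in> standard_simplex k"
  shows "supp (wt k c t) = obj c ` {i. i \<le> k \<and> 0 < t i}"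
proof -
  have t0: "\<And>i. 0 \<le> t i" using t by (simp add: standard_simplex_def)
  have "0 < wt k c t y \<longleftrightarrow> (\<exists>i\<le>k. 0 < t i \<and> obj c i = y)" for y
  proof
    assume "0 < wt k c t y"
    then obtain i where "i \<le> k \<and> obj c i = y" "t i \<noteq> 0"
      unfolding wt_def by (metis (mono_tags, lifting) less_irrefl mem_Collect_eq sum.neutral)
    then show "\<exists>i\<le>k. 0 < t i \<and> obj c i = y" using t0[of i] by force
  next
    assume "\<exists>i\<le>k. 0 < t i \<and> obj c i = y"
    then obtain i where i: "i \<le> k" "0 < t i" "obj c i = y" by blast
    have "t i \<le> wt k c t y"
      unfolding wt_def using i t0 by (intro member_le_sum) auto
    then show "0 < wt k c t y" using i by simp
  qed
  then show ?thesis unfolding supp_def by auto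
qed

lemma wt_nonneg: "t \<in> standard_simplex k \<Longrightarrow> 0 \<le> wt k c t y"
  by (auto simp: wt_def standard_simplex_def intro: sum_nonneg)

lemma wt_nerve_op:
  assumes c: "c \<in> topspace (nerve C k)" and th: "th \<in> {..m} \<rightarrow> {..k}" "mono_on {..m} th"
  shows "wt m (nerve_op C m th c) t = wt k c (simplex_map m th t)"
proof
  fix y
  let ?S = "{i. i \<le> m \<and> obj c (th i) = y}"
  have "wt m (nerve_op C m th c) t y = (\<Sum>i\<in>?S. t i)"
    unfolding wt_def using nerve_op_obj[OF c th] by (intro sum.cong) auto
  also have "\<dots> = (\<Sum>j | j \<le> k \<and> obj c j = y. \<Sum>i | i \<in> ?S \<and> th i = j. t i)"
    using th by (intro sum.group[symmetric]) auto
  also have "\<dots> = wt k c (simplex_map m th t) y"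
    unfolding wt_def simplex_map_def by (intro sum.cong) auto
  finally show "wt m (nerve_op C m th c) t y = wt k c (simplex_map m th t) y" .
qed

text \<open>The support consists of objects of the new chain, so \<open>hops_nerve_op\<close>
  applies. With a nonempty \<open>B\<close> this would fail, as an operator may delete a marked
  object; stars therefore use chains whose last object is fixed.\<close>

lemma shape_nerve_op:
  assumes c: "c \<in> topspace (nerve C k)" and th: "th \<in> {..m} \<rightarrow> {..k}" "mono_on {..m} th"
    and t: "t \<in> standard_simplex m"
  shows "shape {} (m, nerve_op C m th c, t) = shape {} (k, c, simplex_map m th t)"
proof -
  have "supp (wt m (nerve_op C m th c) t) \<subseteq> (\<lambda>i. obj c (th i)) ` {..m}"
    unfolding supp_wt[OF t] using nerve_op_obj[OF c th] by auto
  then show ?thesis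
    unfolding shape_def using hops_nerve_op[OF c th] wt_nerve_op[OF c th] by simp
qed

section \<open>The classifying space as a space of invariants\<close>

abbreviation "Delta k \<equiv> subtopology (powertop_real UNIV) (standard_simplex k)"

abbreviation "wchains k \<equiv> prod_topology (nerve C k) (Delta k)"

definition all_wchains :: "(nat \<times> ('o, 'm) chain \<times> (nat \<Rightarrow> real)) topology" where
  "all_wchains = sum_topology wchains UNIV"

definition equ :: "(nat \<times> ('o, 'm) chain \<times> (nat \<Rightarrow> real)) rel" where
  "equ = (realization_rel (nerve C) (nerve_op C) \<union> (realization_rel (nerve C) (nerve_op C))\<inverse>)\<^sup>*"

definition cls :: "nat \<times> ('o, 'm) chain \<times> (nat \<Rightarrow> real) \<Rightarrow> ('o, 'm) bpoint" where
  "cls p = equ `` {p}"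

lemma classifying_space_eq:
  "classifying_space C = coinduced_topology (cls ` topspace all_wchains) all_wchains cls"
proof -
  have "cls = (\<lambda>p. (realization_rel (nerve C) (nerve_op C) \<union>
      (realization_rel (nerve C) (nerve_op C))\<inverse>)\<^sup>* `` {p})"
    by (simp add: cls_def equ_def fun_eq_iff)
  then show ?thesis
    by (simp add: classifying_space_def realization_def Let_def all_wchains_def)
qed

lemma quotient_map_cls: "quotient_map all_wchains (classifying_space C) cls"
  unfolding classifying_space_eq by (rule quotient_map_coinduced_topology)

lemma wchains_iff [simp]: "(c, t) \<in> topspace (wchains k) \<longleftrightarrow> c \<in> topspace (nerve C k) \<and> t \<in> standard_simplex k"
  by simp

lemma all_wchains_iff [simp]:
  "(k, c, t) \<in> topspace all_wchains \<longleftrightarrow> c \<in> topspace (nerve C k) \<and> t \<in> standard_simplex k"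
  by (simp add: all_wchains_def)

lemma equ_refl: "(p, p) \<in> equ"
  by (simp add: equ_def)

lemma equ_trans: "(p, q) \<in> equ \<Longrightarrow> (q, r) \<in> equ \<Longrightarrow> (p, r) \<in> equ"
  unfolding equ_def by (rule rtrancl_trans)

lemma equ_sym: "(p, q) \<in> equ \<Longrightarrow> (q, p) \<in> equ"
proof -
  have "sym equ" unfolding equ_def by (intro sym_rtrancl sym_Un_converse)
  then show "(p, q) \<in> equ \<Longrightarrow> (q, p) \<in> equ" by (rule symD)
qed

lemma cls_eq: "cls p = cls q \<longleftrightarrow> (p, q) \<in> equ"
  unfolding cls_def using equ_refl equ_sym equ_trans by blast

lemma equ_nerve_op:
  assumes "c \<in> topspace (nerve C k)" "th \<in> {..m} \<rightarrow> {..k}" "mono_on {..m} th" "t \<in> standard_simplex m"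
  shows "((m, nerve_op C m th c, t), (k, c, simplex_map m th t)) \<in> equ"
proof -
  have "((m, nerve_op C m th c, t), (k, c, simplex_map m th t)) \<in> realization_rel (nerve C) (nerve_op C)"
    unfolding realization_rel_def using assms by blast
  then show ?thesis unfolding equ_def by blast
qed

lemma equ_invariant:
  assumes "(p, q) \<in> equ"
  shows "shape {} p = shape {} q \<and> (p \<in> topspace all_wchains \<longleftrightarrow> q \<in> topspace all_wchains)"
  using assms unfolding equ_def
proof (induction rule: rtrancl_induct)
  case (step q r)
  have "shape {} a = shape {} b \<and> a \<in> topspace all_wchains \<and> b \<in> topspace all_wchains"
    if ab: "(a, b) \<in> realization_rel (nerve C) (nerve_op C)" for a b
  proof -
    obtain m k th c t where *: "a = (m, nerve_op C m th c, t)" "b = (k, c, simplex_map m th t)"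
      "th \<in> {..m} \<rightarrow> {..k}" "mono_on {..m} th" "c \<in> topspace (nerve C k)" "t \<in> standard_simplex m"
      using ab unfolding realization_rel_def by blast
    show ?thesis unfolding *(1,2)
      using shape_nerve_op[OF *(5,3,4,6)] nerve_op_in[OF *(5,3,4)] simplex_map_in[OF *(3,6)] *(5,6) by simp
  qed
  with step show ?case by (metis UnE converseD)
qed simp

text \<open>Two weighted chains with the same invariant are equivalent: first all weight of an object is moved
  to its first occurrence, then the positions of weight 0 are deleted, and the result is determined by
  the invariant.\<close>

definition collapse :: "('o, 'm) chain \<Rightarrow> nat \<Rightarrow> nat" where
  "collapse c i = (LEAST j. obj c j = obj c i)"

lemma collapse_le: "collapse c i \<le> i"
  unfolding collapse_def by (rule Least_le) simp

lemma chain_obj_collapse: "obj c (collapse c i) = obj c i"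
  unfolding collapse_def by (rule LeastI) simp

lemma collapse_cong: "obj c i = obj c j \<Longrightarrow> collapse c i = collapse c j"
  by (simp add: collapse_def)

text \<open>If the first occurrence of the object at \<open>j\<close> precedes that of the object at
  \<open>i\<close>, then \<open>i\<close> lies between two occurrences of the former, so both
  objects agree by \<open>chain_sandwich\<close>.\<close>

lemma collapse_mono:
  assumes c: "c \<in> topspace (nerve C k)" and ij: "i \<le> j" "j \<le> k"
  shows "collapse c i \<le> collapse c j"
proof (rule ccontr)
  assume "\<not> ?thesis"
  then have lt: "collapse c j < collapse c i" by simp
  then have "collapse c j \<le> i" using collapse_le[of c i] by simp
  then have "obj c i = obj c (collapse c j)"
    using chain_sandwich[OF c _ ij] chain_obj_collapse by simp
  then have "collapse c i \<le> collapse c j"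
    unfolding collapse_def[of c i] by (intro Least_le) simp
  then show False using lt by simp
qed

text \<open>Collapsing moves weights only: between the new positions the composites are the old ones
  by \<open>hop_unique\<close>. The simplicial relation for \<open>collapse c\<close> therefore
  identifies two weightings of the same chain.\<close>

lemma nerve_op_collapse:
  assumes c: "c \<in> topspace (nerve C k)"
  shows "nerve_op C k (collapse c) c = c"
proof (rule prod_eqI)
  have "collapse c 0 = 0" using collapse_le[of c 0] by simp
  then show "fst (nerve_op C k (collapse c) c) = fst c" by (simp add: nerve_op_def)
  show "snd (nerve_op C k (collapse c) c) = snd c"
  proof (rule extensionalityI[of _ "{..<k}"])
    show "snd (nerve_op C k (collapse c) c) \<in> extensional {..<k}" by (simp add: nerve_op_def)
    show "snd c \<in> extensional {..<k}" using c by (simp add: nerve_iff)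
    fix i assume i: "i \<in> {..<k}"
    have "hop c (collapse c i) (collapse c (Suc i)) = hop c i (Suc i)"
    proof (rule hop_unique[OF c])
      show "collapse c (Suc i) \<le> k" using collapse_le[of c "Suc i"] i by simp
    qed (use i collapse_mono[OF c] chain_obj_collapse in auto)
    then show "snd (nerve_op C k (collapse c) c) i = snd c i"
      using i hop_Suc[OF c] by (simp add: nerve_op_mor)
  qed
qed

lemma collapse_op:
  assumes c: "c \<in> topspace (nerve C k)"
  shows "collapse c \<in> {..k} \<rightarrow> {..k}" "mono_on {..k} (collapse c)"
  using collapse_le[of c] collapse_mono[OF c] by (auto intro!: mono_onI intro: order_trans)

lemma simplex_map_collapse:
  "simplex_map k (collapse c) t j = (if j \<le> k \<and> collapse c j = j then wt k c t (obj c j) else 0)"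
proof (cases "j \<le> k \<and> collapse c j = j")
  case True
  have "collapse c i = j \<longleftrightarrow> obj c i = obj c j" for i
    using chain_obj_collapse[of c i] collapse_cong[of c i j] True by auto
  then show ?thesis using True by (simp add: simplex_map_def wt_def)
next
  case False
  have "collapse c i \<noteq> j" if i: "i \<le> k" for i
  proof
    assume j: "collapse c i = j"
    then have "obj c i = obj c j" using chain_obj_collapse[of c i] by simp
    then have "collapse c j = j" using j collapse_cong[of c i j] by simp
    then show False using False j collapse_le[of c i] i by simp
  qed
  then have "{i. i \<le> k \<and> collapse c i = j} = {}" by auto
  then show ?thesis using False by (simp only: simplex_map_def sum.empty if_False)
qed

lemma equ_collapse:
  assumes c: "c \<in> topspace (nerve C k)" and t: "t \<in> standard_simplex k"
  shows "((k, c, t), (k, c, simplex_map k (collapse c) t)) \<in> equ"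
  using equ_nerve_op[OF c collapse_op[OF c] t] by (simp add: nerve_op_collapse[OF c])

lemma nondegenerate_rep:
  assumes c: "c \<in> topspace (nerve C k)" and t: "t \<in> standard_simplex k"
  obtains n c' s where "c' \<in> topspace (nerve C n)" "s \<in> standard_simplex n" "\<And>i. i \<le> n \<Longrightarrow> 0 < s i"
    "inj_on (obj c') {..n}" "((k, c, t), (n, c', s)) \<in> equ"
proof -
  define u where "u = simplex_map k (collapse c) t"
  have u: "u \<in> standard_simplex k"
    unfolding u_def by (rule simplex_map_in[OF collapse_op(1)[OF c] t])
  then have u0: "\<And>i. 0 \<le> u i" and u1: "\<And>i. u i \<le> 1" and uk: "\<And>i. i > k \<Longrightarrow> u i = 0" and us: "(\<Sum>i\<le>k. u i) = 1"
    by (auto simp: standard_simplex_def)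
  define J where "J = {j. j \<le> k \<and> 0 < u j}"
  have finJ: "finite J" by (simp add: J_def)
  have uJ: "j \<notin> J \<Longrightarrow> u j = 0" for j using u0[of j] uk[of j] by (auto simp: J_def not_le)
  have "(\<Sum>j\<in>J. u j) = (\<Sum>j\<le>k. u j)" using uJ by (intro sum.mono_neutral_left) (auto simp: J_def)
  then have sJ: "(\<Sum>j\<in>J. u j) = 1" using us by simp
  then have "J \<noteq> {}" by auto
  then have cJ: "0 < card J" using finJ by (simp add: card_gt_0_iff)
  obtain h where bij: "bij_betw h {..<card J} J" and h: "strict_mono_on {..<card J} h"
    using ex_bij_betw_strict_mono_card[OF finJ] .
  \<comment> \<open>A simplex of dimension \<open>n\<close> has \<open>n + 1\<close> vertices;
    \<open>J\<close> is nonempty because the weights sum to 1.\<close>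
  define n where "n = card J - 1"
  have n: "{..<card J} = {..n}" using cJ by (auto simp: n_def)
  have hJ: "h i \<in> J" if "i \<le> n" for i using bij that unfolding n by (auto simp: bij_betw_def)
  have hinj: "inj_on h {..n}" using bij unfolding n by (simp add: bij_betw_def)
  have hop1: "h \<in> {..n} \<rightarrow> {..k}" using hJ by (auto simp: J_def)
  have hop2: "mono_on {..n} h" using h unfolding n by (rule strict_mono_on_imp_mono_on)
  define s where "s = (\<lambda>i. if i \<le> n then u (h i) else 0)"
  have "(\<Sum>i\<le>n. s i) = (\<Sum>i\<le>n. u (h i))" by (simp add: s_def)
  also have "\<dots> = (\<Sum>j\<in>J. u j)" using bij unfolding n by (rule sum.reindex_bij_betw)
  finally have s: "s \<in> standard_simplex n" using sJ u0 u1 by (simp add: standard_simplex_def s_def)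
  have sm: "simplex_map n h s = u"
  proof
    fix j
    show "simplex_map n h s j = u j"
    proof (cases "j \<in> J")
      case True
      then obtain i where i: "i \<le> n" "h i = j" using bij unfolding n bij_betw_def by (metis atMost_iff imageE)
      then have "{i. i \<le> n \<and> h i = j} = {i}" using hinj by (auto dest: inj_onD)
      then show ?thesis using i by (simp add: simplex_map_def s_def)
    next
      case False
      then have "{i. i \<le> n \<and> h i = j} = {}" using hJ by auto
      then show ?thesis using uJ[OF False] by (simp only: simplex_map_def sum.empty)
    qed
  qed
  show thesis
  proof (rule that)
    show c': "nerve_op C n h c \<in> topspace (nerve C n)" by (rule nerve_op_in[OF c hop1 hop2])
    show "s \<in> standard_simplex n" by (rule s)
    show "0 < s i" if "i \<le> n" for i using that hJ[OF that] by (simp add: s_def J_def)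
    show "inj_on (obj (nerve_op C n h c)) {..n}"
    proof (rule inj_onI)
      fix i i' assume i: "i \<in> {..n}" "i' \<in> {..n}"
        "obj (nerve_op C n h c) i = obj (nerve_op C n h c) i'"
      \<comment> \<open>Collapsed weight is positive only at first occurrences, so equal objects at
        positions in \<open>J\<close> force equal positions.\<close>
      have col: "collapse c (h i) = h i" if "i \<le> n" for i
        using hJ[OF that] unfolding J_def u_def simplex_map_collapse by (auto split: if_splits)
      have "obj c (h i) = obj c (h i')"
        using i nerve_op_obj[OF c hop1 hop2] by simp
      then have "h i = h i'" using collapse_cong[of c "h i" "h i'"] col i by simp
      then show "i = i'" using hinj i by (auto dest: inj_onD)
    qed
    have "((k, c, t), (k, c, u)) \<in> equ" unfolding u_def by (rule equ_collapse[OF c t])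
    moreover have "((n, nerve_op C n h c, s), (k, c, u)) \<in> equ"
      using equ_nerve_op[OF c hop1 hop2 s] unfolding sm .
    ultimately show "((k, c, t), (n, nerve_op C n h c, s)) \<in> equ"
      using equ_sym equ_trans by blast
  qed
qed

text \<open>In a chain of distinct objects with positive weights the objects form the support, and
  the position of an object is the number of elements of the support strictly below it. This
  recovers the order; \<open>hops_functional\<close> then recovers the morphisms, and
  \<open>wt\<close> the simplex coordinates.\<close>

lemma nondegenerate_unique:
  assumes c: "c \<in> topspace (nerve C n)" "s \<in> standard_simplex n" "\<And>i. i \<le> n \<Longrightarrow> 0 < s i"
      "inj_on (obj c) {..n}"
    and c': "c' \<in> topspace (nerve C n')" "s' \<in> standard_simplex n'" "\<And>i. i \<le> n' \<Longrightarrow> 0 < s' i"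
      "inj_on (obj c') {..n'}"
    and sh: "shape {} (n, c, s) = shape {} (n', c', s')"
  shows "(n, c, s) = (n', c', s')"
proof -
  have wt1: "wt n c s (obj c i) = s i" if "i \<le> n" "inj_on (obj c) {..n}" for n c s i
  proof -
    have "{j. j \<le> n \<and> obj c j = obj c i} = {i}" using that by (auto dest: inj_onD)
    then show ?thesis by (simp add: wt_def)
  qed
  have supp1: "supp (wt n c s) = obj c ` {..n}"
    if "s \<in> standard_simplex n" "\<And>i. i \<le> n \<Longrightarrow> 0 < s i" for n c s
  proof -
    have "{i. i \<le> n \<and> 0 < s i} = {..n}" using that(2) by auto
    then show ?thesis using supp_wt[OF that(1)] by simp
  qed
  have w: "wt n c s = wt n' c' s'"
    using arg_cong[OF sh, of fst] by (simp add: shape_def)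
  have G: "{f \<in> hops n c. src C f \<in> supp (wt n c s) \<and> tgt C f \<in> supp (wt n c s)} =
      {f \<in> hops n' c'. src C f \<in> supp (wt n c s) \<and> tgt C f \<in> supp (wt n c s)}"
    using arg_cong[OF sh, of snd] by (simp add: shape_def flip: w)
  have im: "obj c ` {..n} = obj c' ` {..n'}"
    using supp1[OF c(2,3), of c] supp1[OF c'(2,3), of c'] unfolding w by simp
  then have "card {..n} = card {..n'}" using card_image[OF c(4)] card_image[OF c'(4)] by simp
  then have n: "n' = n" by simp
  have rank: "card {y \<in> obj c ` {..n}. (y, obj c i) \<in> leq \<and> y \<noteq> obj c i} = i"
    if c: "c \<in> topspace (nerve C n)" "inj_on (obj c) {..n}" and i: "i \<le> n" for c n i
  proof -
    have "(obj c j, obj c i) \<in> leq \<and> obj c j \<noteq> obj c i \<longleftrightarrow> j < i"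
      if j: "j \<le> n" for j
    proof
      assume a: "(obj c j, obj c i) \<in> leq \<and> obj c j \<noteq> obj c i"
      show "j < i"
      proof (rule ccontr)
        assume "\<not> j < i"
        then have "(obj c i, obj c j) \<in> leq" using chain_leq[OF c(1), of i j] j by simp
        with a leq_antisym show False by blast
      qed
    next
      assume "j < i"
      then show "(obj c j, obj c i) \<in> leq \<and> obj c j \<noteq> obj c i"
        using chain_leq[OF c(1), of j i] c(2) i by (auto dest: inj_onD)
    qed
    note below = this
    have "{y \<in> obj c ` {..n}. (y, obj c i) \<in> leq \<and> y \<noteq> obj c i} = obj c ` {..<i}"
    proof (intro equalityI subsetI)
      fix y assume "y \<in> {y \<in> obj c ` {..n}. (y, obj c i) \<in> leq \<and> y \<noteq> obj c i}"
      then obtain j where "j \<le> n" "y = obj c j" "(obj c j, obj c i) \<in> leq \<and> obj c j \<noteq> obj c i"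
        by blast
      then show "y \<in> obj c ` {..<i}" using below by blast
    next
      fix y assume "y \<in> obj c ` {..<i}"
      then obtain j where "j < i" "y = obj c j" by blast
      then show "y \<in> {y \<in> obj c ` {..n}. (y, obj c i) \<in> leq \<and> y \<noteq> obj c i}"
        using below[of j] i by simp
    qed
    moreover have "inj_on (obj c) {..<i}" using c(2) i by (auto intro: inj_on_subset)
    ultimately show ?thesis by (simp add: card_image)
  qed
  have obj: "obj c i = obj c' i" if i: "i \<le> n" for i
  proof -
    obtain j where j: "j \<le> n" "obj c i = obj c' j" using im i n by auto
    have "i = j" using rank[OF c(1,4) i] rank[OF c'(1,4), of j] j im n by simp
    then show ?thesis using j by simp
  qed
  have "snd c = snd c'"
  proof (rule extensionalityI[of _ "{..<n}"])
    show "snd c \<in> extensional {..<n}" "snd c' \<in> extensional {..<n}"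
      using c(1) c'(1) n by (auto simp: nerve_iff)
    fix i assume i: "i \<in> {..<n}"
    have 1: "snd c i \<in> hops n c" using hop_Suc[OF c(1), of i] hopsI[of i "Suc i" n c] i by simp
    have 2: "snd c' i \<in> hops n c'" using hop_Suc[OF c'(1), of i] hopsI[of i "Suc i" n c'] i n by simp
    have st: "src C (snd c i) = obj c i" "tgt C (snd c i) = obj c (Suc i)"
      "src C (snd c' i) = obj c' i" "tgt C (snd c' i) = obj c' (Suc i)"
      using c(1) c'(1) i n by (auto simp: nerve_iff)
    have "src C (snd c i) \<in> supp (wt n c s)" "tgt C (snd c i) \<in> supp (wt n c s)"
      unfolding st supp1[OF c(2,3), of c, simplified] using i by (auto simp del: chain_obj_simps)
    then have "snd c i \<in> hops n c'" using 1 G n by blast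
    then show "snd c i = snd c' i"
      using hops_functional[OF c'(1)] 2 n st obj[of i] obj[of "Suc i"] i by (simp del: chain_obj_simps)
  qed
  moreover have "fst c = fst c'" using obj[of 0] by simp
  moreover have "s = s'"
  proof
    fix i
    show "s i = s' i"
    proof (cases "i \<le> n")
      case True
      then show ?thesis using wt1[OF True c(4)] wt1[of i n' c' s'] c'(4) w obj[OF True] n by metis
    next
      case False
      then show ?thesis using c(2) c'(2) n by (simp add: standard_simplex_def)
    qed
  qed
  ultimately show ?thesis using n by (simp add: prod_eq_iff)
qed

lemma cls_eq_iff:
  assumes "p \<in> topspace all_wchains" "q \<in> topspace all_wchains"
  shows "cls p = cls q \<longleftrightarrow> shape {} p = shape {} q"
proof
  assume "cls p = cls q"
  then show "shape {} p = shape {} q" using cls_eq equ_invariant by blast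
next
  assume sh: "shape {} p = shape {} q"
  obtain k c t where p: "p = (k, c, t)" by (cases p)
  obtain k' c' t' where q: "q = (k', c', t')" by (cases q)
  have ct: "c \<in> topspace (nerve C k)" "t \<in> standard_simplex k"
    and ct': "c' \<in> topspace (nerve C k')" "t' \<in> standard_simplex k'"
    using assms p q by simp_all
  obtain n d s where d: "d \<in> topspace (nerve C n)" "s \<in> standard_simplex n" "\<And>i. i \<le> n \<Longrightarrow> 0 < s i"
    "inj_on (obj d) {..n}" "(p, (n, d, s)) \<in> equ"
    unfolding p by (rule nondegenerate_rep[OF ct]) blast
  obtain n' d' s' where d': "d' \<in> topspace (nerve C n')" "s' \<in> standard_simplex n'" "\<And>i. i \<le> n' \<Longrightarrow> 0 < s' i"
    "inj_on (obj d') {..n'}" "(q, (n', d', s')) \<in> equ"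
    unfolding q by (rule nondegenerate_rep[OF ct']) blast
  have "shape {} (n, d, s) = shape {} (n', d', s')"
    using sh equ_invariant d(5) d'(5) by metis
  then have "(n, d, s) = (n', d', s')" using nondegenerate_unique[OF d(1-4) d'(1-4)] by blast
  then show "cls p = cls q" using d(5) d'(5) cls_eq equ_sym equ_trans by metis
qed

section \<open>Separating points by the invariant\<close>

lemma nerve_eq: "nerve C k =
   subtopology (prod_topology (Obj C) (product_topology (\<lambda>_. Mor C) {..<k}))
     {c. \<forall>i<k. src C (snd c i) = obj c i}"
  by (simp add: nerve_def)

lemma continuous_pre_mor:
  "i < k \<Longrightarrow> continuous_map (prod_topology (Obj C) (product_topology (\<lambda>_. Mor C) {..<k})) (Mor C) (\<lambda>c. snd c i)"
  by (rule continuous_map_compose[OF continuous_map_snd, unfolded o_def]) (rule continuous_map_product_projection, simp)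

lemma continuous_pre_obj:
  "i \<le> k \<Longrightarrow> continuous_map (prod_topology (Obj C) (product_topology (\<lambda>_. Mor C) {..<k})) (Obj C) (\<lambda>c. obj c i)"
proof (cases i)
  case 0
  then show ?thesis by (simp add: continuous_map_fst)
next
  case (Suc j)
  assume "i \<le> k"
  then show ?thesis
    using continuous_map_compose[OF continuous_pre_mor[of j k] continuous_tgt, unfolded o_def] Suc by simp
qed

lemma continuous_chain_mor: "i < k \<Longrightarrow> continuous_map (nerve C k) (Mor C) (\<lambda>c. snd c i)"
  unfolding nerve_eq by (intro continuous_map_from_subtopology continuous_pre_mor)

lemma continuous_chain_obj: "i \<le> k \<Longrightarrow> continuous_map (nerve C k) (Obj C) (\<lambda>c. obj c i)"
  unfolding nerve_eq by (intro continuous_map_from_subtopology continuous_pre_obj)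

lemma continuous_hop:
  assumes "i \<le> j" "j \<le> k"
  shows "continuous_map (nerve C k) (Mor C) (\<lambda>c. hop c i j)"
  using assms
proof (induction j rule: dec_induct)
  case base
  then show ?case
    using continuous_map_compose[OF continuous_chain_obj continuous_ident, unfolded o_def] by simp
next
  case (step n)
  have eq: "src C (snd c n) = tgt C (hop c i n)" if "c \<in> topspace (nerve C k)" for c
    using hop_Hom[OF that, of i n] that step by (simp add: nerve_iff Hom_iff)
  have "continuous_map (nerve C k) (prod_topology (Mor C) (Mor C)) (\<lambda>c. (snd c n, hop c i n))"
    using step continuous_chain_mor by (simp add: continuous_map_paired)
  then have "continuous_map (nerve C k) (subtopology (prod_topology (Mor C) (Mor C)) {(g, f). src C g = tgt C f})
      (\<lambda>c. (snd c n, hop c i n))"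
    using eq by (auto simp: continuous_map_in_subtopology)
  from continuous_map_compose[OF this continuous_cmp] step show ?case
    by (simp add: o_def hop_step)
qed

lemma openin_Obj: "S \<subseteq> Ob \<Longrightarrow> openin (Obj C) S"
  using discrete openin_discrete_topology by metis

lemma openin_Hom: "openin (Mor C) (Hom C x y)"
proof -
  have "openin (Mor C) {f \<in> Mo. src C f \<in> {x} \<inter> Ob}" "openin (Mor C) {f \<in> Mo. tgt C f \<in> {y} \<inter> Ob}"
    by (rule openin_continuous_map_preimage[OF continuous_src openin_Obj], blast,
        rule openin_continuous_map_preimage[OF continuous_tgt openin_Obj], blast)
  moreover have "Hom C x y = {f \<in> Mo. src C f \<in> {x} \<inter> Ob} \<inter> {f \<in> Mo. tgt C f \<in> {y} \<inter> Ob}"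
    using src_in tgt_in by (auto simp: Hom_iff)
  ultimately show ?thesis by (simp add: openin_Int)
qed

lemma continuous_weight: "continuous_map (wchains k) euclideanreal (\<lambda>p. snd p j)"
proof -
  have "continuous_map (Delta k) euclideanreal (\<lambda>t. t j)"
    by (intro continuous_map_from_subtopology continuous_map_product_projection) simp
  from continuous_map_compose[OF continuous_map_snd this] show ?thesis by (simp add: o_def)
qed

lemma openin_chain_obj:
  assumes "i \<le> k"
  shows "openin (wchains k) {p \<in> topspace (wchains k). obj (fst p) i \<in> S}"
proof -
  have "continuous_map (wchains k) (Obj C) (\<lambda>p. obj (fst p) i)"
    using continuous_map_compose[OF continuous_map_fst continuous_chain_obj[OF assms]] by (simp add: o_def)
  from openin_continuous_map_preimage[OF this openin_Obj[of "S \<inter> Ob"]]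
  have "openin (wchains k) {p \<in> topspace (wchains k). obj (fst p) i \<in> S \<inter> Ob}" by simp
  moreover have "{p \<in> topspace (wchains k). obj (fst p) i \<in> S \<inter> Ob} =
      {p \<in> topspace (wchains k). obj (fst p) i \<in> S}"
    using chain_obj_in[OF _ assms] by auto
  ultimately show ?thesis by simp
qed

lemma openin_positive: "openin (wchains k) {p \<in> topspace (wchains k). 0 < snd p j}"
  using openin_continuous_map_preimage[OF continuous_weight[of k j], of "{0<..}"] by simp

text \<open>Objects are locally constant, and an object enters the support as soon as one of its
  occurrences has positive weight, which is an open condition.\<close>

lemma openin_marked:
  assumes i: "i \<le> k"
  shows "openin (wchains k) {p \<in> topspace (wchains k). obj (fst p) i \<in> B \<union> supp (wt k (fst p) (snd p))}"
proof -
  have "openin (wchains k) {p \<in> topspace (wchains k). obj (fst p) i = obj (fst p) j}" if "j \<le> k" for j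
  proof -
    have "{p \<in> topspace (wchains k). obj (fst p) i = obj (fst p) j} =
      (\<Union>y. {p \<in> topspace (wchains k). obj (fst p) i \<in> {y}} \<inter> {p \<in> topspace (wchains k). obj (fst p) j \<in> {y}})"
      by auto
    moreover have "openin (wchains k) ({p \<in> topspace (wchains k). obj (fst p) i \<in> {y}} \<inter>
        {p \<in> topspace (wchains k). obj (fst p) j \<in> {y}})" for y
      by (intro openin_Int openin_chain_obj i that)
    ultimately show ?thesis by (metis (no_types, lifting) openin_Union image_iff)
  qed
  then have "openin (wchains k) ({p \<in> topspace (wchains k). obj (fst p) i \<in> B} \<union>
      (\<Union>j\<in>{..k}. {p \<in> topspace (wchains k). obj (fst p) i = obj (fst p) j} \<inter>
        {p \<in> topspace (wchains k). 0 < snd p j}))" (is "openin _ ?U")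
    using openin_chain_obj[OF i] openin_positive by (intro openin_Un openin_Union) auto
  moreover have "?U = {p \<in> topspace (wchains k). obj (fst p) i \<in> B \<union> supp (wt k (fst p) (snd p))}"
    by (auto simp: supp_wt)
  ultimately show ?thesis by simp
qed

lemma continuous_wt: "continuous_map (wchains k) euclideanreal (\<lambda>p. wt k (fst p) (snd p) y)"
proof -
  \<comment> \<open>Indicators of objects are continuous because the space of objects is
    discrete.\<close>
  have ind: "continuous_map (wchains k) euclideanreal (\<lambda>p. if obj (fst p) i = y then 1 else 0)"
    if "i \<le> k" for i
  proof -
    have "continuous_map (discrete_topology Ob) euclideanreal (\<lambda>z. if z = y then 1 else 0)" by simp
    then have o: "continuous_map (Obj C) euclideanreal (\<lambda>z. if z = y then 1 else 0)" by (simp flip: discrete)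
    have "continuous_map (wchains k) (Obj C) (\<lambda>p. obj (fst p) i)"
      using continuous_map_compose[OF continuous_map_fst continuous_chain_obj[OF that]] by (simp add: o_def)
    from continuous_map_compose[OF this o] show ?thesis by (simp add: o_def)
  qed
  have "continuous_map (wchains k) euclideanreal
      (\<lambda>p. \<Sum>i\<in>{..k}. (if obj (fst p) i = y then 1 else 0) * snd p i)"
    using ind continuous_weight by (intro continuous_map_sum continuous_map_real_mult) auto
  moreover have "(\<lambda>p. \<Sum>i\<in>{..k}. (if obj (fst p) i = y then 1 else 0) * snd p i) =
      (\<lambda>p. wt k (fst p) (snd p) y)"
  proof
    fix p :: "('o, 'm) chain \<times> (nat \<Rightarrow> real)"
    have "(\<Sum>i\<in>{..k}. (if obj (fst p) i = y then 1 else 0) * snd p i) =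
        (\<Sum>i\<in>{..k}. if obj (fst p) i = y then snd p i else 0)"
      by (intro sum.cong) auto
    also have "\<dots> = (\<Sum>i | i \<in> {..k} \<and> obj (fst p) i = y. snd p i)"
      by (rule sum.inter_filter[symmetric]) simp
    finally show "(\<Sum>i\<in>{..k}. (if obj (fst p) i = y then 1 else 0) * snd p i) = wt k (fst p) (snd p) y"
      by (simp add: wt_def)
  qed
  ultimately show ?thesis by simp
qed

lemma shape_fst: "fst (shape B (k, p)) = wt k (fst p) (snd p)"
  by (simp add: shape_def split: prod.splits)

lemma shape_snd: "f \<in> snd (shape B (k, p)) \<longleftrightarrow> f \<in> hops k (fst p) \<and>
    src C f \<in> B \<union> supp (wt k (fst p) (snd p)) \<and> tgt C f \<in> B \<union> supp (wt k (fst p) (snd p))"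
  by (simp add: shape_def split: prod.splits)

text \<open>The morphism part of the invariant is lower semicontinuous: composites depend
  continuously on the chain, and marked objects stay marked nearby. It may jump upwards, since the
  support can grow.\<close>

lemma openin_hops:
  assumes U: "openin (Mor C) U"
  shows "openin (wchains k) {p \<in> topspace (wchains k). snd (shape B (k, p)) \<inter> U \<noteq> {}}"
proof -
  have hU: "openin (wchains k) {p \<in> topspace (wchains k). hop (fst p) i j \<in> U}" if "i \<le> j" "j \<le> k" for i j
  proof -
    have "continuous_map (wchains k) (Mor C) (\<lambda>p. hop (fst p) i j)"
      using continuous_map_compose[OF continuous_map_fst continuous_hop[OF that]] by (simp add: o_def)
    from openin_continuous_map_preimage[OF this U] show ?thesis .
  qed
  define V where "V i j = {p \<in> topspace (wchains k). hop (fst p) i j \<in> U} \<inter>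
      ({p \<in> topspace (wchains k). obj (fst p) i \<in> B \<union> supp (wt k (fst p) (snd p))} \<inter>
       {p \<in> topspace (wchains k). obj (fst p) j \<in> B \<union> supp (wt k (fst p) (snd p))})" for i j
  have V: "openin (wchains k) (V i j)" if "i \<le> j" "j \<le> k" for i j
    unfolding V_def by (intro openin_Int hU openin_marked that order_trans[OF that])
  have "{p \<in> topspace (wchains k). snd (shape B (k, p)) \<inter> U \<noteq> {}} = (\<Union>j\<in>{..k}. \<Union>i\<in>{..j}. V i j)"
  proof (intro equalityI subsetI)
    fix p assume "p \<in> {p \<in> topspace (wchains k). snd (shape B (k, p)) \<inter> U \<noteq> {}}"
    then obtain f where p: "p \<in> topspace (wchains k)" "f \<in> snd (shape B (k, p))" "f \<in> U" by blast
    then have c: "fst p \<in> topspace (nerve C k)" by auto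
    obtain i j where "i \<le> j" "j \<le> k" "f = hop (fst p) i j" "src C f = obj (fst p) i" "tgt C f = obj (fst p) j"
      using hopsE[OF c] p(2) unfolding shape_snd by metis
    then have "p \<in> V i j" "j \<in> {..k}" "i \<in> {..j}" using p unfolding shape_snd V_def by (simp_all del: wchains_iff topspace_prod_topology)
    then show "p \<in> (\<Union>j\<in>{..k}. \<Union>i\<in>{..j}. V i j)" by blast
  next
    fix p assume "p \<in> (\<Union>j\<in>{..k}. \<Union>i\<in>{..j}. V i j)"
    then obtain i j where ij: "i \<le> j" "j \<le> k" and p: "p \<in> V i j" by auto
    then have c: "fst p \<in> topspace (nerve C k)" by (auto simp: V_def)
    have "hop (fst p) i j \<in> snd (shape B (k, p)) \<inter> U"
      using p hop_Hom[OF c ij] hopsI[OF ij, of "fst p"] unfolding V_def Hom_iff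
      by (simp add: shape_snd del: topspace_prod_topology)
    moreover have "p \<in> topspace (wchains k)" using p unfolding V_def by blast
    ultimately show "p \<in> {p \<in> topspace (wchains k). snd (shape B (k, p)) \<inter> U \<noteq> {}}" by blast
  qed
  moreover have "openin (wchains k) (\<Union>j\<in>{..k}. \<Union>i\<in>{..j}. V i j)"
    using V by (intro openin_Union) auto
  ultimately show ?thesis by simp
qed

section \<open>Open sets of invariants\<close>

definition functional :: "'m set \<Rightarrow> bool" where
  "functional G \<longleftrightarrow> (\<forall>f\<in>G. \<forall>g\<in>G. src C f = src C g \<longrightarrow> tgt C f = tgt C g \<longrightarrow> f = g)"

lemma functional_shape:
  assumes "p \<in> topspace (wchains k)"
  shows "functional (snd (shape B (k, p)))"
proof -
  have "fst p \<in> topspace (nerve C k)" using assms by auto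
  then show ?thesis unfolding functional_def using hops_functional shape_snd by blast
qed

text \<open>Openness is tested on weighted chains of every length and does not refer to a quotient,
  so the same notion serves for the classifying space and for the stars.\<close>

definition open_shapes :: "'o set \<Rightarrow> (('o \<Rightarrow> real) \<times> 'm set) set \<Rightarrow> bool" where
  "open_shapes B P \<longleftrightarrow> (\<forall>k. openin (wchains k) {p \<in> topspace (wchains k). shape B (k, p) \<in> P})"

lemma separate_wt:
  assumes "fst I y \<noteq> fst J y"
  shows "\<exists>P Q. open_shapes B P \<and> open_shapes B Q \<and> I \<in> P \<and> J \<in> Q \<and> P \<inter> Q = {}"
proof -
  obtain U V where UV: "open U" "open V" "fst I y \<in> U" "fst J y \<in> V" "U \<inter> V = {}"
    using hausdorff[OF assms] by blast
  have "open_shapes B {I. fst I y \<in> U}" if "open U" for U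
    unfolding open_shapes_def
  proof
    fix k
    from openin_continuous_map_preimage[OF continuous_wt[of k y], of U] that
    show "openin (wchains k) {p \<in> topspace (wchains k). shape B (k, p) \<in> {I. fst I y \<in> U}}"
      by (simp add: shape_fst)
  qed
  then have "open_shapes B {I. fst I y \<in> U}" "open_shapes B {I. fst I y \<in> V}" using UV by auto
  then show ?thesis using UV by (intro exI[of _ "{I. fst I y \<in> U}"] exI[of _ "{I. fst I y \<in> V}"]) auto
qed

text \<open>For equal weights the marked objects agree, and the chain of \<open>q\<close> passes
  through both ends of \<open>g\<close>. So it contains a morphism \<open>h\<close> parallel to
  \<open>g\<close> and different from it, and the Hausdorff space of morphisms between these ends
  separates the two.\<close>

lemma separate_mor:
  assumes p: "p \<in> topspace (wchains k)" and q: "q \<in> topspace (wchains l)"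
    and B: "B \<subseteq> obj (fst q) ` {..l}"
    and w: "fst (shape B (k, p)) = fst (shape B (l, q))"
    and g: "g \<in> snd (shape B (k, p))" "g \<notin> snd (shape B (l, q))"
  shows "\<exists>P Q. open_shapes B P \<and> open_shapes B Q \<and> shape B (k, p) \<in> P \<and> shape B (l, q) \<in> Q \<and> P \<inter> Q = {}"
proof -
  define A where "A = B \<union> supp (wt l (fst q) (snd q))"
  have A: "A = B \<union> supp (wt k (fst p) (snd p))" using w by (simp add: A_def shape_fst)
  have cp: "fst p \<in> topspace (nerve C k)" and cq: "fst q \<in> topspace (nerve C l)" and tq: "snd q \<in> standard_simplex l"
    using p q by auto
  have Aq: "A \<subseteq> obj (fst q) ` {..l}"
    using B supp_wt[OF tq, of "fst q"] by (auto simp: A_def)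
  obtain i j where ij: "i \<le> l" "j \<le> l" "src C g = obj (fst q) i" "tgt C g = obj (fst q) j"
    using g(1) subsetD[OF Aq, of "src C g"] subsetD[OF Aq, of "tgt C g"] unfolding shape_snd A[symmetric] by auto
  have gA: "g \<in> Mo" "src C g \<in> A" "tgt C g \<in> A"
    using g(1) hopsE[OF cp] unfolding shape_snd A[symmetric] by blast+
  have "\<exists>h \<in> snd (shape B (l, q)). src C h = src C g \<and> tgt C h = tgt C g"
  proof (cases "i \<le> j")
    case True
    have "hop (fst q) i j \<in> snd (shape B (l, q))"
      unfolding shape_snd A_def[symmetric]
      using hopsI[OF True ij(2)] hop_Hom[OF cq True ij(2)] gA ij by (simp add: Hom_iff)
    then show ?thesis using hop_Hom[OF cq True ij(2)] ij by (auto simp: Hom_iff)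
  next
    case False
    then have ji: "j \<le> i" by simp
    have "(tgt C g, src C g) \<in> leq" using chain_leq[OF cq ji ij(1)] ij by simp
    moreover have "(src C g, tgt C g) \<in> leq" using gA by (intro leqI[of g]) (simp add: Hom_iff)
    ultimately have eq: "src C g = tgt C g" by (rule leq_antisym[rotated])
    have "hop (fst q) i i \<in> snd (shape B (l, q))"
      unfolding shape_snd A_def[symmetric]
      using hopsI[OF order_refl ij(1)] hop_Hom[OF cq order_refl ij(1)] gA ij by (simp add: Hom_iff)
    then show ?thesis using hop_Hom[OF cq order_refl ij(1)] ij eq by (auto simp: Hom_iff)
  qed
  then obtain h where h: "h \<in> snd (shape B (l, q))" "src C h = src C g" "tgt C h = tgt C g" by blast
  let ?H = "Hom C (src C g) (tgt C g)"
  have hM: "h \<in> Mo" using h(1) hopsE[OF cq] unfolding shape_snd by blast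
  have gh: "g \<in> ?H" "h \<in> ?H" "g \<noteq> h" using gA h hM g by (auto simp: Hom_iff)
  have "Hausdorff_space (subtopology (Mor C) ?H)"
    using compact_Hausdorff_Hom src_in tgt_in gA by blast
  then obtain U V where UV: "openin (subtopology (Mor C) ?H) U" "openin (subtopology (Mor C) ?H) V"
      "g \<in> U" "h \<in> V" "disjnt U V"
    using gh gA hM unfolding Hausdorff_space_def by (metis IntI topspace_subtopology)
  have UV': "openin (Mor C) U" "openin (Mor C) V" "U \<subseteq> ?H" "V \<subseteq> ?H"
    using UV openin_Hom openin_trans_full openin_subset by (blast, blast, auto dest!: openin_subset)
  \<comment> \<open>Functionality holds for every shape and so does not change the preimages, but it
    keeps the two sets of invariants disjoint: a functional set cannot meet both \<open>U\<close>
    and \<open>V\<close>.\<close>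
  have op: "open_shapes B {I. functional (snd I) \<and> snd I \<inter> U \<noteq> {}}" if "openin (Mor C) U" for U
    unfolding open_shapes_def
  proof
    fix k
    have "{p \<in> topspace (wchains k). shape B (k, p) \<in> {I. functional (snd I) \<and> snd I \<inter> U \<noteq> {}}} =
        {p \<in> topspace (wchains k). snd (shape B (k, p)) \<inter> U \<noteq> {}}"
      using functional_shape by blast
    then show "openin (wchains k) {p \<in> topspace (wchains k). shape B (k, p) \<in> {I. functional (snd I) \<and> snd I \<inter> U \<noteq> {}}}"
      using openin_hops[OF that] by simp
  qed
  have dis: "{I :: ('o \<Rightarrow> real) \<times> 'm set. functional (snd I) \<and> snd I \<inter> U \<noteq> {}} \<inter> {I. functional (snd I) \<and> snd I \<inter> V \<noteq> {}} = {}"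
  proof -
    have False if G: "functional G" "f \<in> G \<inter> U" "f' \<in> G \<inter> V" for G f f'
    proof -
      have "f \<in> ?H" "f' \<in> ?H" using UV'(3,4) G by auto
      then have "src C f = src C f'" "tgt C f = tgt C f'" by (simp_all add: Hom_iff)
      then have "f = f'" using G unfolding functional_def by blast
      then show False using G UV(5) by (auto simp: disjnt_def)
    qed
    then show ?thesis by blast
  qed
  show ?thesis
    using op[OF UV'(1)] op[OF UV'(2)] dis functional_shape[OF p, of B] functional_shape[OF q, of B] g(1) h(1) UV(3,4)
    by (intro exI[of _ "{I. functional (snd I) \<and> snd I \<inter> U \<noteq> {}}"] exI[of _ "{I. functional (snd I) \<and> snd I \<inter> V \<noteq> {}}"]) auto
qed

lemma separate:
  assumes p: "p \<in> topspace (wchains k)" and q: "q \<in> topspace (wchains l)"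
    and B: "B \<subseteq> obj (fst p) ` {..k}" "B \<subseteq> obj (fst q) ` {..l}"
    and ne: "shape B (k, p) \<noteq> shape B (l, q)"
  shows "\<exists>P Q. open_shapes B P \<and> open_shapes B Q \<and> shape B (k, p) \<in> P \<and> shape B (l, q) \<in> Q \<and> P \<inter> Q = {}"
proof (cases "fst (shape B (k, p)) = fst (shape B (l, q))")
  case True
  then have "snd (shape B (k, p)) \<noteq> snd (shape B (l, q))" using ne by (simp add: prod_eq_iff)
  then consider g where "g \<in> snd (shape B (k, p))" "g \<notin> snd (shape B (l, q))"
    | g where "g \<in> snd (shape B (l, q))" "g \<notin> snd (shape B (k, p))" by blast
  then show ?thesis
  proof cases
    case 1
    then show ?thesis by (rule separate_mor[OF p q B(2) True])
  next
    case 2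
    then have "\<exists>P Q. open_shapes B P \<and> open_shapes B Q \<and> shape B (l, q) \<in> P \<and> shape B (k, p) \<in> Q \<and> P \<inter> Q = {}"
      by (rule separate_mor[OF q p B(1) True[symmetric]])
    then show ?thesis by (metis Int_commute)
  qed
next
  case False
  then obtain y where "fst (shape B (k, p)) y \<noteq> fst (shape B (l, q)) y" by blast
  then show ?thesis by (rule separate_wt)
qed

lemma openin_all_wchains:
  assumes "open_shapes B P"
  shows "openin all_wchains {p \<in> topspace all_wchains. shape B p \<in> P}"
  unfolding all_wchains_def openin_sum_topology
proof (intro conjI ballI)
  fix k
  have "{p. (k, p) \<in> {p \<in> topspace (sum_topology wchains UNIV). shape B p \<in> P}} =
      {p \<in> topspace (wchains k). shape B (k, p) \<in> P}"
    by auto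
  then show "openin (wchains k) {p. (k, p) \<in> {p \<in> topspace (sum_topology wchains UNIV). shape B p \<in> P}}"
    using assms by (simp add: open_shapes_def)
qed auto

lemma Hausdorff_classifying_space: "Hausdorff_space (classifying_space C)"
proof (rule Hausdorff_quotient[OF quotient_map_cls cls_eq_iff])
  fix a b assume ab: "a \<in> topspace all_wchains" "b \<in> topspace all_wchains" "shape {} a \<noteq> shape {} b"
  obtain k p l q where "a = (k, p)" "b = (l, q)" by (cases a, cases b)
  with ab show "\<exists>P Q. openin all_wchains {p \<in> topspace all_wchains. shape {} p \<in> P} \<and>
      openin all_wchains {p \<in> topspace all_wchains. shape {} p \<in> Q} \<and> shape {} a \<in> P \<and> shape {} b \<in> Q \<and> P \<inter> Q = {}"
    using separate[of p k q l "{}"] openin_all_wchains by (cases p, cases q) (simp, meson)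
qed

section \<open>The closed stars\<close>

definition height :: "'o \<Rightarrow> nat" where
  "height x = card (strictly_below C x)"

text \<open>Chains of the fixed length \<open>height x\<close> ending at \<open>x\<close> suffice, since shorter ones may be padded
  with identities of \<open>x\<close>.\<close>

definition padded :: "'o \<Rightarrow> (('o, 'm) chain \<times> (nat \<Rightarrow> real)) topology" where
  "padded x = subtopology (wchains (height x)) {p. obj (fst p) (height x) = x}"

definition pshape :: "'o \<Rightarrow> ('o, 'm) chain \<times> (nat \<Rightarrow> real) \<Rightarrow> ('o \<Rightarrow> real) \<times> 'm set" where
  "pshape x p = shape {x} (height x, p)"

text \<open>The fibre of \<open>pshape x\<close> over \<open>I\<close>, kept as a set of weighted
  chains so that stars have the same type as the classifying space. The invariant is recovered by
  \<open>data\<close>, which chooses a representative.\<close>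

definition point :: "'o \<Rightarrow> ('o \<Rightarrow> real) \<times> 'm set \<Rightarrow> ('o, 'm) bpoint" where
  "point x I = Pair (height x) ` {p \<in> topspace (padded x). pshape x p = I}"

definition star :: "'o \<Rightarrow> ('o, 'm) bpoint topology" where
  "star x = coinduced_topology ((\<lambda>p. point x (pshape x p)) ` topspace (padded x)) (padded x) (\<lambda>p. point x (pshape x p))"

definition data :: "'o \<Rightarrow> ('o, 'm) bpoint \<Rightarrow> ('o \<Rightarrow> real) \<times> 'm set" where
  "data x e = pshape x (snd (SOME a. a \<in> e))"

lemma padded_iff [simp]: "(c, t) \<in> topspace (padded x) \<longleftrightarrow>
    c \<in> topspace (nerve C (height x)) \<and> t \<in> standard_simplex (height x) \<and> obj c (height x) = x"
  by (auto simp: padded_def)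

lemma quotient_map_star: "quotient_map (padded x) (star x) (\<lambda>p. point x (pshape x p))"
  unfolding star_def by (rule quotient_map_coinduced_topology)

lemma continuous_map_star: "continuous_map (padded x) (star x) (\<lambda>p. point x (pshape x p))"
  using quotient_map_star quotient_imp_continuous_map by blast

lemma topspace_star: "topspace (star x) = (\<lambda>p. point x (pshape x p)) ` topspace (padded x)"
  using quotient_map_star[of x] by (simp add: quotient_map_def)

lemma starE:
  assumes "e \<in> topspace (star x)"
  obtains c t where "(c, t) \<in> topspace (padded x)" "e = point x (pshape x (c, t))"
proof -
  obtain p where "p \<in> topspace (padded x)" "e = point x (pshape x p)"
    using assms unfolding topspace_star by blast
  then show ?thesis using that[of "fst p" "snd p"] by simp
qed

lemma point_in_star: "p \<in> topspace (padded x) \<Longrightarrow> point x (pshape x p) \<in> topspace (star x)"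
  unfolding topspace_star by blast

lemma some_in_point:
  assumes "p \<in> topspace (padded x)"
  obtains q where "q \<in> topspace (padded x)" "pshape x q = pshape x p"
    "(SOME a. a \<in> point x (pshape x p)) = (height x, q)"
proof -
  have "(height x, p) \<in> point x (pshape x p)" using assms by (simp add: point_def)
  then have "(SOME a. a \<in> point x (pshape x p)) \<in> point x (pshape x p)" by (rule someI)
  then show ?thesis using that by (auto simp: point_def)
qed

lemma data_point: "p \<in> topspace (padded x) \<Longrightarrow> data x (point x (pshape x p)) = pshape x p"
  by (erule some_in_point) (simp add: data_def)

lemma point_data: "e \<in> topspace (star x) \<Longrightarrow> point x (data x e) = e"
  using data_point by (auto simp: topspace_star)

lemma point_eq_iff:
  "p \<in> topspace (padded x) \<Longrightarrow> q \<in> topspace (padded x) \<Longrightarrow>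
    point x (pshape x p) = point x (pshape x q) \<longleftrightarrow> pshape x p = pshape x q"
  using data_point by metis

lemma Hausdorff_Obj: "Hausdorff_space (Obj C)"
  using Hausdorff_space_discrete_topology[of Ob] by (simp flip: discrete)

lemma compactin_Hom:
  assumes "x \<in> Ob" "y \<in> Ob"
  shows "compactin (Mor C) (Hom C x y)"
  unfolding compactin_subspace using compact_Hausdorff_Hom[OF assms] by (auto simp: Hom_iff)

text \<open>All objects of a chain ending at \<open>x\<close> lie in the finite set
  \<open>F\<close>, and all its morphisms in the finite union \<open>H\<close> of compact spaces.
  The remaining conditions are equations between objects, hence closed as \<open>Obj C\<close> is
  discrete.\<close>

lemma compactin_chains:
  assumes x: "x \<in> Ob"
  shows "compactin (nerve C n) {c \<in> topspace (nerve C n). obj c n = x}"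
proof -
  let ?P = "prod_topology (Obj C) (product_topology (\<lambda>_. Mor C) {..<n})"
  define F where "F = insert x (strictly_below C x)"
  have finF: "finite F" using finite_below[OF x] by (simp add: F_def)
  have F: "y \<in> F \<longleftrightarrow> (y, x) \<in> leq" for y
    using leq_refl[OF x] by (auto simp: F_def strictly_below_iff)
  then have FOb: "F \<subseteq> Ob" using leq_in by blast
  define H where "H = (\<Union>(y, z)\<in>F \<times> F. Hom C y z)"
  have "compactin (Mor C) H"
    unfolding H_def using finF FOb compactin_Hom by (intro compactin_Union) auto
  then have "compactin ?P (F \<times> (\<Pi>\<^sub>E i\<in>{..<n}. H))"
    using FOb finF by (simp add: compactin_Times compactin_PiE finite_imp_compactin)
  moreover have closed_eq: "closedin ?P {c \<in> topspace ?P. src C (snd c i) = obj c i}" if "i < n" for i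
    using continuous_map_compose[OF continuous_pre_mor[OF that] continuous_src] continuous_pre_obj[of i n] that
    by (intro closedin_continuous_maps_eq[OF Hausdorff_Obj]) (simp_all add: o_def)
  have "closedin ?P {c \<in> topspace ?P. \<forall>i<n. src C (snd c i) = obj c i}"
  \<comment> \<open>For \<open>n = 0\<close> the intersection below would have an empty index set
    and be the whole type.\<close>
  proof (cases "n = 0")
    case True
    then have "\<not> i < n" for i by simp
    then have eq: "{c \<in> topspace ?P. \<forall>i<n. src C (snd c i) = obj c i} = topspace ?P" by blast
    show ?thesis unfolding eq by (rule closedin_topspace)
  next
    case False
    have "{c \<in> topspace ?P. \<forall>i<n. src C (snd c i) = obj c i} =
        (\<Inter>i\<in>{..<n}. {c \<in> topspace ?P. src C (snd c i) = obj c i})"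
      using False by auto
    moreover have "closedin ?P (\<Inter>i\<in>{..<n}. {c \<in> topspace ?P. src C (snd c i) = obj c i})"
      using False closed_eq by (intro closedin_INT) auto
    ultimately show ?thesis by (simp only:)
  qed
  moreover have "closedin ?P {c \<in> topspace ?P. obj c n = x}"
    using x by (intro closedin_continuous_maps_eq[OF Hausdorff_Obj] continuous_pre_obj) auto
  ultimately have "compactin ?P ({c \<in> topspace ?P. \<forall>i<n. src C (snd c i) = obj c i} \<inter>
      ({c \<in> topspace ?P. obj c n = x} \<inter> (F \<times> (\<Pi>\<^sub>E i\<in>{..<n}. H))))" (is "compactin _ ?K")
    by (intro closed_Int_compactin)
  moreover have "?K = {c \<in> topspace (nerve C n). obj c n = x}"
  proof (intro equalityI subsetI)
    fix c assume "c \<in> ?K"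
    then have "c \<in> topspace ?P" "\<forall>i<n. src C (snd c i) = obj c i" "obj c n = x" by blast+
    then show "c \<in> {c \<in> topspace (nerve C n). obj c n = x}"
      unfolding nerve_eq topspace_subtopology by blast
  next
    fix c assume "c \<in> {c \<in> topspace (nerve C n). obj c n = x}"
    then have c: "c \<in> topspace (nerve C n)" "obj c n = x" by blast+
    then have c': "c \<in> topspace ?P" "\<forall>i<n. src C (snd c i) = obj c i"
      unfolding nerve_eq topspace_subtopology by blast+
    have objF: "obj c i \<in> F" if "i \<le> n" for i
      unfolding F using chain_leq[OF c(1) that] c(2) by simp
    have "snd c i \<in> H" if "i < n" for i
    proof -
      have "snd c i \<in> Hom C (obj c i) (obj c (Suc i))"
        using c(1) that by (simp add: nerve_iff Hom_iff)
      moreover have "obj c i \<in> F" "obj c (Suc i) \<in> F"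
        using objF that by (simp_all del: chain_obj_simps)
      ultimately show ?thesis unfolding H_def by blast
    qed
    then have "snd c \<in> (\<Pi>\<^sub>E i\<in>{..<n}. H)" using c(1) by (auto simp: nerve_iff PiE_iff)
    moreover have "fst c \<in> F" using objF[of 0] by simp
    ultimately have "c \<in> F \<times> (\<Pi>\<^sub>E i\<in>{..<n}. H)" by (simp add: mem_Times_iff)
    then show "c \<in> ?K" using c c' by blast
  qed
  ultimately have "compactin ?P {c \<in> topspace (nerve C n). obj c n = x}" by simp
  moreover have "{c \<in> topspace (nerve C n). obj c n = x} \<subseteq> {c. \<forall>i<n. src C (snd c i) = obj c i}"
    by (auto simp: nerve_iff)
  ultimately show ?thesis unfolding nerve_eq[of n] compactin_subtopology by (simp add: nerve_eq)
qed

lemma compact_space_padded: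
  assumes "x \<in> Ob"
  shows "compact_space (padded x)"
proof -
  let ?A = "{c \<in> topspace (nerve C (height x)). obj c (height x) = x}"
  have "compactin (Delta (height x)) (standard_simplex (height x))"
    by (simp add: compactin_subtopology compactin_standard_simplex)
  then have "compactin (wchains (height x)) (?A \<times> standard_simplex (height x))"
    using compactin_chains[OF assms, of "height x"] by (simp add: compactin_Times)
  moreover have "topspace (padded x) = ?A \<times> standard_simplex (height x)"
    by auto
  moreover have "padded x = subtopology (wchains (height x)) (topspace (padded x))"
    unfolding padded_def topspace_subtopology subtopology_restrict ..
  ultimately show ?thesis by (metis compact_space_subtopology)
qed

lemma compact_space_star: "x \<in> Ob \<Longrightarrow> compact_space (star x)"
  unfolding compact_space_def topspace_star
  by (rule image_compactin[OF _ continuous_map_star]) (simp add: compact_space_padded flip: compact_space_def)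

lemma Hausdorff_star: "Hausdorff_space (star x)"
proof (rule Hausdorff_quotient[OF quotient_map_star point_eq_iff])
  fix p q assume p: "p \<in> topspace (padded x)" and q: "q \<in> topspace (padded x)" and ne: "pshape x p \<noteq> pshape x q"
  have sub: "topspace (padded x) \<subseteq> topspace (wchains (height x))" by (auto simp: padded_def)
  have "{x} \<subseteq> obj (fst r) ` {..height x}" if "r \<in> topspace (padded x)" for r
  proof -
    have "x = obj (fst r) (height x)" using that unfolding padded_def by auto
    then show ?thesis by blast
  qed
  note mark = this
  then obtain P Q where PQ: "open_shapes {x} P" "open_shapes {x} Q" "pshape x p \<in> P" "pshape x q \<in> Q" "P \<inter> Q = {}"
    using separate[OF subsetD[OF sub p] subsetD[OF sub q] mark[OF p] mark[OF q]] ne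
    unfolding pshape_def by blast
  have "openin (padded x) {p \<in> topspace (padded x). pshape x p \<in> P}" if "open_shapes {x} P" for P
  proof -
    have "{p \<in> topspace (padded x). pshape x p \<in> P} =
        {p \<in> topspace (wchains (height x)). shape {x} (height x, p) \<in> P} \<inter> {p. obj (fst p) (height x) = x}"
      by (auto simp: pshape_def)
    then show ?thesis using that unfolding padded_def open_shapes_def openin_subtopology by blast
  qed
  then show "\<exists>P Q. openin (padded x) {p \<in> topspace (padded x). pshape x p \<in> P} \<and>
      openin (padded x) {p \<in> topspace (padded x). pshape x p \<in> Q} \<and> pshape x p \<in> P \<and> pshape x q \<in> Q \<and> P \<inter> Q = {}"
    using PQ by blast
qed

lemma continuous_data: "continuous_map (star x) euclideanreal (\<lambda>e. fst (data x e) y)"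
proof (rule continuous_compose_quotient_map[OF quotient_map_star])
  have "continuous_map (padded x) euclideanreal (\<lambda>p. wt (height x) (fst p) (snd p) y)"
    unfolding padded_def by (intro continuous_map_from_subtopology continuous_wt)
  then show "continuous_map (padded x) euclideanreal ((\<lambda>e. fst (data x e) y) \<circ> (\<lambda>p. point x (pshape x p)))"
    by (rule continuous_map_eq) (simp add: data_point, simp add: pshape_def shape_fst)
qed

section \<open>The characteristic maps on stars\<close>

definition chr :: "'o \<Rightarrow> ('o, 'm) bpoint \<Rightarrow> ('o, 'm) bpoint" where
  "chr x e = cls (SOME a. a \<in> e)"

lemma padded_all: "p \<in> topspace (padded x) \<Longrightarrow> (height x, p) \<in> topspace all_wchains"
  by (cases p) simp

lemma pshape_restrict:
  "shape {} (height x, p) = (fst (pshape x p),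
     {f \<in> snd (pshape x p). src C f \<in> supp (fst (pshape x p)) \<and> tgt C f \<in> supp (fst (pshape x p))})"
  unfolding pshape_def by (cases p) (auto simp: shape_def)

text \<open>The invariant without marks is a function of the marked one
  (\<open>pshape_restrict\<close>), so all representatives of a point of the star have the same
  class, and the choice in \<open>chr\<close> does no harm.\<close>

lemma chr_point:
  assumes p: "p \<in> topspace (padded x)"
  shows "chr x (point x (pshape x p)) = cls (height x, p)"
proof -
  obtain q where q: "q \<in> topspace (padded x)" "pshape x q = pshape x p"
    "(SOME a. a \<in> point x (pshape x p)) = (height x, q)"
    using some_in_point[OF p] .
  have "shape {} (height x, q) = shape {} (height x, p)"
    unfolding pshape_restrict q(2) ..
  then show ?thesis
    unfolding chr_def q(3) using cls_eq_iff[OF padded_all[OF q(1)] padded_all[OF p]] by simp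
qed

lemma continuous_chr: "continuous_map (star x) (classifying_space C) (chr x)"
proof (rule continuous_compose_quotient_map[OF quotient_map_star])
  have "continuous_map (wchains (height x)) all_wchains (Pair (height x))"
    unfolding all_wchains_def by (rule continuous_map_component_injection) simp
  then have "continuous_map (padded x) (classifying_space C) (\<lambda>p. cls (height x, p))"
    unfolding padded_def
    using continuous_map_compose[OF _ quotient_imp_continuous_map[OF quotient_map_cls]]
    by (intro continuous_map_from_subtopology) (auto simp: o_def)
  then show "continuous_map (padded x) (classifying_space C) (chr x \<circ> (\<lambda>p. point x (pshape x p)))"
    by (rule continuous_map_eq) (simp add: chr_point)
qed

definition bdata :: "('o, 'm) bpoint \<Rightarrow> ('o \<Rightarrow> real) \<times> 'm set" where
  "bdata b = shape {} (SOME p. p \<in> b)"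

lemma bdata_cls: "bdata (cls p) = shape {} p"
proof -
  have "p \<in> cls p" by (simp add: cls_def equ_refl)
  then have "(SOME q. q \<in> cls p) \<in> cls p" by (rule someI)
  then have "(p, SOME q. q \<in> cls p) \<in> equ" by (simp add: cls_def)
  then show ?thesis unfolding bdata_def using equ_invariant by metis
qed

lemma topspace_classifying_space: "topspace (classifying_space C) = cls ` topspace all_wchains"
  using quotient_map_cls by (simp add: quotient_map_def)

lemma continuous_bdata: "continuous_map (classifying_space C) euclideanreal (\<lambda>b. fst (bdata b) y)"
proof (rule continuous_compose_quotient_map[OF quotient_map_cls])
  have "continuous_map all_wchains euclideanreal (\<lambda>p. fst (shape {} p) y)"
    unfolding all_wchains_def by (rule continuous_map_from_sum) (simp add: shape_fst continuous_wt)
  then show "continuous_map all_wchains euclideanreal ((\<lambda>b. fst (bdata b) y) \<circ> cls)"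
    by (rule continuous_map_eq) (simp add: bdata_cls)
qed

lemma bdata_chr:
  assumes "e \<in> topspace (star x)"
  shows "bdata (chr x e) = (fst (data x e),
     {f \<in> snd (data x e). src C f \<in> supp (fst (data x e)) \<and> tgt C f \<in> supp (fst (data x e))})"
  using assms by (auto simp: topspace_star chr_point bdata_cls data_point pshape_restrict)

section \<open>Extending chains\<close>

text \<open>For \<open>n = N\<close> there is no room for \<open>f\<close> and the chain is
  unchanged. This case occurs for chains that already end at the target of \<open>f\<close>, where
  \<open>f\<close> is an identity.\<close>

definition ext :: "'m \<Rightarrow> nat \<Rightarrow> nat \<Rightarrow> ('o, 'm) chain \<Rightarrow> ('o, 'm) chain" where
  "ext f n N c = (fst c, \<lambda>i\<in>{..<N}. if i < n then snd c i else if i = n then f else ident C (tgt C f))"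

context
  fixes f n N and c :: "('o, 'm) chain"
  assumes c: "c \<in> topspace (nerve C n)" and f: "f \<in> Mo" "src C f = obj c n" and nN: "n \<le> N"
begin

lemma ext_obj_low: "i \<le> n \<Longrightarrow> obj (ext f n N c) i = obj c i"
  using nN by (cases i) (simp_all add: ext_def)

lemma ext_obj_high: "n < i \<Longrightarrow> i \<le> N \<Longrightarrow> obj (ext f n N c) i = tgt C f"
  using f(1) by (cases i) (simp_all add: ext_def tgt_ident tgt_in)

lemma ext_nerve: "ext f n N c \<in> topspace (nerve C N)"
  unfolding nerve_iff
proof (intro conjI allI impI)
  show "fst (ext f n N c) \<in> Ob" using c by (simp add: ext_def nerve_iff)
  show "snd (ext f n N c) \<in> extensional {..<N}" by (simp add: ext_def)
  fix i assume i: "i < N"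
  show "snd (ext f n N c) i \<in> Mo"
    using i c f by (auto simp: ext_def nerve_iff ident_in tgt_in)
  show "src C (snd (ext f n N c) i) = obj (ext f n N c) i"
  proof (cases "i \<le> n")
    case True
    then show ?thesis using i c f ext_obj_low[OF True] by (auto simp: ext_def nerve_iff)
  next
    case False
    then show ?thesis using i f ext_obj_high[of i] by (simp add: ext_def src_ident tgt_in)
  qed
qed

lemma incl_op: "(\<lambda>i. i) \<in> {..n} \<rightarrow> {..N}" "mono_on {..n} (\<lambda>i. i :: nat)"
  using nN by (auto intro: mono_onI)

lemma nerve_op_ext: "nerve_op C n (\<lambda>i. i) (ext f n N c) = c"
proof (rule prod_eqI)
  show "fst (nerve_op C n (\<lambda>i. i) (ext f n N c)) = fst c" by (simp add: nerve_op_def ext_def)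
  show "snd (nerve_op C n (\<lambda>i. i) (ext f n N c)) = snd c"
  proof (rule extensionalityI[of _ "{..<n}"])
    show "snd (nerve_op C n (\<lambda>i. i) (ext f n N c)) \<in> extensional {..<n}" by (simp add: nerve_op_def)
    show "snd c \<in> extensional {..<n}" using c by (simp add: nerve_iff)
    fix i assume i: "i \<in> {..<n}"
    then show "snd (nerve_op C n (\<lambda>i. i) (ext f n N c)) i = snd c i"
      using nN hop_Suc[OF ext_nerve, of i] by (simp add: nerve_op_mor, simp add: ext_def)
  qed
qed

lemma hop_ext: "i \<le> j \<Longrightarrow> j \<le> n \<Longrightarrow> hop (ext f n N c) i j = hop c i j"
  using nerve_op_hop[OF ext_nerve incl_op] nerve_op_ext by simp

text \<open>The original chain is the front face of the extended one, and the new vertices get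
  weight 0.\<close>

lemma equ_ext:
  assumes "t \<in> standard_simplex n"
  shows "((n, c, t), (N, ext f n N c, t)) \<in> equ"
  using equ_nerve_op[OF ext_nerve incl_op assms] by (simp add: nerve_op_ext simplex_map_id[OF assms])

lemma wt_ext:
  assumes "t \<in> standard_simplex n"
  shows "wt N (ext f n N c) t = wt n c t"
  using equ_invariant[OF equ_ext[OF assms]] by (simp add: shape_def)

lemma hops_ext:
  assumes lt: "n < N"
  shows "hops N (ext f n N c) = hops n c \<union> {cmp C f g | g. g \<in> hops n c \<and> tgt C g = obj c n} \<union> {ident C (tgt C f)}"
proof -
  let ?e = "ext f n N c"
  have over: "hop ?e i (Suc n) = cmp C f (hop c i n)" if "i \<le> n" for i
    using that lt hop_ext[OF that] by (simp add: hop_step ext_def)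
  have "h \<in> hops n c \<union> {cmp C f g | g. g \<in> hops n c \<and> tgt C g = obj c n} \<union> {ident C (tgt C f)}"
    if h: "h \<in> hops N ?e" for h
  proof -
    obtain i j where ij: "i \<le> j" "j \<le> N" "h = hop ?e i j" using h by (auto simp: hops_def)
    consider "j \<le> n" | "i \<le> n" "n < j" | "n < i" by linarith
    then show ?thesis
    proof cases
      case 1
      then show ?thesis using ij hop_ext hopsI by simp
    next
      case 2
      \<comment> \<open>All positions after \<open>n\<close> carry the target of \<open>f\<close>,
        so the end may be moved to the first of them.\<close>
      have "hop ?e i j = hop ?e i (Suc n)"
        using 2 ij lt ext_obj_high[of j] ext_obj_high[of "Suc n"]
        by (intro hop_unique[OF ext_nerve]) (simp_all del: chain_obj_simps)
      then have "h = cmp C f (hop c i n)" using over[OF 2(1)] ij by simp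
      moreover have "hop c i n \<in> hops n c" "tgt C (hop c i n) = obj c n"
        using hopsI[OF 2(1)] hop_Hom[OF c 2(1)] by (simp_all add: Hom_iff)
      ultimately show ?thesis by blast
    next
      case 3
      have "hop ?e i j \<in> Hom C (tgt C f) (tgt C f)"
        using hop_Hom[OF ext_nerve ij(1,2)] ext_obj_high[of i] ext_obj_high[of j] ij 3 by simp
      then have "h = ident C (tgt C f)" using ij by (intro endo_ident) (simp_all add: Hom_iff)
      then show ?thesis by blast
    qed
  qed
  moreover have "h \<in> hops N ?e" if h: "h \<in> hops n c" for h
  proof -
    obtain i j where ij: "i \<le> j" "j \<le> n" "h = hop c i j" using h by (auto simp: hops_def)
    then have "h = hop ?e i j" "j \<le> N" using hop_ext lt by simp_all
    then show ?thesis using ij hopsI by metis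
  qed
  moreover have "cmp C f g \<in> hops N ?e" if g: "g \<in> hops n c" "tgt C g = obj c n" for g
  proof -
    obtain i j where ij: "i \<le> j" "j \<le> n" "g = hop c i j" "tgt C g = obj c j"
      using hopsE[OF c g(1)] by metis
    then have "hop c i j = hop c i n" using g(2) by (intro hop_unique[OF c]) simp_all
    then have "cmp C f g = hop ?e i (Suc n)" using over[of i] ij by simp
    moreover have "hop ?e i (Suc n) \<in> hops N ?e" using ij lt by (intro hopsI) auto
    ultimately show ?thesis by simp
  qed
  moreover have "ident C (tgt C f) \<in> hops N ?e"
    using hopsI[of N N N ?e] ext_obj_high[of N] lt by simp
  ultimately show ?thesis by blast
qed

end

section \<open>The top object of a point\<close>

definition top_of :: "('o \<Rightarrow> real) \<Rightarrow> 'o" where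
  "top_of w = (THE y. y \<in> supp w \<and> (\<forall>z\<in>supp w. (z, y) \<in> leq))"

lemma top_of_eq: "y \<in> supp w \<Longrightarrow> (\<And>z. z \<in> supp w \<Longrightarrow> (z, y) \<in> leq) \<Longrightarrow> top_of w = y"
  unfolding top_of_def using leq_antisym by (intro the_equality) auto

lemma exists_positive:
  assumes "t \<in> standard_simplex k"
  obtains i where "i \<le> k" "0 < t i"
proof -
  have s: "(\<Sum>i\<le>k. t i) = 1" and t0: "\<And>i. 0 \<le> t i" using assms by (auto simp: standard_simplex_def)
  have "\<exists>i\<le>k. t i \<noteq> 0" using s by (metis atMost_iff sum.neutral zero_neq_one)
  then show ?thesis using that t0 by (metis order_le_less)
qed

text \<open>The support is totally ordered by its positions, so its top is the object at the last
  position of positive weight.\<close>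

lemma top_of_wt:
  assumes c: "c \<in> topspace (nerve C k)" and t: "t \<in> standard_simplex k"
  obtains j where "j \<le> k" "0 < t j" "\<And>i. i \<le> k \<Longrightarrow> 0 < t i \<Longrightarrow> i \<le> j" "top_of (wt k c t) = obj c j"
proof -
  let ?J = "{i. i \<le> k \<and> 0 < t i}"
  have J: "finite ?J" "?J \<noteq> {}" using exists_positive[OF t] by auto
  let ?j = "Max ?J"
  have j: "?j \<le> k" "0 < t ?j" using Max_in[OF J] by auto
  have max: "i \<le> ?j" if "i \<le> k" "0 < t i" for i using Max_ge[OF J(1)] that by simp
  have "top_of (wt k c t) = obj c ?j"
  proof (rule top_of_eq)
    show "obj c ?j \<in> supp (wt k c t)" unfolding supp_wt[OF t] using j by blast
    fix z assume "z \<in> supp (wt k c t)"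
    then obtain i where "i \<le> k" "0 < t i" "z = obj c i" unfolding supp_wt[OF t] by blast
    then show "(z, obj c ?j) \<in> leq" using chain_leq[OF c max j(1)] by simp
  qed
  then show ?thesis using that j max by blast
qed

definition top_obj :: "('o, 'm) bpoint \<Rightarrow> 'o" where
  "top_obj b = top_of (fst (bdata b))"

lemma top_obj_props:
  assumes b: "b \<in> topspace (classifying_space C)"
  shows "top_obj b \<in> Ob" "top_obj b \<in> supp (fst (bdata b))"
    "z \<in> supp (fst (bdata b)) \<Longrightarrow> (z, top_obj b) \<in> leq"
proof -
  obtain k c t where k: "c \<in> topspace (nerve C k)" "t \<in> standard_simplex k" "b = cls (k, c, t)"
    using b unfolding topspace_classifying_space by auto
  obtain j where j: "j \<le> k" "0 < t j" "\<And>i. i \<le> k \<Longrightarrow> 0 < t i \<Longrightarrow> i \<le> j" "top_of (wt k c t) = obj c j"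
    using top_of_wt[OF k(1,2)] by blast
  have bd: "fst (bdata b) = wt k c t" by (simp add: k(3) bdata_cls shape_def)
  have top: "top_obj b = obj c j" by (simp add: top_obj_def bd j(4))
  show "top_obj b \<in> Ob" using top chain_obj_in[OF k(1) j(1)] by simp
  show "top_obj b \<in> supp (fst (bdata b))" unfolding bd supp_wt[OF k(2)] top using j by blast
  show "(z, top_obj b) \<in> leq" if "z \<in> supp (fst (bdata b))"
  proof -
    obtain i where "i \<le> k" "0 < t i" "z = obj c i" using \<open>z \<in> supp (fst (bdata b))\<close> unfolding bd supp_wt[OF k(2)] by blast
    then show ?thesis unfolding top using chain_leq[OF k(1) j(3) j(1)] by simp
  qed
qed

lemma chr_in: "e \<in> topspace (star x) \<Longrightarrow> chr x e \<in> topspace (classifying_space C)"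
  using funcset_mem[OF continuous_map_funspace[OF continuous_chr]] .

text \<open>In a nondegenerate representative the last object is the top object. Appending a
  morphism from it to \<open>x\<close>, with no weight on the new vertices, gives a preimage in the
  star.\<close>

lemma chr_surj:
  assumes b: "b \<in> topspace (classifying_space C)" and x: "(top_obj b, x) \<in> leq"
  obtains e where "e \<in> topspace (star x)" "chr x e = b"
proof -
  obtain k c t where k: "c \<in> topspace (nerve C k)" "t \<in> standard_simplex k" "b = cls (k, c, t)"
    using b unfolding topspace_classifying_space by auto
  obtain n d s where d: "d \<in> topspace (nerve C n)" "s \<in> standard_simplex n" "\<And>i. i \<le> n \<Longrightarrow> 0 < s i"
    "inj_on (obj d) {..n}" "((k, c, t), (n, d, s)) \<in> equ"
    by (rule nondegenerate_rep[OF k(1,2)]) blast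
  have b: "b = cls (n, d, s)" using d(5) k(3) cls_eq by simp
  obtain j where j: "j \<le> n" "0 < s j" "\<And>i. i \<le> n \<Longrightarrow> 0 < s i \<Longrightarrow> i \<le> j" "top_of (wt n d s) = obj d j"
    using top_of_wt[OF d(1,2)] by blast
  have "j = n" using j(3)[of n] d(3)[of n] j(1) by simp
  then have top: "top_obj b = obj d n" using j(4) by (simp add: top_obj_def b bdata_cls shape_def)
  obtain f where "f \<in> Hom C (obj d n) x" using x unfolding leq_iff top by blast
  then have f: "f \<in> Mo" "src C f = obj d n" "tgt C f = x" by (simp_all add: Hom_iff)
  have fin: "finite (strictly_below C x)" using finite_below f tgt_in by blast
  have low: "(obj d i, x) \<in> leq" if "i \<le> n" for i
    using chain_leq[OF d(1) that] leq_trans x top by simp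
  have below: "obj d i \<in> strictly_below C x" if "i \<le> n" "obj d n \<noteq> x \<or> i < n" for i
    unfolding strictly_below_iff
  proof (intro conjI notI)
    show "(obj d i, x) \<in> leq" using low that by simp
    assume ix: "obj d i = x"
    then have "(x, obj d n) \<in> leq" using chain_leq[OF d(1) that(1)] by simp
    then have "obj d n = x" using x top leq_antisym by simp
    then have "i = n" using d(4) ix that by (auto dest: inj_onD)
    then show False using that \<open>obj d n = x\<close> by simp
  qed
  \<comment> \<open>The objects are distinct and, apart from a last object equal to
    \<open>x\<close>, strictly below \<open>x\<close>. So either the chain ends at \<open>x\<close>
    and has length at most \<open>height x\<close>, or there is still room for the appended
    morphism.\<close>
  have le: "n \<le> height x \<and> (n < height x \<or> obj d n = x)"
  proof (cases "obj d n = x")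
    case True
    have "card (obj d ` {..<n}) \<le> height x"
      unfolding height_def using below by (intro card_mono fin) auto
    moreover have "inj_on (obj d) {..<n}" using d(4) by (rule inj_on_subset) auto
    ultimately show ?thesis using True by (simp add: card_image)
  next
    case False
    have "card (obj d ` {..n}) \<le> height x"
      unfolding height_def using below False by (intro card_mono fin) auto
    then show ?thesis using d(4) by (simp add: card_image)
  qed
  then have nN: "n \<le> height x" by simp
  let ?e = "ext f n (height x) d"
  have end_x: "obj ?e (height x) = x"
    using le ext_obj_high[OF d(1) f(1,2) nN, of "height x"] ext_obj_low[OF d(1) f(1,2) nN, of n] f(3) nN
    by (cases "n = height x") auto
  have p: "(?e, s) \<in> topspace (padded x)"
    using ext_nerve[OF d(1) f(1,2) nN] standard_simplex_mono[OF nN] d(2) end_x by auto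
  have "chr x (point x (pshape x (?e, s))) = b"
    unfolding chr_point[OF p] b using equ_ext[OF d(1) f(1,2) nN d(2)] equ_sym cls_eq by metis
  then show ?thesis using that point_in_star[OF p] by blast
qed

lemma data_chr: "e \<in> topspace (star x) \<Longrightarrow> fst (bdata (chr x e)) = fst (data x e)"
  by (simp add: bdata_chr)

lemma star_rep:
  assumes e: "e \<in> topspace (star x)"
  obtains c t where "(c, t) \<in> topspace (padded x)" "e = point x (pshape x (c, t))"
    "c \<in> topspace (nerve C (height x))" "t \<in> standard_simplex (height x)" "obj c (height x) = x"
    "data x e = pshape x (c, t)" "fst (data x e) = wt (height x) c t"
    "\<And>f. f \<in> snd (data x e) \<longleftrightarrow> f \<in> hops (height x) c \<and>
       src C f \<in> insert x (supp (wt (height x) c t)) \<and> tgt C f \<in> insert x (supp (wt (height x) c t))"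
proof -
  obtain c t where p: "(c, t) \<in> topspace (padded x)" "e = point x (pshape x (c, t))"
    using starE[OF e] .
  have d: "data x e = pshape x (c, t)" unfolding p(2) by (rule data_point[OF p(1)])
  show thesis
    by (rule that[OF p]) (use p(1) in \<open>simp_all add: d, simp_all add: pshape_def shape_def\<close>)
qed

lemma data_leq:
  assumes e: "e \<in> topspace (star x)" and z: "z \<in> supp (fst (data x e))"
  shows "(z, x) \<in> leq"
proof -
  obtain c t where p: "c \<in> topspace (nerve C (height x))" "t \<in> standard_simplex (height x)"
    "obj c (height x) = x" "fst (data x e) = wt (height x) c t"
    using star_rep[OF e] by metis
  obtain i where "i \<le> height x" "z = obj c i"
    using z unfolding p(4) supp_wt[OF p(2)] by blast
  then show ?thesis using chain_leq[OF p(1), of i "height x"] p(3) by simp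
qed

lemma top_obj_chr:
  assumes e: "e \<in> topspace (star x)"
  shows "(top_obj (chr x e), x) \<in> leq" "0 < fst (data x e) x \<longleftrightarrow> top_obj (chr x e) = x"
proof -
  have b: "chr x e \<in> topspace (classifying_space C)" by (rule chr_in[OF e])
  have t: "top_obj (chr x e) \<in> supp (fst (data x e))" using top_obj_props(2)[OF b] data_chr[OF e] by simp
  then show leq: "(top_obj (chr x e), x) \<in> leq" by (rule data_leq[OF e])
  show "0 < fst (data x e) x \<longleftrightarrow> top_obj (chr x e) = x"
  proof
    assume "0 < fst (data x e) x"
    then have "(x, top_obj (chr x e)) \<in> leq"
      using top_obj_props(3)[OF b] data_chr[OF e] by (simp add: supp_def)
    then show "top_obj (chr x e) = x" using leq leq_antisym by blast
  qed (use t in \<open>simp add: supp_def\<close>)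
qed

lemma data_nonneg: "e \<in> topspace (star x) \<Longrightarrow> 0 \<le> fst (data x e) y"
  by (erule star_rep) (simp only: wt_nonneg)

lemma data_mor:
  assumes e: "e \<in> topspace (star x)" and g: "g \<in> snd (data x e)"
  shows "g \<in> Mo" "src C g \<in> insert x (supp (fst (data x e)))" "tgt C g \<in> insert x (supp (fst (data x e)))"
proof -
  obtain c t where p: "c \<in> topspace (nerve C (height x))" "fst (data x e) = wt (height x) c t"
    "\<And>f. f \<in> snd (data x e) \<longleftrightarrow> f \<in> hops (height x) c \<and>
       src C f \<in> insert x (supp (wt (height x) c t)) \<and> tgt C f \<in> insert x (supp (wt (height x) c t))"
    by (rule star_rep[OF e]) blast
  have "g \<in> hops (height x) c" using g unfolding p(3) by blast
  then show "g \<in> Mo" by (rule hopsE[OF p(1)])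
  show "src C g \<in> insert x (supp (fst (data x e)))" "tgt C g \<in> insert x (supp (fst (data x e)))"
    using g unfolding p(2,3) by blast+
qed

lemma data_functional:
  assumes e: "e \<in> topspace (star x)"
  shows "functional (snd (data x e))"
proof (rule star_rep[OF e])
  fix c t assume "data x e = pshape x (c, t)" "c \<in> topspace (nerve C (height x))" "t \<in> standard_simplex (height x)"
  then show ?thesis using functional_shape[of "(c, t)" "height x"] by (simp add: pshape_def)
qed

lemma data_ident:
  assumes e: "e \<in> topspace (star x)"
  shows "ident C x \<in> snd (data x e)"
proof -
  obtain c t where p: "c \<in> topspace (nerve C (height x))" "obj c (height x) = x"
    "\<And>f. f \<in> snd (data x e) \<longleftrightarrow> f \<in> hops (height x) c \<and>
       src C f \<in> insert x (supp (wt (height x) c t)) \<and> tgt C f \<in> insert x (supp (wt (height x) c t))"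
    by (rule star_rep[OF e]) blast
  have "x \<in> Ob" using chain_obj_in[OF p(1) order_refl] p(2) by simp
  moreover have "ident C x \<in> hops (height x) c" using hopsI[of "height x" "height x" "height x" c] p(2) by simp
  ultimately show ?thesis unfolding p(3) by (simp add: src_ident tgt_ident)
qed

section \<open>A star is the cone over its link\<close>

definition link :: "'o \<Rightarrow> ('o, 'm) bpoint topology" where
  "link x = subtopology (star x) {e. fst (data x e) x = 0}"

lemma link_iff: "e \<in> topspace (link x) \<longleftrightarrow> e \<in> topspace (star x) \<and> fst (data x e) x = 0"
  by (auto simp: link_def)

definition cone_data :: "'o \<Rightarrow> ('o, 'm) bpoint cone_point \<Rightarrow> ('o \<Rightarrow> real) \<times> 'm set" where
  "cone_data x d = (case d of Tip \<Rightarrow> (\<lambda>y. if y = x then 1 else 0, {ident C x})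
     | Ray s e \<Rightarrow> (\<lambda>y. s * fst (data x e) y + (if y = x then 1 - s else 0), snd (data x e)))"

definition join :: "'o \<Rightarrow> ('o, 'm) bpoint cone_point \<Rightarrow> ('o, 'm) bpoint" where
  "join x d = point x (cone_data x d)"

text \<open>The point at parameter \<open>s\<close> on the segment from vertex \<open>n\<close> to
  \<open>t\<close>, in simplex coordinates.\<close>

definition mix :: "real \<Rightarrow> nat \<Rightarrow> (nat \<Rightarrow> real) \<Rightarrow> nat \<Rightarrow> real" where
  "mix s n t = (\<lambda>i. s * t i + (if i = n then 1 - s else 0))"

lemma mix_in:
  assumes "t \<in> standard_simplex n" "0 \<le> s" "s \<le> 1"
  shows "mix s n t \<in> standard_simplex n"
proof -
  have "(\<lambda>i. (1 - s) * (if i = n then 1 else 0) + s * t i) \<in> standard_simplex n"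
    using assms by (intro convex_standard_simplex) auto
  moreover have "(\<lambda>i. (1 - s) * (if i = n then 1 else 0) + s * t i) = mix s n t"
    by (auto simp: mix_def)
  ultimately show ?thesis by simp
qed

lemma wt_mix:
  assumes "obj c n = x"
  shows "wt n c (mix s n t) y = s * wt n c t y + (if y = x then 1 - s else 0)"
proof -
  have "wt n c (mix s n t) y = (\<Sum>i | i \<le> n \<and> obj c i = y. s * t i) +
      (\<Sum>i | i \<le> n \<and> obj c i = y. if i = n then 1 - s else 0)"
    by (simp add: wt_def mix_def sum.distrib)
  moreover have "(\<Sum>i | i \<le> n \<and> obj c i = y. if i = n then 1 - s else 0) = (if y = x then 1 - s else 0)"
    using assms by (subst sum.delta) auto
  ultimately show ?thesis by (simp add: wt_def sum_distrib_left)
qed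

lemma pshape_vertex:
  assumes p: "(c, t) \<in> topspace (padded x)" and w: "wt (height x) c t = (\<lambda>y. if y = x then 1 else 0)"
  shows "pshape x (c, t) = (\<lambda>y. if y = x then 1 else 0, {ident C x})"
proof -
  have c: "c \<in> topspace (nerve C (height x))" "obj c (height x) = x" using p by simp_all
  have "x \<in> Ob" using chain_obj_in[OF c(1) order_refl] c(2) by simp
  moreover have "supp (\<lambda>y. if y = x then 1 else 0) = {x}" by (auto simp: supp_def)
  moreover have "{f \<in> hops (height x) c. src C f = x \<and> tgt C f = x} = {ident C x}"
  proof (intro equalityI subsetI)
    fix f assume f: "f \<in> {f \<in> hops (height x) c. src C f = x \<and> tgt C f = x}"
    then have "f \<in> Mo" using hopsE[OF c(1)] by blast
    then show "f \<in> {ident C x}" using f endo_ident by simp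
  next
    fix f assume "f \<in> {ident C x}"
    then show "f \<in> {f \<in> hops (height x) c. src C f = x \<and> tgt C f = x}"
      using hopsI[of "height x" "height x" "height x" c] c(2) \<open>x \<in> Ob\<close> by (simp add: src_ident tgt_ident)
  qed
  ultimately show ?thesis unfolding pshape_def shape_def by (simp add: w)
qed

lemma vertex_padded:
  assumes x: "x \<in> Ob"
  obtains c t where "(c, t) \<in> topspace (padded x)" "wt (height x) c t = (\<lambda>y. if y = x then 1 else 0)"
proof -
  define c0 :: "('o, 'm) chain" where "c0 = (x, \<lambda>_. undefined)"
  define t :: "nat \<Rightarrow> real" where "t = (\<lambda>j. if j = 0 then 1 else 0)"
  have c0: "c0 \<in> topspace (nerve C 0)" using x by (simp add: nerve_iff c0_def)
  have f: "ident C x \<in> Mo" "src C (ident C x) = obj c0 0" "tgt C (ident C x) = x"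
    using x by (simp_all add: ident_in src_ident tgt_ident c0_def)
  note e = c0 f(1,2) le0[of "height x"]
  have t0: "t \<in> standard_simplex 0" by (simp add: standard_simplex_0 t_def)
  let ?c = "ext (ident C x) 0 (height x) c0"
  have "obj ?c (height x) = x"
    using ext_obj_low[OF e, of 0] ext_obj_high[OF e, of "height x"] f(3)
    by (cases "height x = 0") (auto simp: c0_def)
  then have "(?c, t) \<in> topspace (padded x)"
    using ext_nerve[OF e] standard_simplex_mono[of 0 "height x"] t0 by auto
  moreover have "wt (height x) ?c t = (\<lambda>y. if y = x then 1 else 0)"
  proof
    fix y
    have "{i. i \<le> 0 \<and> obj c0 i = y} = (if y = x then {0} else {})" by (auto simp: c0_def)
    then show "wt (height x) ?c t y = (if y = x then 1 else 0)"
      unfolding wt_ext[OF e t0] wt_def by (simp add: t_def)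
  qed
  ultimately show ?thesis using that by blast
qed

text \<open>Since \<open>x\<close> is marked at any weight, shifting weight to it leaves the marked
  objects, and hence the morphisms, unchanged as long as \<open>s\<close> is positive. At
  \<open>s = 0\<close> only \<open>x\<close> is left, and all rays meet in the vertex.\<close>

lemma join_cone_pt:
  assumes p: "(c, t) \<in> topspace (padded x)" and z: "wt (height x) c t x = 0" and s: "0 \<le> s" "s \<le> 1"
  shows "(c, mix s (height x) t) \<in> topspace (padded x)"
    "cone_data x (cone_pt s (point x (pshape x (c, t)))) = pshape x (c, mix s (height x) t)"
proof -
  have c: "c \<in> topspace (nerve C (height x))" "obj c (height x) = x" and t: "t \<in> standard_simplex (height x)"
    using p by simp_all
  show p': "(c, mix s (height x) t) \<in> topspace (padded x)"
    using p mix_in[OF t s] by simp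
  have w: "wt (height x) c (mix s (height x) t) = (\<lambda>y. s * wt (height x) c t y + (if y = x then 1 - s else 0))"
    using wt_mix[OF c(2)] by blast
  show "cone_data x (cone_pt s (point x (pshape x (c, t)))) = pshape x (c, mix s (height x) t)"
  proof (cases "s = 0")
    case True
    have "wt (height x) c (mix s (height x) t) = (\<lambda>y. if y = x then 1 else 0)" unfolding w by (auto simp: True)
    from pshape_vertex[OF p' this] show ?thesis by (simp add: True cone_data_def cone_pt_def)
  next
    case False
    have "0 < s * wt (height x) c t y \<longleftrightarrow> 0 < wt (height x) c t y" for y
      using False s(1) by (simp add: zero_less_mult_iff)
    then have "{x} \<union> supp (\<lambda>y. s * wt (height x) c t y + (if y = x then 1 - s else 0)) = {x} \<union> supp (wt (height x) c t)"
      by (auto simp: supp_def)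
    then have "pshape x (c, mix s (height x) t) =
        (\<lambda>y. s * wt (height x) c t y + (if y = x then 1 - s else 0), snd (pshape x (c, t)))"
      by (simp only: pshape_def shape_def prod.case w snd_conv)
    then show ?thesis
      using False by (simp add: cone_data_def cone_pt_def data_point[OF p]) (simp add: pshape_def shape_def)
  qed
qed

lemma cone_data_rep:
  assumes x: "x \<in> Ob" and d: "d \<in> topspace (cone_topology (link x))"
  obtains p where "p \<in> topspace (padded x)" "cone_data x d = pshape x p"
  using d
proof (cases rule: cone_point_cases)
  case 1
  obtain c t where "(c, t) \<in> topspace (padded x)" "wt (height x) c t = (\<lambda>y. if y = x then 1 else 0)"
    using vertex_padded[OF x] .
  then show ?thesis using that[of "(c, t)"] pshape_vertex 1 by (simp add: cone_data_def)
next
  case (2 s e)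
  then obtain c t where p: "(c, t) \<in> topspace (padded x)" "e = point x (pshape x (c, t))" "fst (data x e) = wt (height x) c t"
    using star_rep[of e x] unfolding link_iff by metis
  have z: "wt (height x) c t x = 0" using 2(3) p(3) unfolding link_iff by simp
  have s: "0 \<le> s" "s \<le> 1" using 2 by simp_all
  show ?thesis
    using that[OF join_cone_pt(1)[OF p(1) z s]] join_cone_pt(2)[OF p(1) z s] unfolding 2(5) p(2) by blast
qed

lemma join_in_star: "x \<in> Ob \<Longrightarrow> d \<in> topspace (cone_topology (link x)) \<Longrightarrow> join x d \<in> topspace (star x)"
  by (erule (1) cone_data_rep) (simp add: join_def point_in_star)

lemma data_join: "x \<in> Ob \<Longrightarrow> d \<in> topspace (cone_topology (link x)) \<Longrightarrow> data x (join x d) = cone_data x d"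
  by (erule (1) cone_data_rep) (simp add: join_def data_point)

lemma closedin_link: "closedin (star x) (topspace (link x))"
proof -
  have "closedin (star x) {e \<in> topspace (star x). fst (data x e) x \<in> {0}}"
    using continuous_data by (rule closedin_continuous_map_preimage) simp
  moreover have "topspace (link x) = {e \<in> topspace (star x). fst (data x e) x \<in> {0}}"
    by (auto simp: link_iff)
  ultimately show ?thesis by simp
qed

lemma link_eq: "link x = subtopology (star x) (topspace (link x))"
  unfolding link_def topspace_subtopology subtopology_restrict ..

lemma compact_space_link: "x \<in> Ob \<Longrightarrow> compact_space (link x)"
  using closedin_compact_space[OF compact_space_star closedin_link] compact_space_subtopology link_eq by metis

lemma Hausdorff_link: "Hausdorff_space (link x)"
  unfolding link_def by (intro Hausdorff_space_subtopology Hausdorff_star)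

text \<open>On representatives the join is the continuous map \<open>mix\<close>. To descend, the
  product of the interval with the quotient map onto the link has to be a quotient map; it is one
  because \<open>K\<close> is compact and the link is Hausdorff.\<close>

lemma continuous_join:
  assumes x: "x \<in> Ob"
  shows "continuous_map (cone_topology (link x)) (star x) (join x)"
proof (rule continuous_map_from_cone)
  show "join x Tip \<in> topspace (star x)" by (intro join_in_star x cone_pt_in_cone)
  let ?N = "height x" and ?I = "top_of_set {0..1::real}"
  let ?Z = "{p. wt ?N (fst p) (snd p) x = 0}"
  define K where "K = subtopology (padded x) ?Z"
  let ?q = "\<lambda>p. point x (pshape x p)"
  have "continuous_map (padded x) euclideanreal (\<lambda>p. wt ?N (fst p) (snd p) x)"
    unfolding padded_def by (intro continuous_map_from_subtopology continuous_wt)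
  then have "closedin (padded x) {p \<in> topspace (padded x). wt ?N (fst p) (snd p) x \<in> {0}}"
    by (rule closedin_continuous_map_preimage) simp
  then have "compactin (padded x) {p \<in> topspace (padded x). wt ?N (fst p) (snd p) x \<in> {0}}"
    by (rule closedin_compact_space[OF compact_space_padded[OF x]])
  moreover have "K = subtopology (padded x) {p \<in> topspace (padded x). wt ?N (fst p) (snd p) x \<in> {0}}"
    unfolding K_def by (subst subtopology_restrict[symmetric]) (simp add: Collect_conj_eq)
  ultimately have K: "compact_space K" by (simp add: compact_space_subtopology)
  have Kp: "p \<in> topspace (padded x)" "wt ?N (fst p) (snd p) x = 0" if "p \<in> topspace K" for p
    using that unfolding K_def by auto
  have w: "fst (data x (?q p)) = wt ?N (fst p) (snd p)" if "p \<in> topspace (padded x)" for p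
    using data_point[OF that] by (simp add: pshape_def shape_fst)
  have q_img: "?q ` topspace K = topspace (link x)"
  proof (intro equalityI subsetI)
    fix e assume "e \<in> ?q ` topspace K"
    then obtain p where "p \<in> topspace K" "e = ?q p" by blast
    then show "e \<in> topspace (link x)" using Kp w point_in_star by (simp add: link_iff)
  next
    fix e assume e: "e \<in> topspace (link x)"
    then obtain p where p: "p \<in> topspace (padded x)" "e = ?q p" unfolding link_iff topspace_star by blast
    then have "p \<in> topspace K" using e w unfolding K_def link_iff by simp
    then show "e \<in> ?q ` topspace K" using p by blast
  qed
  have q_cont: "continuous_map K (link x) ?q"
  proof (subst link_eq, unfold continuous_map_in_subtopology, intro conjI)
    show "continuous_map K (star x) ?q"
      unfolding K_def by (rule continuous_map_from_subtopology[OF continuous_map_star])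
    show "?q \<in> topspace K \<rightarrow> topspace (link x)" using q_img by blast
  qed
  have "quotient_map (prod_topology ?I K) (prod_topology ?I (link x)) (\<lambda>(s, p). (s, ?q p))"
  proof (rule T1_Spaces.continuous_imp_quotient_map)
    show "continuous_map (prod_topology ?I K) (prod_topology ?I (link x)) (\<lambda>(s, p). (s, ?q p))"
      unfolding case_prod_unfold continuous_map_paired
      using continuous_map_fst continuous_map_compose[OF continuous_map_snd q_cont] by (auto simp: o_def)
    show "compact_space (prod_topology ?I K)"
      using K by (simp add: compact_space_prod_topology compact_space_subtopology)
    show "Hausdorff_space (prod_topology ?I (link x))"
      using Hausdorff_link by (simp add: Hausdorff_space_prod_topology Hausdorff_space_subtopology)
    show "(\<lambda>(s, p). (s, ?q p)) ` topspace (prod_topology ?I K) = topspace (prod_topology ?I (link x))"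
      unfolding topspace_prod_topology q_img[symmetric] by (rule image_Times_snd)
  qed
  then show "continuous_map (prod_topology ?I (link x)) (star x) (\<lambda>(s, e). join x (cone_pt s e))"
  proof (rule continuous_compose_quotient_map)
    have 1: "continuous_map (prod_topology ?I K) euclideanreal fst"
      using continuous_map_fst by (rule continuous_map_into_fulltopology)
    have 2: "continuous_map (prod_topology ?I K) (wchains ?N) snd"
      using continuous_map_snd[of ?I K] unfolding K_def padded_def by (meson continuous_map_in_subtopology)
    have 3: "continuous_map (prod_topology ?I K) (nerve C ?N) (\<lambda>a. fst (snd a))"
      using continuous_map_compose[OF 2 continuous_map_fst] by (simp add: o_def)
    have 4: "continuous_map (prod_topology ?I K) euclideanreal (\<lambda>a. snd (snd a) i)" for i
      using continuous_map_compose[OF 2 continuous_weight] by (simp add: o_def)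
    have mem: "(fst (snd a), mix (fst a) ?N (snd (snd a))) \<in> topspace (padded x) \<and>
        join x (cone_pt (fst a) (?q (snd a))) = ?q (fst (snd a), mix (fst a) ?N (snd (snd a)))"
      if "a \<in> topspace (prod_topology ?I K)" for a
    proof -
      have "snd a \<in> topspace K" "0 \<le> fst a" "fst a \<le> 1" using that by auto
      then show ?thesis
        using join_cone_pt[of "fst (snd a)" "snd (snd a)" x "fst a"] Kp[of "snd a"] by (simp add: join_def)
    qed
    have "continuous_map (prod_topology ?I K) (powertop_real UNIV) (\<lambda>a. mix (fst a) ?N (snd (snd a)))"
      unfolding continuous_map_componentwise_UNIV mix_def
      using 1 4 by (auto intro!: continuous_map_add continuous_map_real_mult continuous_map_diff)
    then have "continuous_map (prod_topology ?I K) (wchains ?N) (\<lambda>a. (fst (snd a), mix (fst a) ?N (snd (snd a))))"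
      using 3 mem by (auto simp: continuous_map_paired continuous_map_in_subtopology)
    then have "continuous_map (prod_topology ?I K) (padded x) (\<lambda>a. (fst (snd a), mix (fst a) ?N (snd (snd a))))"
      unfolding padded_def continuous_map_in_subtopology using mem by auto
    from continuous_map_compose[OF this continuous_map_star]
    show "continuous_map (prod_topology ?I K) (star x) ((\<lambda>(s, e). join x (cone_pt s e)) \<circ> (\<lambda>(s, p). (s, ?q p)))"
      by (rule continuous_map_eq) (use mem in \<open>simp add: case_prod_unfold\<close>)
  qed
qed

text \<open>The weight of \<open>x\<close> is \<open>1 - s\<close>, since it vanishes on the link.
  Dividing the other weights by \<open>s\<close> recovers the point of the link.\<close>

lemma inj_join:
  assumes x: "x \<in> Ob"
  shows "inj_on (join x) (topspace (cone_topology (link x)))"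
proof (rule inj_onI)
  fix d d' assume d: "d \<in> topspace (cone_topology (link x))" and d': "d' \<in> topspace (cone_topology (link x))"
    and "join x d = join x d'"
  then have eq: "cone_data x d = cone_data x d'" using data_join[OF x] by metis
  have a: "fst (cone_data x d) x = (case d of Tip \<Rightarrow> 1 | Ray s e \<Rightarrow> 1 - s)" if "d \<in> topspace (cone_topology (link x))" for d
    using that by (cases rule: cone_point_cases) (auto simp: cone_data_def link_iff)
  show "d = d'"
    using d
  proof (cases rule: cone_point_cases)
    case 1
    show ?thesis using d' by (cases rule: cone_point_cases) (use 1 eq a[OF d] a[OF d'] in auto)
  next
    case (2 s e)
    show ?thesis using d'
    proof (cases rule: cone_point_cases)
      case 1
      then show ?thesis using 2 eq a[OF d] a[OF d'] by simp
    next
      case (2 s' e')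
      have s: "s' = s" using a[OF d] a[OF d'] eq \<open>d = Ray s e\<close> 2 by simp
      have "snd (data x e) = snd (data x e')" using eq \<open>d = Ray s e\<close> 2 by (simp add: cone_data_def)
      moreover have "fst (data x e) y = fst (data x e') y" for y
      proof (cases "y = x")
        case True
        then show ?thesis using \<open>e \<in> topspace (link x)\<close> 2 by (simp add: link_iff)
      next
        case False
        have "fst (cone_data x d) y = fst (cone_data x d') y" using eq by simp
        then show ?thesis using False s \<open>d = Ray s e\<close> \<open>0 < s\<close> 2 by (simp add: cone_data_def)
      qed
      ultimately have "data x e = data x e'" by (simp add: prod_eq_iff fun_eq_iff)
      then have "e = e'" using point_data \<open>e \<in> topspace (link x)\<close> 2 unfolding link_iff by metis
      then show ?thesis using s \<open>d = Ray s e\<close> 2 by simp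
    qed
  qed
qed

lemma join_surj:
  assumes x: "x \<in> Ob" and e: "e \<in> topspace (star x)"
  obtains d where "d \<in> topspace (cone_topology (link x))" "join x d = e"
proof -
  let ?N = "height x"
  obtain c t where p: "(c, t) \<in> topspace (padded x)" "e = point x (pshape x (c, t))"
    using starE[OF e] .
  have c: "c \<in> topspace (nerve C ?N)" "obj c ?N = x" and t: "t \<in> standard_simplex ?N"
    using p by simp_all
  have t0: "\<And>i. 0 \<le> t i" and tz: "\<And>i. i > ?N \<Longrightarrow> t i = 0" and t1: "(\<Sum>i\<le>?N. t i) = 1"
    using t by (auto simp: standard_simplex_def)
  \<comment> \<open>The total weight away from \<open>x\<close> becomes the cone parameter, and
    dividing by it in \<open>u\<close> gives the point of the link. If it is 0, the point is the
    vertex.\<close>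
  define s where "s = (\<Sum>i | i \<le> ?N \<and> obj c i \<noteq> x. t i)"
  have s0: "0 \<le> s" unfolding s_def using t0 by (intro sum_nonneg) auto
  have "{..?N} = {i. i \<le> ?N \<and> obj c i = x} \<union> {i. i \<le> ?N \<and> obj c i \<noteq> x}" by auto
  then have "(\<Sum>i\<le>?N. t i) = wt ?N c t x + s"
    unfolding wt_def s_def by (simp only:) (rule sum.union_disjoint, auto)
  then have wx: "wt ?N c t x = 1 - s" using t1 by simp
  have ts: "t i \<le> s" if "i \<le> ?N" "obj c i \<noteq> x" for i
    unfolding s_def using that t0 by (intro member_le_sum) auto
  show ?thesis
  proof (cases "s = 0")
    case True
    have "wt ?N c t y = 0" if "y \<noteq> x" for y
      unfolding wt_def using that ts t0 True by (intro sum.neutral) (auto intro: antisym)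
    then have "wt ?N c t = (\<lambda>y. if y = x then 1 else 0)" using wx True by auto
    then have "join x Tip = e" using pshape_vertex[OF p(1)] p(2) by (simp add: join_def cone_data_def)
    then show ?thesis using that cone_pt_in_cone(2) by blast
  next
    case False
    then have sp: "0 < s" using s0 by simp
    have s1: "s \<le> 1" using wx wt_nonneg[OF t, of c x] by simp
    define u where "u i = (if obj c i = x then 0 else t i / s)" for i
    have "(\<Sum>i\<le>?N. u i) = (\<Sum>i | i \<le> ?N \<and> obj c i \<noteq> x. t i / s)"
      unfolding u_def by (rule sum.mono_neutral_cong_right) auto
    also have "\<dots> = 1" using False by (simp add: s_def flip: sum_divide_distrib)
    finally have "(\<Sum>i\<le>?N. u i) = 1" .
    moreover have "0 \<le> u i \<and> u i \<le> 1" for i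
      using t0[of i] ts[of i] tz[of i] sp by (cases "i \<le> ?N") (auto simp: u_def)
    ultimately have u: "u \<in> standard_simplex ?N" using tz by (simp add: standard_simplex_def u_def)
    have pu: "(c, u) \<in> topspace (padded x)" using p u by simp
    have wu: "wt ?N c u y = (if y = x then 0 else wt ?N c t y / s)" for y
    proof (cases "y = x")
      case True
      then show ?thesis unfolding wt_def u_def by (simp add: sum.neutral)
    next
      case False
      then have "wt ?N c u y = (\<Sum>i | i \<le> ?N \<and> obj c i = y. t i / s)"
        unfolding wt_def u_def by (intro sum.cong) auto
      then show ?thesis using False by (simp add: wt_def sum_divide_distrib)
    qed
    have "wt ?N c (mix s ?N u) y = wt ?N c t y" for y
      unfolding wt_mix[OF c(2)] wu using wx False by simp
    then have "wt ?N c (mix s ?N u) = wt ?N c t" by blast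
    then have "pshape x (c, mix s ?N u) = pshape x (c, t)" by (simp add: pshape_def shape_def)
    moreover have "wt ?N c u x = 0" using wu[of x] by simp
    ultimately have e: "join x (cone_pt s (point x (pshape x (c, u)))) = e"
      using join_cone_pt(2)[OF pu _ s0 s1] p(2) unfolding join_def by metis
    have "fst (data x (point x (pshape x (c, u)))) x = 0"
      unfolding data_point[OF pu] using wu[of x] by (simp add: pshape_def shape_def)
    then have "point x (pshape x (c, u)) \<in> topspace (link x)"
      using point_in_star[OF pu] by (simp only: link_iff)
    then show ?thesis using that[OF cone_pt_in_cone(1)[OF s0 s1] e] by blast
  qed
qed

lemma homeomorphic_join:
  assumes x: "x \<in> Ob"
  shows "homeomorphic_map (cone_topology (link x)) (star x) (join x)"
proof (rule T1_Spaces.continuous_imp_homeomorphic_map)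
  show "join x ` topspace (cone_topology (link x)) = topspace (star x)"
    using join_surj[OF x] join_in_star[OF x] by blast
qed (use x continuous_join compact_space_cone compact_space_link Hausdorff_star inj_join in auto)

section \<open>Attaching a star to the link of a larger object\<close>

text \<open>This leaves room for a morphism from \<open>m\<close> to \<open>l\<close> after a padded
  chain that ends at \<open>m\<close>.\<close>

lemma height_less:
  assumes "(m, l) \<in> leq" "m \<noteq> l"
  shows "height m < height l"
  unfolding height_def
proof (rule psubset_card_mono)
  show "finite (strictly_below C l)" using finite_below leq_in[OF assms(1)] by blast
  have "strictly_below C m \<subseteq> strictly_below C l"
    using assms leq_trans leq_antisym unfolding subset_iff strictly_below_iff by metis
  moreover have "m \<in> strictly_below C l" "m \<notin> strictly_below C m"
    using assms by (simp_all add: strictly_below_iff)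
  ultimately show "strictly_below C m \<subset> strictly_below C l" by blast
qed

text \<open>The effect of appending \<open>f\<close> on the invariant. The mark moves from
  \<open>m\<close> to \<open>l\<close>: morphisms at \<open>m\<close> survive only if
  \<open>m\<close> has positive weight, and the morphisms from the support to \<open>m\<close> are
  composed with \<open>f\<close> to give those to \<open>l\<close>.\<close>

definition bdata_ext :: "'o \<Rightarrow> 'o \<Rightarrow> 'm \<Rightarrow> ('o \<Rightarrow> real) \<times> 'm set \<Rightarrow> ('o \<Rightarrow> real) \<times> 'm set" where
  "bdata_ext m l f I = (fst I, {g \<in> snd I. src C g \<in> supp (fst I) \<and> tgt C g \<in> supp (fst I)} \<union>
     {cmp C f g | g. g \<in> snd I \<and> tgt C g = m \<and> src C g \<in> supp (fst I)} \<union> {ident C l})"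

definition attach :: "'o \<Rightarrow> 'o \<Rightarrow> 'm \<Rightarrow> ('o, 'm) bpoint \<Rightarrow> ('o, 'm) bpoint" where
  "attach m l f e = point l (bdata_ext m l f (data m e))"

context
  fixes m l :: 'o and f :: 'm
  assumes f: "f \<in> Hom C m l" and ml: "m \<noteq> l"
begin

lemma height_ml: "height m < height l"
  using height_less[OF leqI[OF f] ml] .

lemma not_below: "e \<in> topspace (star m) \<Longrightarrow> l \<notin> supp (fst (data m e))"
  using data_leq leq_antisym[OF leqI[OF f]] ml by blast

text \<open>As \<open>l\<close> is not below \<open>m\<close>, it is no object of the given chain.
  So in \<open>hops_ext\<close> the old morphisms do not touch \<open>l\<close>, the composites have
  only their target at \<open>l\<close>, and the identity has both ends there.\<close>

lemma ext_padded:
  assumes p: "(c, t) \<in> topspace (padded m)"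
  shows "(ext f (height m) (height l) c, t) \<in> topspace (padded l)"
    "pshape l (ext f (height m) (height l) c, t) = bdata_ext m l f (pshape m (c, t))"
    "cls (height l, ext f (height m) (height l) c, t) = cls (height m, c, t)"
proof -
  let ?e = "ext f (height m) (height l) c"
  have c: "c \<in> topspace (nerve C (height m))" "obj c (height m) = m" and t: "t \<in> standard_simplex (height m)"
    using p by simp_all
  have f': "f \<in> Mo" "src C f = obj c (height m)" "tgt C f = l" using f c(2) by (simp_all add: Hom_iff)
  note e = c(1) f'(1,2) less_imp_le[OF height_ml]
  show "(?e, t) \<in> topspace (padded l)"
    using ext_nerve[OF e] ext_obj_high[OF e height_ml order_refl] f'(3) t standard_simplex_mono[OF less_imp_le[OF height_ml]]
    by auto
  show "cls (height l, ?e, t) = cls (height m, c, t)"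
    using equ_ext[OF e t] equ_sym cls_eq by blast
  let ?w = "wt (height m) c t"
  have sm: "(z, m) \<in> leq" if "z \<in> supp ?w" for z
  proof -
    obtain i where "i \<le> height m" "z = obj c i" using \<open>z \<in> supp ?w\<close> unfolding supp_wt[OF t] by blast
    then show ?thesis using chain_leq[OF c(1), of i "height m"] c(2) by simp
  qed
  have hm: "(src C g, tgt C g) \<in> leq" "(tgt C g, m) \<in> leq" "g \<in> Mo" if "g \<in> hops (height m) c" for g
  proof -
    obtain i j where "i \<le> j" "j \<le> height m" "g \<in> Mo" "src C g = obj c i" "tgt C g = obj c j"
      using hopsE[OF c(1) \<open>g \<in> hops (height m) c\<close>] by metis
    then show "(src C g, tgt C g) \<in> leq" "(tgt C g, m) \<in> leq" "g \<in> Mo"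
      using chain_leq[OF c(1), of i j] chain_leq[OF c(1), of j "height m"] c(2) by simp_all
  qed
  have nl: "(l, m) \<notin> leq" using leq_antisym[OF leqI[OF f]] ml by blast
  have lw: "l \<notin> supp ?w" using sm nl by blast
  have l: "l \<in> Ob" using leqI[OF f] leq_in by blast
  have "{g \<in> hops (height l) ?e. src C g \<in> {l} \<union> supp ?w \<and> tgt C g \<in> {l} \<union> supp ?w} =
      {g \<in> hops (height m) c. src C g \<in> supp ?w \<and> tgt C g \<in> supp ?w} \<union>
      {cmp C f g | g. g \<in> hops (height m) c \<and> tgt C g = m \<and> src C g \<in> supp ?w} \<union> {ident C l}" (is "?L = ?R")
  proof (intro equalityI subsetI)
    fix g assume g: "g \<in> ?L"
    then consider "g \<in> hops (height m) c" | h where "g = cmp C f h" "h \<in> hops (height m) c" "tgt C h = m" | "g = ident C l"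
      unfolding hops_ext[OF e height_ml] f'(3) c(2) by blast
    then show "g \<in> ?R"
    proof cases
      case 1
      then have "tgt C g \<noteq> l" using hm nl by metis
      moreover have "src C g \<noteq> l" using hm[OF 1] nl leq_trans by metis
      ultimately show ?thesis using 1 g by blast
    next
      case 2
      have "src C g = src C h" using 2 hm(3)[OF 2(2)] f by (simp add: src_cmp Hom_iff)
      moreover have "src C h \<noteq> l" using hm[OF 2(2)] nl leq_trans by metis
      ultimately have "src C h \<in> supp ?w" using g by auto
      then show ?thesis using 2 by blast
    qed blast
  next
    fix g assume "g \<in> ?R"
    then consider "g \<in> hops (height m) c" "src C g \<in> supp ?w" "tgt C g \<in> supp ?w"
      | h where "g = cmp C f h" "h \<in> hops (height m) c" "tgt C h = m" "src C h \<in> supp ?w" | "g = ident C l"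
      by blast
    then show "g \<in> ?L"
    proof cases
      case 1
      then show ?thesis unfolding hops_ext[OF e height_ml] by blast
    next
      case 2
      have "src C g = src C h" "tgt C g = l" using 2 hm(3)[OF 2(2)] f by (simp_all add: src_cmp tgt_cmp Hom_iff)
      moreover have "g \<in> {cmp C f h | h. h \<in> hops (height m) c \<and> tgt C h = m}" using 2 by blast
      ultimately show ?thesis using 2(4) unfolding hops_ext[OF e height_ml] c(2) by simp
    next
      case 3
      then show ?thesis using l f'(3) unfolding hops_ext[OF e height_ml] by (simp add: src_ident tgt_ident)
    qed
  qed
  moreover have "{g \<in> {g \<in> hops (height m) c. src C g \<in> {m} \<union> supp ?w \<and> tgt C g \<in> {m} \<union> supp ?w}.
      src C g \<in> supp ?w \<and> tgt C g \<in> supp ?w} = {g \<in> hops (height m) c. src C g \<in> supp ?w \<and> tgt C g \<in> supp ?w}"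
    by blast
  moreover have "{cmp C f g | g. g \<in> {g \<in> hops (height m) c. src C g \<in> {m} \<union> supp ?w \<and> tgt C g \<in> {m} \<union> supp ?w} \<and>
      tgt C g = m \<and> src C g \<in> supp ?w} = {cmp C f g | g. g \<in> hops (height m) c \<and> tgt C g = m \<and> src C g \<in> supp ?w}"
    by blast
  ultimately show "pshape l (?e, t) = bdata_ext m l f (pshape m (c, t))"
    by (simp only: pshape_def shape_def prod.case wt_ext[OF e t] bdata_ext_def fst_conv snd_conv)
qed

lemma attach_point:
  assumes p: "(c, t) \<in> topspace (padded m)"
  shows "attach m l f (point m (pshape m (c, t))) = point l (pshape l (ext f (height m) (height l) c, t))"
  unfolding attach_def data_point[OF p] ext_padded(2)[OF p] ..

lemma attach_props:
  assumes e: "e \<in> topspace (star m)"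
  shows "attach m l f e \<in> topspace (star l)" "data l (attach m l f e) = bdata_ext m l f (data m e)"
    "chr l (attach m l f e) = chr m e"
proof -
  obtain c t where p: "(c, t) \<in> topspace (padded m)" "e = point m (pshape m (c, t))"
    using starE[OF e] .
  note q = ext_padded[OF p(1)]
  show "attach m l f e \<in> topspace (star l)"
    unfolding p(2) attach_point[OF p(1)] by (rule point_in_star[OF q(1)])
  show "data l (attach m l f e) = bdata_ext m l f (data m e)"
    unfolding p(2) attach_point[OF p(1)] data_point[OF q(1)] data_point[OF p(1)] by (rule q(2))
  show "chr l (attach m l f e) = chr m e"
    unfolding p(2) attach_point[OF p(1)] chr_point[OF q(1)] chr_point[OF p(1)] by (rule q(3))
qed

lemma attach_in_link:
  assumes e: "e \<in> topspace (star m)"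
  shows "attach m l f e \<in> topspace (link l)"
proof -
  have "fst (data m e) l = 0"
    using not_below[OF e] data_nonneg[OF e, of l] by (simp add: supp_def)
  then show ?thesis unfolding link_iff using attach_props[OF e] by (simp add: bdata_ext_def)
qed

lemma fst_data_attach: "e \<in> topspace (star m) \<Longrightarrow> fst (data l (attach m l f e)) = fst (data m e)"
  by (simp add: attach_props bdata_ext_def)

text \<open>On the interior of the star the morphism \<open>f\<close> is part of the data, as the composite of \<open>f\<close>
  with the identity of \<open>m\<close>, and it is separated from the old morphisms by its target.\<close>

lemma data_attach_interior:
  assumes e: "e \<in> topspace (star m)" and pos: "0 < fst (data m e) m"
  shows "f \<in> snd (data l (attach m l f e))"
    "snd (data m e) = {g \<in> snd (data l (attach m l f e)). tgt C g \<in> supp (fst (data m e))}"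
proof -
  have fm: "f \<in> Mo" "src C f = m" "tgt C f = l" using f by (simp_all add: Hom_iff)
  have m: "m \<in> Ob" and l: "l \<in> Ob" using leqI[OF f] leq_in by blast+
  have s: "m \<in> supp (fst (data m e))" using pos by (simp add: supp_def)
  have "f = cmp C f (ident C m)" using fm by (simp add: cmp_ident_right)
  moreover have "tgt C (ident C m) = m" "src C (ident C m) \<in> supp (fst (data m e))"
    using m s by (simp_all add: src_ident tgt_ident)
  ultimately show "f \<in> snd (data l (attach m l f e))"
    unfolding attach_props(2)[OF e] bdata_ext_def using data_ident[OF e] by auto
  have 1: "src C g \<in> supp (fst (data m e)) \<and> tgt C g \<in> supp (fst (data m e))" if "g \<in> snd (data m e)" for g
    using data_mor[OF e that] s by auto
  have 2: "tgt C (cmp C f g) \<notin> supp (fst (data m e))" if "g \<in> snd (data m e)" "tgt C g = m" for g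
    using data_mor(1)[OF e that(1)] that(2) fm not_below[OF e] by (simp add: tgt_cmp)
  have 3: "tgt C (ident C l) \<notin> supp (fst (data m e))" using l not_below[OF e] by (simp add: tgt_ident)
  show "snd (data m e) = {g \<in> snd (data l (attach m l f e)). tgt C g \<in> supp (fst (data m e))}"
    unfolding attach_props(2)[OF e] bdata_ext_def snd_conv using 1 2 3 by blast
qed

end

text \<open>Positivity of the weight of \<open>m\<close> puts both morphisms from \<open>m\<close>
  to \<open>l\<close> into the data of the attached point; this data is functional, so they
  agree.\<close>

lemma attach_inj:
  assumes f: "f \<in> Hom C m l" "f' \<in> Hom C m l" and ml: "m \<noteq> l"
    and e: "e \<in> topspace (star m)" "e' \<in> topspace (star m)" and pos: "0 < fst (data m e) m"
    and eq: "attach m l f e = attach m l f' e'"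
  shows "f = f' \<and> e = e'"
proof -
  have w: "fst (data m e) = fst (data m e')"
    using fst_data_attach[OF f(1) ml e(1)] fst_data_attach[OF f(2) ml e(2)] eq by simp
  then have pos': "0 < fst (data m e') m" using pos by simp
  have "f \<in> snd (data l (attach m l f e))" "f' \<in> snd (data l (attach m l f e))"
    using data_attach_interior(1)[OF f(1) ml e(1) pos] data_attach_interior(1)[OF f(2) ml e(2) pos'] eq by simp_all
  then have "f = f'"
    using data_functional[OF attach_props(1)[OF f(1) ml e(1)]] f unfolding functional_def by (simp add: Hom_iff)
  moreover have "snd (data m e) = snd (data m e')"
    using data_attach_interior(2)[OF f(1) ml e(1) pos] data_attach_interior(2)[OF f(2) ml e(2) pos'] eq w by simp
  then have "e = e'" using w point_data e by (metis prod_eq_iff)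
  ultimately show ?thesis by simp
qed

text \<open>In the intermediate point \<open>m\<close> has weight 0, so its morphisms from the
  support to \<open>m\<close> are exactly the composites with \<open>f\<close>. Attaching along
  \<open>g\<close> replaces these by composites with \<open>cmp C g f\<close>.\<close>

lemma attach_attach:
  assumes f: "f \<in> Hom C k m" and km: "k \<noteq> m" and g: "g \<in> Hom C m l" and ml: "m \<noteq> l" and e: "e \<in> topspace (star k)"
  shows "attach m l g (attach k m f e) = attach k l (cmp C g f) e"
proof -
  let ?w = "fst (data k e)" and ?G = "snd (data k e)"
  have m: "m \<in> Ob" using leqI[OF f] leq_in by blast
  have fm: "f \<in> Mo" "src C f = k" "tgt C f = m" and gm: "g \<in> Mo" "src C g = m" "tgt C g = l"
    using f g by (simp_all add: Hom_iff)
  have nm: "m \<notin> supp ?w" by (rule not_below[OF f km e])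
  have h: "h \<in> Mo" if "h \<in> ?G" for h using data_mor(1)[OF e that] .
  have tf: "src C (cmp C f h) = src C h \<and> tgt C (cmp C f h) = m" if "h \<in> ?G" "tgt C h = k" for h
    using h[OF that(1)] that(2) fm by (simp add: src_cmp tgt_cmp)
  have as: "cmp C g (cmp C f h) = cmp C (cmp C g f) h" if "h \<in> ?G" "tgt C h = k" for h
    using h[OF that(1)] that(2) fm gm by (simp add: cmp_assoc)
  let ?G' = "{h \<in> ?G. src C h \<in> supp ?w \<and> tgt C h \<in> supp ?w} \<union>
     {cmp C f h | h. h \<in> ?G \<and> tgt C h = k \<and> src C h \<in> supp ?w} \<union> {ident C m}"
  have im: "tgt C (ident C m) = m" "src C (ident C m) = m" using m by (simp_all add: src_ident tgt_ident)
  have A: "{h \<in> ?G'. src C h \<in> supp ?w \<and> tgt C h \<in> supp ?w} = {h \<in> ?G. src C h \<in> supp ?w \<and> tgt C h \<in> supp ?w}"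
  proof (intro equalityI subsetI)
    fix a assume a: "a \<in> {h \<in> ?G'. src C h \<in> supp ?w \<and> tgt C h \<in> supp ?w}"
    then have "tgt C a \<noteq> m" using nm by blast
    then show "a \<in> {h \<in> ?G. src C h \<in> supp ?w \<and> tgt C h \<in> supp ?w}" using a tf im by auto
  qed auto
  have B: "{cmp C g h | h. h \<in> ?G' \<and> tgt C h = m \<and> src C h \<in> supp ?w} =
      {cmp C (cmp C g f) h | h. h \<in> ?G \<and> tgt C h = k \<and> src C h \<in> supp ?w}"
  proof (intro equalityI subsetI)
    fix a assume "a \<in> {cmp C g h | h. h \<in> ?G' \<and> tgt C h = m \<and> src C h \<in> supp ?w}"
    then obtain b where b: "a = cmp C g b" "b \<in> ?G'" "tgt C b = m" "src C b \<in> supp ?w" by blast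
    then have "b \<notin> ?G \<or> tgt C b \<notin> supp ?w" "b \<noteq> ident C m" using nm im by auto
    then obtain h where "b = cmp C f h" "h \<in> ?G" "tgt C h = k" "src C h \<in> supp ?w" using b(2) by blast
    then show "a \<in> {cmp C (cmp C g f) h | h. h \<in> ?G \<and> tgt C h = k \<and> src C h \<in> supp ?w}" using as b(1) by blast
  next
    fix a assume "a \<in> {cmp C (cmp C g f) h | h. h \<in> ?G \<and> tgt C h = k \<and> src C h \<in> supp ?w}"
    then obtain h where hh: "a = cmp C (cmp C g f) h" "h \<in> ?G" "tgt C h = k" "src C h \<in> supp ?w" by blast
    then have "a = cmp C g (cmp C f h)" using as by simp
    moreover have "cmp C f h \<in> ?G'" using hh by blast
    ultimately show "a \<in> {cmp C g h | h. h \<in> ?G' \<and> tgt C h = m \<and> src C h \<in> supp ?w}" using tf[OF hh(2,3)] hh(4) by auto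
  qed
  have "bdata_ext m l g (bdata_ext k m f (data k e)) = bdata_ext k l (cmp C g f) (data k e)"
    unfolding bdata_ext_def fst_conv snd_conv A B ..
  then show ?thesis
    unfolding attach_def[of m] attach_props(2)[OF f km e] attach_def[of k l] by simp
qed

text \<open>Every morphism from the support to \<open>l\<close> factors through the last position of
  positive weight, whose object is the top object \<open>m\<close>. The part before it belongs to
  the star of \<open>m\<close>, and the composite after it is the required morphism.\<close>

lemma link_covered:
  assumes e: "e \<in> topspace (link l)"
  obtains f e' where "f \<in> Hom C (top_obj (chr l e)) l" "top_obj (chr l e) \<noteq> l" "e' \<in> topspace (star (top_obj (chr l e)))"
    "0 < fst (data (top_obj (chr l e)) e') (top_obj (chr l e))" "attach (top_obj (chr l e)) l f e' = e"
proof -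
  define b where "b = chr l e"
  define m where "m = top_obj b"
  have es: "e \<in> topspace (star l)" and z: "fst (data l e) l = 0" using e by (simp_all add: link_iff)
  have b: "b \<in> topspace (classifying_space C)" unfolding b_def by (rule chr_in[OF es])
  have mOb: "m \<in> Ob" unfolding m_def by (rule top_obj_props(1)[OF b])
  have ml: "m \<noteq> l" using top_obj_chr(2)[OF es] z by (simp add: m_def b_def)
  \<comment> \<open>The image of \<open>e\<close> lies in the cell of \<open>m\<close>, so it has a
    preimage in the star of \<open>m\<close>, and there \<open>m\<close> has positive
    weight.\<close>
  obtain e' where e': "e' \<in> topspace (star m)" "chr m e' = b"
    using chr_surj[OF b leq_refl[OF mOb, unfolded m_def]] unfolding m_def by blast
  have pos: "0 < fst (data m e') m" using top_obj_chr(2)[OF e'(1)] e'(2) m_def by simp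
  obtain c t where p: "e = point l (pshape l (c, t))" "c \<in> topspace (nerve C (height l))" "t \<in> standard_simplex (height l)"
    "obj c (height l) = l" "fst (data l e) = wt (height l) c t"
    "\<And>f. f \<in> snd (data l e) \<longleftrightarrow> f \<in> hops (height l) c \<and>
       src C f \<in> insert l (supp (wt (height l) c t)) \<and> tgt C f \<in> insert l (supp (wt (height l) c t))"
    by (rule star_rep[OF es]) blast
  let ?N = "height l" and ?w = "wt (height l) c t"
  have bd: "bdata (chr m e') = bdata (chr l e)" using e'(2) b_def by simp
  have w: "fst (data m e') = ?w" using bd data_chr[OF e'(1)] data_chr[OF es] p(5) by simp
  have G: "{g \<in> snd (data m e'). src C g \<in> supp ?w \<and> tgt C g \<in> supp ?w} =
      {g \<in> snd (data l e). src C g \<in> supp ?w \<and> tgt C g \<in> supp ?w}"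
    using bd unfolding bdata_chr[OF e'(1)] bdata_chr[OF es] w p(5) by simp
  have G1: "g \<in> snd (data m e')" if "g \<in> snd (data l e)" "src C g \<in> supp ?w" "tgt C g \<in> supp ?w" for g
    using G that by blast
  have G2: "g \<in> snd (data l e)" if "g \<in> snd (data m e')" "src C g \<in> supp ?w" "tgt C g \<in> supp ?w" for g
    using G that by blast
  obtain j where j: "j \<le> ?N" "0 < t j" "\<And>i. i \<le> ?N \<Longrightarrow> 0 < t i \<Longrightarrow> i \<le> j" "top_of ?w = obj c j"
    using top_of_wt[OF p(2,3)] by blast
  have mj: "m = obj c j" unfolding m_def b_def top_obj_def data_chr[OF es] p(5) j(4) ..
  have ms: "m \<in> supp ?w" using pos w by (simp add: supp_def)
  let ?f = "hop c j ?N"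
  have f: "?f \<in> Hom C m l" using hop_Hom[OF p(2) j(1) order_refl] mj p(4) by simp
  have fac: "\<exists>i\<le>j. y = obj c i" if "y \<in> supp ?w" for y
    using that j(3) unfolding supp_wt[OF p(3)] by auto
  have l: "l \<in> Ob" using leqI[OF f] leq_in by blast
  have lw: "l \<notin> supp ?w" using z p(5) by (simp add: supp_def)
  have "snd (data l e) = {g \<in> snd (data m e'). src C g \<in> supp ?w \<and> tgt C g \<in> supp ?w} \<union>
     {cmp C ?f g | g. g \<in> snd (data m e') \<and> tgt C g = m \<and> src C g \<in> supp ?w} \<union> {ident C l}" (is "?L = ?R")
  proof (intro equalityI subsetI)
    fix g assume g: "g \<in> ?L"
    then have gh: "g \<in> hops ?N c" and gs: "src C g \<in> insert l (supp ?w)" and gt: "tgt C g \<in> insert l (supp ?w)"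
      unfolding p(6) by blast+
    obtain i' j' where ij: "i' \<le> j'" "j' \<le> ?N" "g = hop c i' j'" "g \<in> Mo" "src C g = obj c i'" "tgt C g = obj c j'"
      using hopsE[OF p(2) gh] .
    consider "src C g = l" | "src C g \<in> supp ?w" "tgt C g \<in> supp ?w" | "src C g \<in> supp ?w" "tgt C g = l"
      using gs gt by blast
    then show "g \<in> ?R"
    proof cases
      case 1
      have "(l, tgt C g) \<in> leq" using chain_leq[OF p(2) ij(1,2)] 1 ij by simp
      moreover have "(tgt C g, l) \<in> leq" using chain_leq[OF p(2) ij(2) order_refl] p(4) ij by simp
      ultimately have "tgt C g = l" using leq_antisym by blast
      then have "g = ident C l" using 1 ij(4) endo_ident by blast
      then show ?thesis by blast
    next
      case 2
      then show ?thesis using G1[OF g] by blast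
    next
      case 3
      obtain i where i: "i \<le> j" "src C g = obj c i" using fac[OF 3(1)] by blast
      have "hop c i' j' = hop c i ?N"
        using ij i j(1) 3(2) p(4) by (intro hop_unique[OF p(2)]) auto
      then have "g = cmp C ?f (hop c i j)" using ij(3) hop_comp[OF p(2) i(1) j(1) order_refl] by simp
      moreover have "hop c i j \<in> Hom C (src C g) m" using hop_Hom[OF p(2) i(1) j(1)] i(2) mj by simp
      then have hij: "src C (hop c i j) = src C g" "tgt C (hop c i j) = m" by (simp_all add: Hom_iff)
      moreover have "hop c i j \<in> snd (data m e')"
      proof -
        have "hop c i j \<in> snd (data l e)" unfolding p(6) using hopsI[OF i(1) j(1)] hij 3(1) ms by simp
        then show ?thesis by (rule G1) (simp_all add: hij 3(1) ms)
      qed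
      ultimately show ?thesis using 3(1) by auto
    qed
  next
    fix g assume "g \<in> ?R"
    then consider "g \<in> snd (data m e')" "src C g \<in> supp ?w" "tgt C g \<in> supp ?w"
      | h where "g = cmp C ?f h" "h \<in> snd (data m e')" "tgt C h = m" "src C h \<in> supp ?w" | "g = ident C l" by blast
    then show "g \<in> ?L"
    proof cases
      case 1
      then show ?thesis by (intro G2)
    next
      case 2
      obtain i where i: "i \<le> j" "src C h = obj c i" using fac[OF 2(4)] by blast
      have "h \<in> snd (data l e)" using 2 ms by (intro G2) simp_all
      then have "h \<in> hops ?N c" unfolding p(6) by blast
      moreover have "hop c i j \<in> Hom C (src C h) m" using hop_Hom[OF p(2) i(1) j(1)] i(2) mj by simp
      ultimately have "h = hop c i j"
        using hops_functional[OF p(2) _ hopsI[OF i(1) j(1)], of h] 2(3) by (simp add: Hom_iff)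
      then have "g = hop c i ?N" using 2(1) hop_comp[OF p(2) i(1) j(1) order_refl] by simp
      moreover have iN: "i \<le> ?N" using i j by simp
      ultimately show ?thesis
        unfolding p(6) using hopsI[OF iN order_refl] hop_Hom[OF p(2) iN order_refl] i(2) 2(4) p(4) by (simp add: Hom_iff)
    next
      case 3
      then show ?thesis using data_ident[OF es] by simp
    qed
  qed
  then have "bdata_ext m l ?f (data m e') = data l e"
    unfolding bdata_ext_def w using p(5) by (simp add: prod_eq_iff)
  then have "attach m l ?f e' = e" unfolding attach_def using point_data[OF es] by simp
  then show ?thesis using that f ml e'(1) pos unfolding m_def b_def by blast
qed

abbreviation "HomT m l \<equiv> subtopology (Mor C) (Hom C m l)"

text \<open>On representatives this is \<open>ext\<close>, whose components are continuous in
  \<open>f\<close> and the chain. It descends as in \<open>continuous_join\<close>, by compactness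
  of the product of the morphism space with the padded chains.\<close>

lemma continuous_attach:
  assumes ml: "(m, l) \<in> leq" "m \<noteq> l"
  shows "continuous_map (prod_topology (HomT m l) (star m)) (link l) (\<lambda>(f, e). attach m l f e)"
proof -
  let ?M = "height m" and ?L = "height l"
  let ?q = "\<lambda>p. point m (pshape m p)"
  have Ob: "m \<in> Ob" "l \<in> Ob" using leq_in[OF ml(1)] by blast+
  have lt: "?M < ?L" by (rule height_less[OF ml])
  have Hom_top: "topspace (HomT m l) = Hom C m l" by (auto simp: Hom_iff)
  let ?X = "prod_topology (HomT m l) (padded m)"
  have 1: "continuous_map ?X (Mor C) fst" using continuous_map_fst by (rule continuous_map_into_fulltopology)
  have 2: "continuous_map ?X (wchains ?M) snd"
    using continuous_map_snd[of "HomT m l" "padded m"] unfolding padded_def by (meson continuous_map_in_subtopology)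
  have 3: "continuous_map ?X (nerve C ?M) (\<lambda>a. fst (snd a))"
    using continuous_map_compose[OF 2 continuous_map_fst] by (simp add: o_def)
  have 4: "continuous_map ?X (Delta ?M) (\<lambda>a. snd (snd a))"
    using continuous_map_compose[OF 2 continuous_map_snd] by (simp add: o_def)
  have mem: "fst a \<in> Hom C m l" "(fst (snd a), snd (snd a)) \<in> topspace (padded m)" if "a \<in> topspace ?X" for a
  proof -
    have "fst a \<in> topspace (HomT m l)" "snd a \<in> topspace (padded m)"
      using that by (simp_all add: mem_Times_iff)
    then show "fst a \<in> Hom C m l" "(fst (snd a), snd (snd a)) \<in> topspace (padded m)"
      using Hom_top by (blast, simp)
  qed
  have e_mem: "(ext (fst a) ?M ?L (fst (snd a)), snd (snd a)) \<in> topspace (padded l)" if "a \<in> topspace ?X" for a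
    using ext_padded(1)[OF mem(1)[OF that] ml(2) mem(2)[OF that]] .
  have "continuous_map ?X (Mor C) (\<lambda>a. snd (ext (fst a) ?M ?L (fst (snd a))) i)" if i: "i < ?L" for i
  proof -
    consider "i < ?M" | "i = ?M" | "?M < i" by linarith
    then show ?thesis
    proof cases
      case 1
      then show ?thesis using continuous_map_compose[OF 3 continuous_chain_mor[OF 1]] i by (simp add: ext_def o_def)
    next
      case 2
      then show ?thesis using 1 i by (simp add: ext_def)
    next
      case 3
      have "continuous_map ?X (Mor C) (\<lambda>a. ident C (tgt C (fst a)))"
        using continuous_map_compose[OF continuous_map_compose[OF 1 continuous_tgt] continuous_ident] by (simp add: o_def)
      then show ?thesis using 3 i by (simp add: ext_def)
    qed
  qed
  moreover have "continuous_map (nerve C ?M) (Obj C) fst"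
    unfolding nerve_eq by (intro continuous_map_from_subtopology continuous_map_fst)
  from continuous_map_compose[OF 3 this] have "continuous_map ?X (Obj C) (\<lambda>a. fst (ext (fst a) ?M ?L (fst (snd a))))"
    by (simp add: ext_def o_def)
  ultimately have "continuous_map ?X (prod_topology (Obj C) (product_topology (\<lambda>_. Mor C) {..<?L}))
      (\<lambda>a. ext (fst a) ?M ?L (fst (snd a)))"
    unfolding continuous_map_componentwise continuous_map_pairwise o_def by (auto simp: ext_def)
  moreover have "ext (fst a) ?M ?L (fst (snd a)) \<in> {c. \<forall>i<?L. src C (snd c i) = obj c i}" if "a \<in> topspace ?X" for a
    using e_mem[OF that] by (simp add: nerve_iff)
  ultimately have n: "continuous_map ?X (nerve C ?L) (\<lambda>a. ext (fst a) ?M ?L (fst (snd a)))"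
    unfolding nerve_eq[of ?L] continuous_map_in_subtopology by blast
  have d: "continuous_map ?X (Delta ?L) (\<lambda>a. snd (snd a))"
    using 4 standard_simplex_mono[of ?M ?L] lt unfolding continuous_map_in_subtopology by auto
  have "continuous_map ?X (wchains ?L) (\<lambda>a. (ext (fst a) ?M ?L (fst (snd a)), snd (snd a)))"
    unfolding continuous_map_paired using n d by blast
  moreover have "(\<lambda>a. (ext (fst a) ?M ?L (fst (snd a)), snd (snd a))) \<in>
      topspace ?X \<rightarrow> {p. obj (fst p) ?L = l}"
    using e_mem unfolding padded_iff by simp
  ultimately have "continuous_map ?X (padded l) (\<lambda>a. (ext (fst a) ?M ?L (fst (snd a)), snd (snd a)))"
    unfolding padded_def[of l] by (intro continuous_map_into_subtopology)
  from continuous_map_compose[OF this continuous_map_star]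
  have "continuous_map ?X (star l) (\<lambda>a. point l (pshape l (ext (fst a) ?M ?L (fst (snd a)), snd (snd a))))"
    by (simp add: o_def)
  then have c: "continuous_map ?X (star l) (\<lambda>a. attach m l (fst a) (?q (snd a)))"
    by (rule continuous_map_eq) (use attach_point[OF mem(1) ml(2) mem(2)] in simp)
  have H: "compact_space (HomT m l)" "Hausdorff_space (HomT m l)" using compact_Hausdorff_Hom[OF Ob] by blast+
  have "quotient_map ?X (prod_topology (HomT m l) (star m)) (\<lambda>(f, p). (f, ?q p))"
  proof (rule T1_Spaces.continuous_imp_quotient_map)
    show "continuous_map ?X (prod_topology (HomT m l) (star m)) (\<lambda>(f, p). (f, ?q p))"
      unfolding case_prod_unfold continuous_map_paired
      using continuous_map_fst continuous_map_compose[OF continuous_map_snd continuous_map_star] by (auto simp: o_def)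
    show "compact_space ?X" using H compact_space_padded[OF Ob(1)] by (simp add: compact_space_prod_topology)
    show "Hausdorff_space (prod_topology (HomT m l) (star m))"
      using H Hausdorff_star by (simp add: Hausdorff_space_prod_topology)
    show "(\<lambda>(f, p). (f, ?q p)) ` topspace ?X = topspace (prod_topology (HomT m l) (star m))"
      unfolding topspace_prod_topology topspace_star by (rule image_Times_snd)
  qed
  then have "continuous_map (prod_topology (HomT m l) (star m)) (star l) (\<lambda>(f, e). attach m l f e)"
  proof (rule continuous_compose_quotient_map)
    show "continuous_map ?X (star l) ((\<lambda>(f, e). attach m l f e) \<circ> (\<lambda>(f, p). (f, ?q p)))"
      using c by (simp add: o_def case_prod_unfold)
  qed
  moreover have "(\<lambda>(f, e). attach m l f e) \<in> topspace (prod_topology (HomT m l) (star m)) \<rightarrow> topspace (link l)"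
    using attach_in_link[OF _ ml(2)] Hom_top by auto
  ultimately show ?thesis by (subst link_eq) (simp only: continuous_map_in_subtopology)
qed

section \<open>The stratification of the classifying space\<close>

abbreviation "BC \<equiv> classifying_space C"

abbreviation "Cone x \<equiv> cone_topology (link x)"

definition phi :: "'o \<Rightarrow> ('o, 'm) bpoint cone_point \<Rightarrow> ('o, 'm) bpoint" where
  "phi x d = chr x (join x d)"

lemma cone_weight:
  assumes "d \<in> topspace (Cone x)"
  shows "fst (cone_data x d) x = (case d of Tip \<Rightarrow> 1 | Ray s e \<Rightarrow> 1 - s)"
  using assms by (cases rule: cone_point_cases) (auto simp: cone_data_def link_iff)

lemma continuous_phi:
  assumes "x \<in> Ob"
  shows "continuous_map (Cone x) BC (phi x)"
proof -
  have "phi x = chr x \<circ> join x" by (simp add: phi_def fun_eq_iff)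
  then show ?thesis using continuous_map_compose[OF continuous_join[OF assms] continuous_chr] by simp
qed

lemma phi_in: "x \<in> Ob \<Longrightarrow> d \<in> topspace (Cone x) \<Longrightarrow> phi x d \<in> topspace BC"
  unfolding phi_def by (intro chr_in join_in_star)

lemma bdata_phi:
  assumes "x \<in> Ob" "d \<in> topspace (Cone x)"
  shows "fst (bdata (phi x d)) = fst (cone_data x d)"
    "snd (bdata (phi x d)) = {f \<in> snd (cone_data x d). src C f \<in> supp (fst (cone_data x d)) \<and> tgt C f \<in> supp (fst (cone_data x d))}"
  unfolding phi_def using bdata_chr[OF join_in_star[OF assms]] data_join[OF assms] by simp_all

lemma top_obj_phi:
  assumes "x \<in> Ob" "d \<in> topspace (Cone x)"
  shows "(top_obj (phi x d), x) \<in> leq" "top_obj (phi x d) = x \<longleftrightarrow> 0 < fst (cone_data x d) x"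
  unfolding phi_def using top_obj_chr[OF join_in_star[OF assms]] data_join[OF assms] by simp_all

lemma phi_image:
  assumes x: "x \<in> Ob"
  shows "phi x ` topspace (Cone x) = {b \<in> topspace BC. (top_obj b, x) \<in> leq}"
proof (intro equalityI subsetI)
  fix b assume "b \<in> phi x ` topspace (Cone x)"
  then show "b \<in> {b \<in> topspace BC. (top_obj b, x) \<in> leq}" using phi_in[OF x] top_obj_phi(1)[OF x] by blast
next
  fix b assume b: "b \<in> {b \<in> topspace BC. (top_obj b, x) \<in> leq}"
  then have b1: "b \<in> topspace BC" and b2: "(top_obj b, x) \<in> leq" by blast+
  obtain e where e: "e \<in> topspace (star x)" "chr x e = b" using chr_surj[OF b1 b2] .
  obtain d where "d \<in> topspace (Cone x)" "join x d = e" using join_surj[OF x e(1)] .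
  then show "b \<in> phi x ` topspace (Cone x)" using e(2) unfolding phi_def by blast
qed

lemma continuous_ray_phi:
  assumes x: "x \<in> Ob" and e: "e \<in> topspace (link x)"
  shows "continuous_map (top_of_set {0..1}) BC (\<lambda>s. phi x (cone_pt s e))"
proof -
  have "continuous_map (top_of_set {0..1}) (prod_topology (top_of_set {0..1}) (link x)) (\<lambda>s. (s, e))"
    using e by (simp add: continuous_map_paired)
  from continuous_map_compose[OF continuous_map_compose[OF this continuous_map_cone_pt] continuous_phi[OF x]]
  show ?thesis by (simp add: o_def)
qed

lemma ray_phi_top:
  assumes x: "x \<in> Ob" and e: "e \<in> topspace (link x)" and s: "0 \<le> s" "s < 1"
  shows "top_obj (phi x (cone_pt s e)) = x"
proof -
  have d: "cone_pt s e \<in> topspace (Cone x)" using cone_pt_in_cone(1)[OF s(1) _ e] s by simp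
  show ?thesis
    unfolding top_obj_phi(2)[OF x d] cone_weight[OF d] using s by (simp add: cone_pt_def)
qed

lemma phi_Tip_top: "x \<in> Ob \<Longrightarrow> top_obj (phi x Tip) = x"
  using top_obj_phi(2)[OF _ cone_pt_in_cone(2)] by (simp add: cone_data_def)

definition cell :: "'o \<Rightarrow> ('o, 'm) bpoint set" where
  "cell x = {b \<in> topspace BC. top_obj b = x}"

text \<open>The right-hand side is the image of a compact cone, hence closed. Conversely each point
  of the cone is the tip or a limit of points with parameter below 1 on its ray, and these are
  mapped into the cell.\<close>

lemma closure_cell:
  assumes x: "x \<in> Ob"
  shows "BC closure_of (cell x) = {b \<in> topspace BC. (top_obj b, x) \<in> leq}"
proof
  have "compactin BC (phi x ` topspace (Cone x))"
    using image_compactin[OF _ continuous_phi[OF x]] compact_space_cone[OF compact_space_link[OF x]]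
    by (simp add: compact_space_def)
  then have "closedin BC {b \<in> topspace BC. (top_obj b, x) \<in> leq}"
    unfolding phi_image[OF x] using Hausdorff_classifying_space compactin_imp_closedin by blast
  moreover have "cell x \<subseteq> {b \<in> topspace BC. (top_obj b, x) \<in> leq}"
    using leq_refl[OF x] by (auto simp: cell_def)
  ultimately show "BC closure_of (cell x) \<subseteq> {b \<in> topspace BC. (top_obj b, x) \<in> leq}"
    by (intro closure_of_minimal)
next
  have sub: "cell x \<subseteq> BC closure_of (cell x)" by (rule closure_of_subset) (auto simp: cell_def)
  have ray: "phi x (cone_pt s e) \<in> BC closure_of (cell x)"
    if e: "e \<in> topspace (link x)" and s: "0 \<le> s" "s \<le> 1" for s e
  proof -
    have "top_of_set {0..1::real} closure_of {0..<1} = {0..1} \<inter> closure ({0..1} \<inter> {0..<1})"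
      by (simp add: closure_of_subtopology)
    moreover have "{0..1::real} \<inter> {0..<1} = {0..<1}" by auto
    ultimately have "s \<in> top_of_set {0..1::real} closure_of {0..<1}" using s by simp
    then have "phi x (cone_pt s e) \<in> BC closure_of ((\<lambda>s. phi x (cone_pt s e)) ` {0..<1})"
      using continuous_map_image_closure_subset[OF continuous_ray_phi[OF x e], of "{0..<1}"] by blast
    moreover have "(\<lambda>s. phi x (cone_pt s e)) ` {0..<1} \<subseteq> cell x"
      using ray_phi_top[OF x e] phi_in[OF x] cone_pt_in_cone(1)[OF _ _ e] by (auto simp: cell_def)
    ultimately show ?thesis using closure_of_mono by blast
  qed
  show "{b \<in> topspace BC. (top_obj b, x) \<in> leq} \<subseteq> BC closure_of (cell x)"
    unfolding phi_image[OF x, symmetric]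
  proof (rule image_subsetI)
    fix d assume "d \<in> topspace (Cone x)"
    then show "phi x d \<in> BC closure_of (cell x)"
    proof (cases rule: cone_point_cases)
      case 1
      then show ?thesis using sub phi_Tip_top[OF x] phi_in[OF x cone_pt_in_cone(2)] by (auto simp: cell_def)
    next
      case (2 s e)
      then show ?thesis using ray[of e s] by simp
    qed
  qed
qed

text \<open>The cell is star-shaped around the image of the tip: it is a union of images of segments
  of rays that all contain this point.\<close>

lemma connectedin_cell:
  assumes x: "x \<in> Ob"
  shows "connectedin BC (cell x)"
proof -
  let ?F = "{T. connectedin BC T \<and> phi x Tip \<in> T \<and> T \<subseteq> cell x}"
  have tip: "phi x Tip \<in> cell x"
    using phi_Tip_top[OF x] phi_in[OF x cone_pt_in_cone(2)] by (simp add: cell_def)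
  have "\<exists>T\<in>?F. b \<in> T" if b: "b \<in> cell x" for b
  proof -
    have "b \<in> {b \<in> topspace BC. (top_obj b, x) \<in> leq}" using b leq_refl[OF x] by (auto simp: cell_def)
    then obtain d where d: "d \<in> topspace (Cone x)" "b = phi x d" unfolding phi_image[OF x, symmetric] by blast
    have pos: "0 < fst (cone_data x d) x" using b d top_obj_phi(2)[OF x d(1)] by (simp add: cell_def)
    show ?thesis
      using d(1)
    proof (cases rule: cone_point_cases)
      case 1
      have "connectedin BC {phi x Tip}" using tip by (simp add: cell_def connectedin_sing)
      then show ?thesis using 1 d(2) tip by blast
    next
      case (2 s e)
      have s: "s < 1" using pos cone_weight[OF d(1)] 2(4) by simp
      have "connectedin (top_of_set {0..1}) {0..s}" using 2 by (simp add: connectedin_subtopology)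
      then have "connectedin BC ((\<lambda>s. phi x (cone_pt s e)) ` {0..s})"
        by (rule connectedin_continuous_map_image[OF continuous_ray_phi[OF x 2(3)]])
      moreover have "(\<lambda>s. phi x (cone_pt s e)) ` {0..s} \<subseteq> cell x"
        using ray_phi_top[OF x 2(3)] phi_in[OF x] cone_pt_in_cone(1)[OF _ _ 2(3)] s by (auto simp: cell_def)
      moreover have "phi x Tip \<in> (\<lambda>s. phi x (cone_pt s e)) ` {0..s}"
        using 2(1) by (intro image_eqI[of _ _ 0]) (simp_all add: cone_pt_def)
      moreover have "b \<in> (\<lambda>s. phi x (cone_pt s e)) ` {0..s}"
        using 2(1) by (intro image_eqI[of _ _ s]) (simp_all add: d(2) 2(5)[symmetric])
      ultimately show ?thesis
        by (intro bexI[of _ "(\<lambda>s. phi x (cone_pt s e)) ` {0..s}"] CollectI conjI)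
    qed
  qed
  then have "cell x \<subseteq> \<Union>?F" by (simp only: subset_iff Union_iff) blast
  moreover have "\<Union>?F \<subseteq> cell x" by (rule Union_least) simp
  ultimately have "cell x = \<Union>?F" by (rule equalityI)
  moreover have "connectedin BC (\<Union>?F)" by (rule connectedin_Union) auto
  ultimately show ?thesis by simp
qed

text \<open>For an upward closed \<open>U\<close> the top object lies in \<open>U\<close> as soon as
  any object of the support does, so the preimage is the union of the open sets where some object of
  \<open>U\<close> has positive weight.\<close>

lemma continuous_top_obj: "continuous_map BC (alexandroff leq) top_obj"
  unfolding continuous_map_alexandroff Field_leq
proof (intro conjI allI impI)
  show "top_obj \<in> topspace BC \<rightarrow> Ob" using top_obj_props(1) by blast
  fix U assume U: "U \<subseteq> Ob" "\<forall>x y. x \<in> U \<longrightarrow> (x, y) \<in> leq \<longrightarrow> y \<in> U"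
  have "{b \<in> topspace BC. top_obj b \<in> U} = (\<Union>y\<in>U. {b \<in> topspace BC. fst (bdata b) y \<in> {0<..}})"
    using top_obj_props(2,3) U(2) by (auto simp: supp_def)
  moreover have "openin BC {b \<in> topspace BC. fst (bdata b) y \<in> {0<..}}" for y
    by (rule openin_continuous_map_preimage[OF continuous_bdata]) simp
  ultimately show "openin BC {b \<in> topspace BC. top_obj b \<in> U}" by auto
qed

text \<open>A point with top object \<open>x\<close> lies in the closure of the cell of every
  \<open>y\<close> above \<open>x\<close>, so each of its neighbourhoods contains points with top
  object \<open>y\<close>.\<close>

lemma open_map_top_obj: "open_map BC (alexandroff leq) top_obj"
  unfolding open_map_def openin_alexandroff Field_leq
proof (intro allI impI conjI)
  fix V assume V: "openin BC V"
  show "top_obj ` V \<subseteq> Ob" using openin_subset[OF V] top_obj_props(1) by blast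
  fix x y assume "x \<in> top_obj ` V" and xy: "(x, y) \<in> leq"
  then obtain b where b: "b \<in> V" "x = top_obj b" by blast
  have y: "y \<in> Ob" using leq_in[OF xy] by blast
  have "b \<in> BC closure_of (cell y)"
    unfolding closure_cell[OF y] using b xy openin_subset[OF V] by blast
  then obtain b' where "b' \<in> cell y" "b' \<in> V" using V b(1) unfolding in_closure_of by blast
  then show "y \<in> top_obj ` V" by (auto simp: cell_def)
qed

section \<open>The stellar structure\<close>

definition face :: "'o \<Rightarrow> ('o, 'm) bpoint \<Rightarrow> 'o set" where
  "face x e = supp (fst (data x e))"

definition link_poset :: "'o \<Rightarrow> 'o set rel" where
  "link_poset x = {(a, b). a \<in> face x ` topspace (link x) \<and> b \<in> face x ` topspace (link x) \<and> a \<subseteq> b}"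

text \<open>The weights \<open>\<lambda>_. 2\<close> are not in any simplex, so these points are new.\<close>

definition omega :: "'o set \<Rightarrow> ('o, 'm) bpoint" where
  "omega a = (\<lambda>y. (0, (y, \<lambda>_. undefined), \<lambda>_. 2)) ` a"

lemma Field_link_poset: "Field (link_poset x) = face x ` topspace (link x)"
  by (auto simp: Field_def link_poset_def)

lemma face_props:
  assumes "e \<in> topspace (link x)"
  shows "finite (face x e)" "face x e \<noteq> {}" "x \<notin> face x e"
proof -
  have e: "e \<in> topspace (star x)" and z: "fst (data x e) x = 0" using assms by (simp_all add: link_iff)
  have b: "chr x e \<in> topspace BC" by (rule chr_in[OF e])
  have top: "top_obj (chr x e) \<in> face x e"
    using top_obj_props(2)[OF b] data_chr[OF e] by (simp add: face_def)
  then show "face x e \<noteq> {}" by blast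
  show "x \<notin> face x e" using z by (simp add: face_def supp_def)
  have "face x e \<subseteq> insert x (strictly_below C x)"
    using data_leq[OF e] by (auto simp: face_def strictly_below_iff)
  moreover have "x \<in> Ob" using data_leq[OF e] top leq_in unfolding face_def by blast
  ultimately show "finite (face x e)" using finite_below by (meson finite.insertI finite_subset)
qed

lemma generic_extension_link: "generic_extension (link x) (link_poset x) (face x) omega"
proof
  have "link_poset x \<subseteq> Field (link_poset x) \<times> Field (link_poset x)" by (auto simp: Field_def)
  moreover have "refl_on (Field (link_poset x)) (link_poset x)"
    unfolding Field_link_poset by (auto simp: refl_on_def link_poset_def)
  moreover have "trans (link_poset x)" "antisym (link_poset x)"
    by (auto simp: link_poset_def trans_def antisym_def)
  ultimately show "Partial_order (link_poset x)"
    by (simp add: partial_order_on_def preorder_on_def)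
  have "inj omega"
    by (rule injI) (auto simp: omega_def inj_image_eq_iff inj_on_def)
  then show "inj_on omega (Field (link_poset x))" by (rule inj_on_subset) simp
  show "omega ` Field (link_poset x) \<inter> topspace (link x) = {}"
  proof (intro equalityI subsetI)
    fix e assume "e \<in> omega ` Field (link_poset x) \<inter> topspace (link x)"
    then obtain e' where e: "e \<in> topspace (link x)" "e' \<in> topspace (link x)" "e = omega (face x e')"
      unfolding Field_link_poset by blast
    obtain y where "y \<in> face x e'" using face_props(2)[OF e(2)] by blast
    then have mem: "(0, (y, \<lambda>_. undefined), \<lambda>_. 2) \<in> e" unfolding e(3) omega_def by blast
    obtain p where "p \<in> topspace (padded x)" "e = point x (pshape x p)"
      using e(1) unfolding link_iff topspace_star by blast
    then have "((y, \<lambda>_. undefined), \<lambda>_. 2) \<in> topspace (padded x)" using mem by (auto simp: point_def)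
    then have "(\<lambda>_. 2) \<in> standard_simplex (height x)" by simp
    then show "e \<in> {}" by (simp add: standard_simplex_def)
  qed simp
  show "continuous_map (link x) (alexandroff (link_poset x)) (face x)"
    unfolding continuous_map_alexandroff Field_link_poset
  proof (intro conjI allI impI)
    fix U assume U: "U \<subseteq> face x ` topspace (link x)"
      "\<forall>a b. a \<in> U \<longrightarrow> (a, b) \<in> link_poset x \<longrightarrow> b \<in> U"
    show "openin (link x) {e \<in> topspace (link x). face x e \<in> U}"
    proof (subst openin_subopen, intro ballI)
      fix e assume "e \<in> {e \<in> topspace (link x). face x e \<in> U}"
      then have e: "e \<in> topspace (link x)" "face x e \<in> U" by blast+
      \<comment> \<open>Keeping the finitely many positive weights of \<open>e\<close> positive is
        an open condition, and it only allows the support to grow.\<close>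
      let ?V = "\<Inter>y\<in>face x e. {a \<in> topspace (link x). fst (data x a) y \<in> {0<..}}"
      have "continuous_map (link x) euclideanreal (\<lambda>a. fst (data x a) y)" for y
        unfolding link_def by (intro continuous_map_from_subtopology continuous_data)
      then have "openin (link x) {a \<in> topspace (link x). fst (data x a) y \<in> {0<..}}" for y
        by (rule openin_continuous_map_preimage) simp
      then have V: "openin (link x) ?V"
        using face_props(1,2)[OF e(1)] by (intro openin_INT2) auto
      have eV: "e \<in> ?V" using e(1) by (simp add: face_def supp_def)
      have VU: "?V \<subseteq> {e \<in> topspace (link x). face x e \<in> U}"
      proof
        fix a assume "a \<in> ?V"
        then have a: "a \<in> topspace (link x)" "face x e \<subseteq> face x a"
          using face_props(2)[OF e(1)] by (auto simp: face_def supp_def)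
        then have "(face x e, face x a) \<in> link_poset x" using e(1) by (simp add: link_poset_def)
        then show "a \<in> {e \<in> topspace (link x). face x e \<in> U}" using U(2) e(2) a(1) by blast
      qed
      show "\<exists>T. openin (link x) T \<and> e \<in> T \<and> T \<subseteq> {e \<in> topspace (link x). face x e \<in> U}"
        using V eV VU by blast
    qed
  qed blast
qed

section \<open>The sphere with generic points and its cone\<close>

definition gen_sphere :: "'o \<Rightarrow> (('o, 'm) bpoint, 'o set) strat" where
  "gen_sphere x = gen_strat (link x) (link_poset x) (face x) omega"

text \<open>The generic points leave no trace on the aster, so topological statements about it can
  be proved in the cone over the link itself.\<close>

lemma gen_sphere_topology:
  "subtopology (sspace (strat_cone (gen_sphere x))) (topspace (Cone x)) = Cone x"
proof -
  interpret generic_extension "link x" "link_poset x" "face x" omega by (rule generic_extension_link)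
  show ?thesis using subtopology_cone_gen_ext by (simp add: strat_cone_def gen_sphere_def gen_strat_def)
qed

lemma gen_sphere_subtopology:
  assumes "A \<subseteq> topspace (Cone x)"
  shows "subtopology (sspace (strat_cone (gen_sphere x))) A = subtopology (Cone x) A"
proof -
  have "topspace (Cone x) \<inter> A = A" using assms by blast
  then show ?thesis using subtopology_subtopology[of "sspace (strat_cone (gen_sphere x))" "topspace (Cone x)" A]
    by (simp add: gen_sphere_topology)
qed

lemma aster_cone: "aster (gen_sphere x) (topspace (Cone x))"
proof -
  have "topspace (subtopology (sspace (strat_cone (gen_sphere x))) (topspace (Cone x))) = topspace (Cone x)"
    by (simp only: gen_sphere_topology)
  then have sub: "topspace (Cone x) \<subseteq> topspace (sspace (strat_cone (gen_sphere x)))" by auto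
  have "cone_pt t' y \<in> topspace (Cone x)" if "t \<in> {0..1}" "t' \<in> {0..t}" "cone_pt t y \<in> topspace (Cone x)" for t t' y
  proof (cases "t' = 0")
    case True
    then show ?thesis using cone_pt_in_cone(2) by (simp add: cone_pt_def)
  next
    case False
    have "y \<in> topspace (link x)"
      using that(3) by (cases rule: cone_point_cases) (use that False in \<open>auto simp: cone_pt_def\<close>)
    then show ?thesis using cone_pt_in_cone(1)[of t' y "link x"] that by simp
  qed
  then show ?thesis using sub unfolding aster_def by blast
qed

lemma smap_gen_sphere:
  assumes "d \<in> topspace (Cone x)"
  shows "smap (strat_cone (gen_sphere x)) d =
    (case d of Tip \<Rightarrow> Apex | Ray t e \<Rightarrow> if t < 1 then Inner (face x e) else Base (face x e))"
proof -
  interpret generic_extension "link x" "link_poset x" "face x" omega by (rule generic_extension_link)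
  show ?thesis
    using assms by (cases rule: cone_point_cases) (simp_all add: strat_cone_def gen_sphere_def smap_gen_strat)
qed

lemma sposet_gen_sphere: "sposet (strat_cone (gen_sphere x)) = cone_poset (link_poset x)"
proof -
  interpret generic_extension "link x" "link_poset x" "face x" omega by (rule generic_extension_link)
  show ?thesis using face_poset_gen_strat by (simp add: strat_cone_def gen_sphere_def)
qed

text \<open>The support of the points in a stratum of the cone, regarded as points of the star: a
  parameter below 1 means that \<open>x\<close> has positive weight.\<close>

definition cone_supp :: "'o \<Rightarrow> 'o set cone_face \<Rightarrow> 'o set" where
  "cone_supp x k = (case k of Apex \<Rightarrow> {x} | Base a \<Rightarrow> a | Inner a \<Rightarrow> insert x a)"

lemma cone_supp_smap:
  assumes d: "d \<in> topspace (Cone x)"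
  shows "cone_supp x (smap (strat_cone (gen_sphere x)) d) = supp (fst (cone_data x d))"
  unfolding smap_gen_sphere[OF d] using d
proof (cases rule: cone_point_cases)
  case 1
  then show "cone_supp x (case d of Tip \<Rightarrow> Apex | Ray t e \<Rightarrow> if t < 1 then Inner (face x e) else Base (face x e)) = supp (fst (cone_data x d))"
    by (auto simp: cone_supp_def cone_data_def supp_def)
next
  case (2 t e)
  have z: "fst (data x e) x = 0" using 2(3) by (simp add: link_iff)
  have "0 < fst (cone_data x d) y \<longleftrightarrow> 0 < fst (data x e) y \<or> (y = x \<and> t < 1)" for y
    using z 2(1,2) by (auto simp: 2(4) cone_data_def zero_less_mult_iff)
  then show "cone_supp x (case d of Tip \<Rightarrow> Apex | Ray t e \<Rightarrow> if t < 1 then Inner (face x e) else Base (face x e)) = supp (fst (cone_data x d))"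
    using 2(2,4) by (auto simp: cone_supp_def supp_def face_def)
qed

lemma cone_supp_mono: "(k, k') \<in> cone_poset (link_poset x) \<Longrightarrow> cone_supp x k \<subseteq> cone_supp x k'"
  by (auto simp: cone_poset_def link_poset_def cone_supp_def)

text \<open>Faces of the link are nonempty and do not contain \<open>x\<close>. So
  \<open>{x}\<close>, \<open>a\<close> and \<open>insert x a\<close> reveal both the kind of stratum
  and the face.\<close>

lemma cone_supp_inj:
  assumes d: "d \<in> topspace (Cone x)" and d': "d' \<in> topspace (Cone x)"
    and eq: "cone_supp x (smap (strat_cone (gen_sphere x)) d) = cone_supp x (smap (strat_cone (gen_sphere x)) d')"
  shows "smap (strat_cone (gen_sphere x)) d = smap (strat_cone (gen_sphere x)) d'"
proof -
  have shape: "k = Apex \<or> (\<exists>a. (k = Inner a \<or> k = Base a) \<and> x \<notin> a \<and> a \<noteq> {})"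
    if k: "k = smap (strat_cone (gen_sphere x)) d" and d: "d \<in> topspace (Cone x)" for k d
    unfolding k smap_gen_sphere[OF d] using d by (cases rule: cone_point_cases) (use face_props in auto)
  show ?thesis
    using shape[OF refl d] shape[OF refl d'] eq by (auto simp: cone_supp_def)
qed

abbreviation "base x \<equiv> cone_pt 1 ` topspace (link x)"

definition cone_int :: "'o \<Rightarrow> ('o, 'm) bpoint cone_point set" where
  "cone_int x = {d \<in> topspace (Cone x). 0 < fst (cone_data x d) x}"

lemma aster_boundary_cone: "aster_boundary (topspace (Cone x)) = base x"
proof (intro equalityI subsetI)
  fix d assume d: "d \<in> aster_boundary (topspace (Cone x))"
  then obtain e where "d \<in> topspace (Cone x)" "d = Ray 1 e" by (auto simp: aster_boundary_def cone_pt_def)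
  then show "d \<in> base x"
    by (cases rule: cone_point_cases) (auto simp: cone_pt_def)
next
  fix d assume "d \<in> base x"
  then show "d \<in> aster_boundary (topspace (Cone x))"
    using cone_pt_in_cone(1)[of 1 _ "link x"] by (auto simp: aster_boundary_def)
qed

lemma aster_interior_cone: "aster_interior (topspace (Cone x)) = cone_int x"
proof (intro equalityI subsetI)
  fix d assume d: "d \<in> aster_interior (topspace (Cone x))"
  then have dc: "d \<in> topspace (Cone x)" "d \<notin> range (cone_pt 1)"
    by (auto simp: aster_interior_def aster_boundary_def)
  have "0 < fst (cone_data x d) x"
    using dc(1) unfolding cone_weight[OF dc(1)]
  proof (cases rule: cone_point_cases)
    case (2 t y)
    then have "t \<noteq> 1" using dc(2) by (auto simp: cone_pt_def)
    then show "0 < (case d of Tip \<Rightarrow> 1 | Ray s e \<Rightarrow> 1 - s)" using 2 by simp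
  qed simp
  then show "d \<in> cone_int x" using dc by (simp add: cone_int_def)
next
  fix d assume d: "d \<in> cone_int x"
  then have dc: "d \<in> topspace (Cone x)" by (simp add: cone_int_def)
  have "d \<noteq> cone_pt 1 e" for e
    using d cone_weight[OF dc] by (auto simp: cone_int_def cone_pt_def)
  then show "d \<in> aster_interior (topspace (Cone x))"
    using dc by (auto simp: aster_interior_def aster_boundary_def)
qed

text \<open>On the interior \<open>x\<close> belongs to the support, so dropping the mark loses no
  morphisms and \<open>phi x\<close> is injective. The interior is a full preimage because it is
  characterized by the top object of the image.\<close>

lemma homeomorphic_phi:
  assumes x: "x \<in> Ob"
  shows "homeomorphic_map (subtopology (Cone x) (cone_int x)) (subtopology BC (cell x)) (phi x)"
proof -
  have img: "phi x ` cone_int x = cell x"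
  proof (intro equalityI subsetI)
    fix b assume "b \<in> phi x ` cone_int x"
    then show "b \<in> cell x" using phi_in[OF x] top_obj_phi(2)[OF x] by (auto simp: cell_def cone_int_def)
  next
    fix b assume b: "b \<in> cell x"
    then have "b \<in> {b \<in> topspace BC. (top_obj b, x) \<in> leq}" using leq_refl[OF x] by (auto simp: cell_def)
    then obtain d where "d \<in> topspace (Cone x)" "b = phi x d" unfolding phi_image[OF x, symmetric] by blast
    then show "b \<in> phi x ` cone_int x" using b top_obj_phi(2)[OF x] by (auto simp: cell_def cone_int_def)
  qed
  have "homeomorphic_map (subtopology (Cone x) (cone_int x)) (subtopology BC (phi x ` cone_int x)) (phi x)"
  proof (rule compact_Hausdorff_restriction)
    show "inj_on (phi x) (cone_int x)"
    proof (rule inj_onI)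
      fix d d' assume d: "d \<in> cone_int x" and d': "d' \<in> cone_int x" and eq: "phi x d = phi x d'"
      have dc: "d \<in> topspace (Cone x)" "d' \<in> topspace (Cone x)" using d d' by (simp_all add: cone_int_def)
      have full: "snd (bdata (phi x a)) = snd (cone_data x a)" if a: "a \<in> cone_int x" for a
      proof -
        have ac: "a \<in> topspace (Cone x)" and "x \<in> supp (fst (cone_data x a))"
          using a by (simp_all add: cone_int_def supp_def)
        then have "src C f \<in> supp (fst (cone_data x a)) \<and> tgt C f \<in> supp (fst (cone_data x a))"
          if "f \<in> snd (cone_data x a)" for f
          using data_mor(2,3)[OF join_in_star[OF x ac], of f] that data_join[OF x ac] by auto
        then show ?thesis unfolding bdata_phi(2)[OF x ac] by blast
      qed
      have "cone_data x d = cone_data x d'"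
        using full[OF d] full[OF d'] bdata_phi(1)[OF x dc(1)] bdata_phi(1)[OF x dc(2)] eq by (simp add: prod_eq_iff)
      then have "join x d = join x d'" by (simp add: join_def)
      then show "d = d'" using inj_onD[OF inj_join[OF x]] dc by blast
    qed
    fix d assume "d \<in> topspace (Cone x)" "phi x d \<in> phi x ` cone_int x"
    then show "d \<in> cone_int x" unfolding img using top_obj_phi(2)[OF x] by (simp add: cell_def cone_int_def)
  qed (use x continuous_phi compact_space_cone compact_space_link Hausdorff_classifying_space in \<open>auto simp: cone_int_def\<close>)
  then show ?thesis by (simp add: img)
qed

text \<open>In \<open>bmap\<close> the map \<open>join m\<close> translates from cones, in which
  asters have to lie, to stars, on which attaching is defined. The result lies in the link of
  \<open>l\<close>, that is, at parameter 1 of the next cone.\<close>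

definition BX :: "(('o, 'm) bpoint, 'o, ('o, 'm) bpoint, 'o set, 'm) cyl" where
  "BX = \<lparr>sspace = BC, sposet = leq, smap = top_obj, sph = gen_sphere,
     ast = (\<lambda>x. topspace (Cone x)), char_map = phi, par = HomT,
     bmap = (\<lambda>m l (f, d). cone_pt 1 (attach m l f (join m d))),
     cmap = (\<lambda>_ _ _ (g, f). cmp C g f)\<rparr>"

lemma BX_simps [simp]:
  "sspace BX = BC" "sposet BX = leq" "smap BX = top_obj" "sph BX = gen_sphere"
  "ast BX x = topspace (Cone x)" "char_map BX = phi" "par BX = HomT"
  "bmap BX m l (f, d) = cone_pt 1 (attach m l f (join m d))"
  "cmap BX l0 l1 l2 (g, f) = cmp C g f"
  by (simp_all add: BX_def)

lemma Mo_Hom [simp]: "Mo \<inter> Hom C m l = Hom C m l"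
  by (auto simp: Hom_iff)

lemma topspace_HomT: "topspace (HomT m l) = Hom C m l"
  by simp

lemma stratum_BX: "stratum BX l = cell l"
  by (simp add: stratum_def cell_def)

lemma vertex_cell: "x \<in> Ob \<Longrightarrow> phi x Tip \<in> cell x"
  using phi_Tip_top phi_in[OF _ cone_pt_in_cone(2)] by (simp add: cell_def)

lemma faces_BX: "faces BX = Ob"
proof (intro equalityI subsetI)
  fix x assume "x \<in> Ob"
  then show "x \<in> faces BX" using vertex_cell by (force simp: faces_def cell_def)
qed (auto simp: faces_def top_obj_props)

lemma closed_stratum_BX: "x \<in> Ob \<Longrightarrow> closed_stratum BX x = {b \<in> topspace BC. (top_obj b, x) \<in> leq}"
  by (simp add: closed_stratum_def stratum_BX closure_cell)

lemma stratum_boundary_BX: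
  "x \<in> Ob \<Longrightarrow> stratum_boundary BX x = {b \<in> topspace BC. (top_obj b, x) \<in> leq \<and> top_obj b \<noteq> x}"
  by (auto simp: stratum_boundary_def closed_stratum_BX stratum_BX cell_def)

lemma cl_face_BX: "cl_face BX m l \<longleftrightarrow> (m, l) \<in> leq"
proof
  assume "cl_face BX m l"
  then have "m \<in> Ob" "l \<in> Ob" "cell m \<subseteq> closed_stratum BX l"
    by (simp_all add: cl_face_def faces_BX stratum_BX)
  then show "(m, l) \<in> leq" using vertex_cell[of m] by (auto simp: closed_stratum_BX cell_def)
next
  assume ml: "(m, l) \<in> leq"
  then have "m \<in> Ob" "l \<in> Ob" using leq_in by blast+
  then show "cl_face BX m l" using ml by (auto simp: cl_face_def faces_BX stratum_BX closed_stratum_BX cell_def)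
qed

lemma bd_face_BX: "bd_face BX m l \<longleftrightarrow> (m, l) \<in> leq \<and> m \<noteq> l"
proof
  assume "bd_face BX m l"
  then have "m \<in> Ob" "l \<in> Ob" "cell m \<subseteq> stratum_boundary BX l"
    by (simp_all add: bd_face_def faces_BX stratum_BX)
  then show "(m, l) \<in> leq \<and> m \<noteq> l" using vertex_cell[of m] by (auto simp: stratum_boundary_BX cell_def)
next
  assume ml: "(m, l) \<in> leq \<and> m \<noteq> l"
  then have "m \<in> Ob" "l \<in> Ob" using leq_in by blast+
  then show "bd_face BX m l" using ml by (auto simp: bd_face_def faces_BX stratum_BX stratum_boundary_BX cell_def)
qed

lemma face_poset_BX: "face_poset BX = leq"
  using leq_in by (auto simp: face_poset_def faces_BX)

lemma stratified_space_BX: "stratified_space BX"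
  unfolding stratified_space_def faces_BX stratum_BX
proof (intro conjI ballI)
  fix l assume l: "l \<in> Ob"
  show "connectedin (sspace BX) (cell l)" using connectedin_cell[OF l] by simp
  show "locally_closedin (sspace BX) (cell l)"
    using locally_closedin_alexandroff_fibre[OF continuous_top_obj Partial_order_leq] l
    by (simp add: Field_leq cell_def)
qed (simp_all add: Partial_order_leq continuous_top_obj open_map_top_obj)

lemma normal_BX: "normal_stratification BX"
  unfolding normal_stratification_def faces_BX stratum_BX
  by (auto simp: closed_stratum_BX cell_def)

abbreviation "kind x d \<equiv> smap (strat_cone (gen_sphere x)) d"

lemma ast_strat_BX: "sspace (ast_strat BX x) = Cone x" "sposet (ast_strat BX x) = cone_poset (link_poset x)"
    "smap (ast_strat BX x) = kind x"
  by (simp_all add: ast_strat_def substrat_def gen_sphere_topology sposet_gen_sphere)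

lemma ast_int_strat_BX: "sspace (ast_int_strat BX x) = subtopology (Cone x) (cone_int x)"
    "smap (ast_int_strat BX x) = kind x"
  by (simp_all add: ast_int_strat_def substrat_def aster_interior_cone gen_sphere_subtopology cone_int_def)

lemma base_sub: "base x \<subseteq> topspace (Cone x)"
  using cone_pt_in_cone(1)[of 1 _ "link x"] by auto

lemma ast_bd_strat_BX: "sspace (ast_bd_strat BX x) = subtopology (Cone x) (base x)"
    "sposet (ast_bd_strat BX x) = cone_poset (link_poset x)" "smap (ast_bd_strat BX x) = kind x"
  by (simp_all add: ast_bd_strat_def substrat_def aster_boundary_cone gen_sphere_subtopology[OF base_sub] sposet_gen_sphere)

definition top_set :: "'o set \<Rightarrow> 'o" where
  "top_set a = (THE y. y \<in> a \<and> (\<forall>z\<in>a. (z, y) \<in> leq))"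

lemma top_obj_set: "top_obj b = top_set (supp (fst (bdata b)))"
  by (simp add: top_obj_def top_of_def top_set_def)

lemma top_set_kind:
  assumes "x \<in> Ob" "d \<in> topspace (Cone x)"
  shows "top_set (cone_supp x (kind x d)) = top_obj (phi x d)"
  unfolding cone_supp_smap[OF assms(2)] top_obj_set bdata_phi(1)[OF assms] ..

lemma stellar_BX:
  assumes x: "x \<in> Ob"
  shows "stellar_structure_at BX x"
  unfolding stellar_structure_at_def
proof (intro conjI)
  have "generic_extension (link x) (link_poset x) (face x) omega" by (rule generic_extension_link)
  then show "stratified_space (sph BX x)"
    using generic_extension.stratified_space_gen_strat by (fastforce simp: gen_sphere_def)
  show "aster (sph BX x) (ast BX x)" using aster_cone by simp
  have sub: "closed_stratum BX x \<subseteq> topspace BC" by (auto simp: closed_stratum_BX[OF x])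
  have img: "phi x ` topspace (Cone x) = topspace (subtopology BC (closed_stratum BX x))"
    using phi_image[OF x] closed_stratum_BX[OF x] by auto
  have cont: "continuous_map (Cone x) (subtopology BC (closed_stratum BX x)) (phi x)"
    using continuous_phi[OF x] phi_image[OF x] by (auto simp: continuous_map_in_subtopology closed_stratum_BX[OF x])
  have q: "quotient_map (Cone x) (subtopology BC (closed_stratum BX x)) (phi x)"
    using cont compact_space_cone[OF compact_space_link[OF x]] img Hausdorff_classifying_space
    by (intro T1_Spaces.continuous_imp_quotient_map) (auto intro: Hausdorff_space_subtopology)
  then show "quotient_map (sspace (ast_strat BX x)) (subtopology (sspace BX) (closed_stratum BX x)) (char_map BX x)"
    by (simp add: ast_strat_BX)
  show "homeomorphic_map (sspace (ast_int_strat BX x)) (subtopology (sspace BX) (stratum BX x)) (char_map BX x)"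
    using homeomorphic_phi[OF x] by (simp add: ast_int_strat_BX stratum_BX)
  show "strat_morphism (ast_strat BX x) (substrat BX (closed_stratum BX x)) (char_map BX x)"
    unfolding strat_morphism_def
  proof (intro exI)
    \<comment> \<open>The stratum of a cone point determines its support, and the top of the support
      names the cell of the image. Order is preserved since a larger support has a larger
      top.\<close>
    let ?p = "\<lambda>k. top_set (cone_supp x k)"
    show "strat_morphism_over (ast_strat BX x) (substrat BX (closed_stratum BX x)) (char_map BX x) ?p"
      unfolding strat_morphism_over_def
    proof (intro conjI allI impI ballI)
      show "continuous_map (sspace (ast_strat BX x)) (sspace (substrat BX (closed_stratum BX x))) (char_map BX x)"
        using cont by (simp add: ast_strat_BX substrat_def)
      show "smap (substrat BX (closed_stratum BX x)) (char_map BX x d) = ?p (smap (ast_strat BX x) d)"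
        if "d \<in> topspace (sspace (ast_strat BX x))" for d
        using that top_set_kind[OF x] by (simp add: ast_strat_BX substrat_def)
      fix k k' assume kk: "(k, k') \<in> face_poset (ast_strat BX x)"
      then obtain d d' where d: "d \<in> topspace (Cone x)" "k = kind x d" and d': "d' \<in> topspace (Cone x)" "k' = kind x d'"
        by (auto simp: face_poset_def faces_def ast_strat_BX)
      have "cone_supp x k \<subseteq> cone_supp x k'"
        using kk by (intro cone_supp_mono) (simp add: face_poset_def ast_strat_BX)
      then have "supp (fst (bdata (phi x d))) \<subseteq> supp (fst (bdata (phi x d')))"
        unfolding d(2) d'(2) cone_supp_smap[OF d(1)] cone_supp_smap[OF d'(1)] bdata_phi(1)[OF x d(1)] bdata_phi(1)[OF x d'(1)] .
      then have "(top_obj (phi x d), top_obj (phi x d')) \<in> leq"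
        using top_obj_props(2)[OF phi_in[OF x d(1)]] top_obj_props(3)[OF phi_in[OF x d'(1)]] by blast
      moreover have "top_obj (phi x a) \<in> faces (substrat BX (closed_stratum BX x))" if "a \<in> topspace (Cone x)" for a
      proof -
        have "phi x a \<in> topspace (subtopology BC (closed_stratum BX x))" using img that by blast
        then show ?thesis by (simp add: faces_def substrat_def)
      qed
      ultimately show "(?p k, ?p k') \<in> face_poset (substrat BX (closed_stratum BX x))"
        unfolding d(2) d'(2) top_set_kind[OF x d(1)] top_set_kind[OF x d'(1)] face_poset_def
        using d(1) d'(1) by (simp add: substrat_def)
    qed
  qed
qed

lemma stellar_stratified_space_BX: "stellar_stratified_space BX"
  unfolding stellar_stratified_space_def
proof (intro conjI ballI)
  fix l assume "l \<in> faces BX"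
  then have l: "l \<in> Ob" by (simp add: faces_BX)
  show "stellar_structure_at BX l" by (rule stellar_BX[OF l])
  show "stratum_boundary BX l \<subseteq> (\<Union>m\<in>{m. (m, l) \<in> face_poset BX \<and> m \<noteq> l}. stratum BX m)"
    by (auto simp: stratum_boundary_BX[OF l] face_poset_BX stratum_BX cell_def)
qed (rule stratified_space_BX)

section \<open>The cylindrical structure\<close>

lemma join_base:
  assumes "e \<in> topspace (link l)"
  shows "join l (cone_pt 1 e) = e"
proof -
  have "cone_data l (cone_pt 1 e) = data l e" by (simp add: cone_data_def cone_pt_def fun_eq_iff prod_eq_iff)
  then show ?thesis using point_data assms by (simp add: join_def link_iff)
qed

lemma kind_base: "e \<in> topspace (link l) \<Longrightarrow> kind l (cone_pt 1 e) = Base (face l e)"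
  using smap_gen_sphere[of "cone_pt 1 e" l] cone_pt_in_cone(1)[of 1 e "link l"] by (simp add: cone_pt_def)

lemma Hausdorff_Cone:
  assumes "x \<in> Ob"
  shows "Hausdorff_space (Cone x)"
  using homeomorphic_Hausdorff_space homeomorphic_map_imp_homeomorphic_space[OF homeomorphic_join[OF assms]] Hausdorff_star
  by blast

context
  fixes m l :: 'o
  assumes ml: "(m, l) \<in> leq" "m \<noteq> l"
begin

lemma m_in: "m \<in> Ob" and l_in: "l \<in> Ob"
  using leq_in[OF ml(1)] by blast+

lemma bmap_props:
  assumes f: "f \<in> Hom C m l" and d: "d \<in> topspace (Cone m)"
  shows "attach m l f (join m d) \<in> topspace (link l)"
    "bmap BX m l (f, d) \<in> base l"
    "kind l (bmap BX m l (f, d)) = Base (cone_supp m (kind m d))"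
    "join l (bmap BX m l (f, d)) = attach m l f (join m d)"
proof -
  have j: "join m d \<in> topspace (star m)" by (rule join_in_star[OF m_in d])
  show a: "attach m l f (join m d) \<in> topspace (link l)" by (rule attach_in_link[OF f ml(2) j])
  then show "bmap BX m l (f, d) \<in> base l" by simp
  show "join l (bmap BX m l (f, d)) = attach m l f (join m d)" using join_base[OF a] by simp
  have "face l (attach m l f (join m d)) = cone_supp m (kind m d)"
    unfolding face_def cone_supp_smap[OF d] fst_data_attach[OF f ml(2) j] data_join[OF m_in d] ..
  then show "kind l (bmap BX m l (f, d)) = Base (cone_supp m (kind m d))" using kind_base[OF a] by simp
qed

lemma continuous_bmap: "continuous_map (prod_topology (HomT m l) (Cone m)) (Cone l) (bmap BX m l)"
proof -
  have "continuous_map (prod_topology (HomT m l) (Cone m)) (prod_topology (HomT m l) (star m)) (\<lambda>a. (fst a, join m (snd a)))"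
    unfolding continuous_map_paired
    using continuous_map_fst continuous_map_compose[OF continuous_map_snd continuous_join[OF m_in]] by (auto simp: o_def)
  from continuous_map_compose[OF this continuous_attach[OF ml]]
  have 1: "continuous_map (prod_topology (HomT m l) (Cone m)) (link l) (\<lambda>a. attach m l (fst a) (join m (snd a)))"
    by (simp add: o_def)
  have "continuous_map (link l) (prod_topology (top_of_set {0..1::real}) (link l)) (\<lambda>e. (1, e))"
    by (simp add: continuous_map_paired)
  from continuous_map_compose[OF continuous_map_compose[OF 1 this] continuous_map_cone_pt]
  have "continuous_map (prod_topology (HomT m l) (Cone m)) (Cone l) (\<lambda>a. cone_pt 1 (attach m l (fst a) (join m (snd a))))"
    by (simp add: o_def)
  moreover have "bmap BX m l = (\<lambda>a. cone_pt 1 (attach m l (fst a) (join m (snd a))))"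
    by (auto simp: fun_eq_iff)
  ultimately show ?thesis by simp
qed

lemma continuous_bmap_base:
  "continuous_map (prod_topology (HomT m l) (Cone m)) (subtopology (Cone l) (base l)) (bmap BX m l)"
proof (rule continuous_map_into_subtopology[OF continuous_bmap], rule Pi_I)
  fix a assume "a \<in> topspace (prod_topology (HomT m l) (Cone m))"
  then obtain f d where "a = (f, d)" "f \<in> Hom C m l" "d \<in> topspace (Cone m)" by (cases a) auto
  then show "bmap BX m l a \<in> base l" using bmap_props(2) by blast
qed

text \<open>Attaching keeps weights, so the weight of \<open>m\<close> tells whether a point of the
  image comes from the interior; this makes the interior part saturated. Injectivity there is
  \<open>attach_inj\<close>.\<close>

lemma embedding_bmap:
  "embedding_map (prod_topology (HomT m l) (subtopology (Cone m) (cone_int m)))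
     (subtopology (Cone l) (base l)) (bmap BX m l)"
proof -
  let ?X = "prod_topology (HomT m l) (Cone m)" and ?A = "Hom C m l \<times> cone_int m"
  have X: "prod_topology (HomT m l) (subtopology (Cone m) (cone_int m)) = subtopology ?X ?A"
    by (simp add: prod_topology_subtopology)
  have A: "?A \<subseteq> topspace ?X" by (auto simp: cone_int_def)
  have weight: "fst (data l (join l (bmap BX m l (f, d)))) m = fst (cone_data m d) m"
    if "f \<in> Hom C m l" "d \<in> topspace (Cone m)" for f d
    unfolding bmap_props(4)[OF that] fst_data_attach[OF that(1) ml(2) join_in_star[OF m_in that(2)]] data_join[OF m_in that(2)] ..
  have "homeomorphic_map (subtopology ?X ?A)
      (subtopology (subtopology (Cone l) (base l)) (bmap BX m l ` ?A)) (bmap BX m l)"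
  proof (rule compact_Hausdorff_restriction[OF _ _ continuous_bmap_base A])
    show "compact_space ?X"
      using compact_Hausdorff_Hom[OF m_in l_in] compact_space_cone[OF compact_space_link[OF m_in]]
      by (simp add: compact_space_prod_topology)
    show "Hausdorff_space (subtopology (Cone l) (base l))"
      by (intro Hausdorff_space_subtopology Hausdorff_Cone l_in)
    show "inj_on (bmap BX m l) ?A"
    proof (rule inj_onI, clarify)
      fix f d f' d' assume f: "f \<in> Hom C m l" "f' \<in> Hom C m l" and d: "d \<in> cone_int m" "d' \<in> cone_int m"
        and eq: "bmap BX m l (f, d) = bmap BX m l (f', d')"
      have dc: "d \<in> topspace (Cone m)" "d' \<in> topspace (Cone m)" using d by (simp_all add: cone_int_def)
      have "attach m l f (join m d) = attach m l f' (join m d')"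
        using bmap_props(4)[OF f(1) dc(1)] bmap_props(4)[OF f(2) dc(2)] eq by metis
      moreover have "0 < fst (data m (join m d)) m" using d(1) data_join[OF m_in dc(1)] by (simp add: cone_int_def)
      ultimately have "f = f' \<and> join m d = join m d'"
        by (intro attach_inj[OF f ml(2) join_in_star[OF m_in dc(1)] join_in_star[OF m_in dc(2)]])
      then show "f = f' \<and> d = d'" using inj_onD[OF inj_join[OF m_in]] dc by blast
    qed
    fix a assume a: "a \<in> topspace ?X" "bmap BX m l a \<in> bmap BX m l ` ?A"
    obtain f d where fd: "a = (f, d)" "f \<in> Hom C m l" "d \<in> topspace (Cone m)" using a(1) by (cases a) auto
    obtain f' d' where fd': "bmap BX m l (f, d) = bmap BX m l (f', d')" "f' \<in> Hom C m l" "d' \<in> cone_int m"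
      using a(2) unfolding fd(1) by blast
    have "d' \<in> topspace (Cone m)" using fd'(3) by (simp add: cone_int_def)
    then have "fst (cone_data m d) m = fst (cone_data m d') m"
      using weight[OF fd(2,3)] weight[OF fd'(2)] fd'(1) by metis
    then show "a \<in> ?A" using fd fd'(3) by (simp add: cone_int_def)
  qed
  moreover have "topspace (subtopology ?X ?A) = ?A" using A by auto
  ultimately show ?thesis unfolding embedding_map_def X by simp
qed

text \<open>Attaching keeps the support, which determines the stratum in both cones: on the base of
  the larger one by \<open>bmap_props\<close>, in the smaller one by \<open>cone_supp_inj\<close>.
  So each stratum is mapped onto an entire stratum of the image.\<close>

lemma strict_bmap:
  "strict_morphism (cylinder (par BX m l) (ast_strat BX m))
     (substrat (ast_bd_strat BX l) (bmap BX m l ` (topspace (par BX m l) \<times> ast BX m))) (bmap BX m l)"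
proof -
  let ?im = "bmap BX m l ` (Hom C m l \<times> topspace (Cone m))"
  let ?Y = "substrat (ast_bd_strat BX l) ?im"
  let ?X = "cylinder (HomT m l) (ast_strat BX m)"
  have imb: "?im \<subseteq> base l" using bmap_props(2) by auto
  have Y: "sspace ?Y = subtopology (subtopology (Cone l) (base l)) ?im"
    "sposet ?Y = cone_poset (link_poset l)" "smap ?Y = kind l"
    by (simp_all add: substrat_def ast_bd_strat_BX)
  have topY: "topspace (sspace ?Y) = ?im" using imb base_sub[of l] unfolding Y by auto
  have X: "sspace ?X = prod_topology (HomT m l) (Cone m)" "sposet ?X = cone_poset (link_poset m)" "smap ?X = kind m \<circ> snd"
    by (simp_all add: cylinder_def ast_strat_BX)
  have topX: "topspace (sspace ?X) = Hom C m l \<times> topspace (Cone m)" by (simp add: X)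
  let ?p = "\<lambda>k. Base (cone_supp m k)"
  have over: "strat_morphism_over ?X ?Y (bmap BX m l) ?p"
    unfolding strat_morphism_over_def
  proof (intro conjI allI impI ballI)
    show "continuous_map (sspace ?X) (sspace ?Y) (bmap BX m l)"
      unfolding X Y by (rule continuous_map_into_subtopology[OF continuous_bmap_base]) auto
    show sm: "smap ?Y (bmap BX m l a) = ?p (smap ?X a)" if "a \<in> topspace (sspace ?X)" for a
      using that bmap_props(3) unfolding topX by (auto simp: X Y simp del: BX_simps)
    fix k k' assume kk: "(k, k') \<in> face_poset ?X"
    then obtain a a' where a: "a \<in> topspace (sspace ?X)" "k = smap ?X a" and a': "a' \<in> topspace (sspace ?X)" "k' = smap ?X a'"
      unfolding face_poset_def faces_def by blast
    have fY: "?p (smap ?X b) \<in> faces ?Y \<and> cone_supp m (smap ?X b) \<in> face l ` topspace (link l)"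
      if b: "b \<in> topspace (sspace ?X)" for b
    proof -
      obtain f d where fd: "b = (f, d)" "f \<in> Hom C m l" "d \<in> topspace (Cone m)" using b unfolding topX by blast
      have "bmap BX m l b \<in> topspace (sspace ?Y)" using b unfolding topX topY by blast
      then have 1: "?p (smap ?X b) \<in> faces ?Y" unfolding faces_def sm[OF b, symmetric] by (rule imageI)
      have "kind l (bmap BX m l (f, d)) = Base (face l (attach m l f (join m d)))"
        using kind_base[OF bmap_props(1)[OF fd(2,3)]] by simp
      then have "face l (attach m l f (join m d)) = cone_supp m (kind m d)"
        using bmap_props(3)[OF fd(2,3)] by simp
      moreover have "smap ?X b = kind m d" by (simp add: X(3) fd(1))
      ultimately have "cone_supp m (smap ?X b) \<in> face l ` topspace (link l)"
        by (intro image_eqI[OF _ bmap_props(1)[OF fd(2,3)]]) simp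
      then show ?thesis using 1 by blast
    qed
    have "cone_supp m k \<subseteq> cone_supp m k'"
      using kk by (intro cone_supp_mono) (simp add: face_poset_def X)
    then have "(?p k, ?p k') \<in> cone_poset (link_poset l)"
      using fY[OF a(1)] fY[OF a'(1)] a(2) a'(2) by (auto simp: cone_poset_def link_poset_def)
    then show "(?p k, ?p k') \<in> face_poset ?Y"
      using fY[OF a(1)] fY[OF a'(1)] a(2) a'(2) by (simp add: face_poset_def Y)
  qed
  have "bmap BX m l ` stratum ?X k = stratum ?Y (?p k)" if k: "k \<in> faces ?X" for k
  proof (intro equalityI subsetI)
    fix z assume "z \<in> bmap BX m l ` stratum ?X k"
    then obtain a where a: "a \<in> topspace (sspace ?X)" "smap ?X a = k" "z = bmap BX m l a"
      unfolding stratum_def by blast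
    then have "z \<in> topspace (sspace ?Y)" unfolding topX topY by blast
    moreover have "smap ?Y z = ?p k" using over a unfolding strat_morphism_over_def by blast
    ultimately show "z \<in> stratum ?Y (?p k)" unfolding stratum_def by blast
  next
    fix z assume z: "z \<in> stratum ?Y (?p k)"
    then have "z \<in> ?im" "kind l z = ?p k" unfolding stratum_def topY Y(3) by blast+
    then obtain f d where fd: "f \<in> Hom C m l" "d \<in> topspace (Cone m)" "z = bmap BX m l (f, d)" by blast
    obtain d0 where d0: "d0 \<in> topspace (Cone m)" "k = kind m d0"
      using k unfolding faces_def topX X(3) by auto
    have "cone_supp m (kind m d) = cone_supp m (kind m d0)"
      using \<open>kind l z = ?p k\<close> bmap_props(3)[OF fd(1,2)] fd(3) d0(2) by simp
    then have "kind m d = k" using cone_supp_inj[OF fd(2) d0(1)] d0(2) by simp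
    then have "(f, d) \<in> stratum ?X k" unfolding stratum_def topX X(3) using fd(1,2) by simp
    then show "z \<in> bmap BX m l ` stratum ?X k" using fd(3) by blast
  qed
  then have "strict_morphism ?X ?Y (bmap BX m l)"
    unfolding strict_morphism_def using over by blast
  then show ?thesis by simp
qed

end

section \<open>Strata of the boundary of a cone\<close>

lemma base_covered:
  assumes z: "z \<in> base l"
  obtains m f d where "(m, l) \<in> leq" "m \<noteq> l" "f \<in> Hom C m l" "d \<in> cone_int m" "bmap BX m l (f, d) = z"
    "kind l z = Base (cone_supp m (kind m d))" "m = top_set (cone_supp m (kind m d))"
proof -
  obtain e where e: "e \<in> topspace (link l)" "z = cone_pt 1 e" using z by blast
  let ?m = "top_obj (chr l e)"
  obtain f e' where f: "f \<in> Hom C ?m l" "?m \<noteq> l" "e' \<in> topspace (star ?m)" "0 < fst (data ?m e') ?m" "attach ?m l f e' = e"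
    using link_covered[OF e(1)] .
  have ml: "(?m, l) \<in> leq" by (rule leqI[OF f(1)])
  have m: "?m \<in> Ob" using leq_in[OF ml] by blast
  obtain d where d: "d \<in> topspace (Cone ?m)" "join ?m d = e'" using join_surj[OF m f(3)] .
  have di: "d \<in> cone_int ?m" using f(4) d data_join[OF m d(1)] by (simp add: cone_int_def)
  have b: "bmap BX ?m l (f, d) = z" using d(2) f(5) e(2) by simp
  have k: "kind l z = Base (cone_supp ?m (kind ?m d))" using bmap_props(3)[OF ml f(2) f(1) d(1)] b by simp
  have "top_set (cone_supp ?m (kind ?m d)) = ?m"
    unfolding top_set_kind[OF m d(1)] using top_obj_phi(2)[OF m d(1)] di by (simp add: cone_int_def)
  then show ?thesis using that[OF ml f(2) f(1) di b k] by simp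
qed

text \<open>The stratum of \<open>z\<close> determines its support, and the top of the support is
  the object \<open>m'\<close> whose star covers \<open>z\<close>. Hence \<open>m' = m\<close>, and
  the piece of the boundary that belongs to \<open>m\<close> contains this stratum entirely.\<close>

lemma stratum_base:
  assumes ml: "(m, l) \<in> leq" "m \<noteq> l" and k: "k \<in> kind m ` cone_int m"
  shows "bmap BX m l ` {(f, d). f \<in> Hom C m l \<and> d \<in> cone_int m \<and> kind m d = k} =
    {z \<in> base l. kind l z = Base (cone_supp m k)}"
proof (intro equalityI subsetI)
  fix z assume "z \<in> bmap BX m l ` {(f, d). f \<in> Hom C m l \<and> d \<in> cone_int m \<and> kind m d = k}"
  then obtain f d where fd: "f \<in> Hom C m l" "d \<in> cone_int m" "kind m d = k" "z = bmap BX m l (f, d)" by blast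
  then show "z \<in> {z \<in> base l. kind l z = Base (cone_supp m k)}"
    using bmap_props(2,3)[OF ml fd(1)] by (simp add: cone_int_def del: BX_simps)
next
  fix z assume z: "z \<in> {z \<in> base l. kind l z = Base (cone_supp m k)}"
  obtain m' f d where m': "(m', l) \<in> leq" "m' \<noteq> l" and fd: "f \<in> Hom C m' l" "d \<in> cone_int m'" "bmap BX m' l (f, d) = z"
    "kind l z = Base (cone_supp m' (kind m' d))" "m' = top_set (cone_supp m' (kind m' d))"
    using base_covered z by blast
  have m: "m \<in> Ob" using leq_in[OF ml(1)] by blast
  obtain d0 where d0: "d0 \<in> cone_int m" "k = kind m d0" using k by blast
  have d0c: "d0 \<in> topspace (Cone m)" using d0 by (simp add: cone_int_def)
  have eq: "cone_supp m' (kind m' d) = cone_supp m k" using z fd(4) by simp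
  have "top_set (cone_supp m k) = m"
    unfolding d0(2) top_set_kind[OF m d0c] using top_obj_phi(2)[OF m d0c] d0(1) by (simp add: cone_int_def)
  then have mm: "m' = m" using fd(5) eq by simp
  have dc: "d \<in> topspace (Cone m)" using fd(2) mm by (simp add: cone_int_def)
  have "kind m d = k" using cone_supp_inj[OF dc d0c] eq mm d0(2) by simp
  then show "z \<in> bmap BX m l ` {(f, d). f \<in> Hom C m l \<and> d \<in> cone_int m \<and> kind m d = k}"
    using fd mm by blast
qed

lemma continuous_cmp_Hom:
  "continuous_map (prod_topology (HomT l1 l2) (HomT l0 l1)) (HomT l0 l2) (cmap BX l0 l1 l2)"
proof (rule continuous_map_into_subtopology)
  have "continuous_map (prod_topology (HomT l1 l2) (HomT l0 l1)) (prod_topology (Mor C) (Mor C)) (\<lambda>a. (fst a, snd a))"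
    unfolding continuous_map_paired
    using continuous_map_into_fulltopology[OF continuous_map_fst] continuous_map_into_fulltopology[OF continuous_map_snd] by blast
  moreover have "(\<lambda>a. (fst a, snd a)) \<in> topspace (prod_topology (HomT l1 l2) (HomT l0 l1)) \<rightarrow> {(g, f). src C g = tgt C f}"
    by (auto simp: Hom_iff)
  ultimately have "continuous_map (prod_topology (HomT l1 l2) (HomT l0 l1))
      (subtopology (prod_topology (Mor C) (Mor C)) {(g, f). src C g = tgt C f}) (\<lambda>a. (fst a, snd a))"
    by (rule continuous_map_into_subtopology)
  from continuous_map_compose[OF this continuous_cmp]
  show "continuous_map (prod_topology (HomT l1 l2) (HomT l0 l1)) (Mor C) (cmap BX l0 l1 l2)"
    by (rule continuous_map_eq) auto
  show "cmap BX l0 l1 l2 \<in> topspace (prod_topology (HomT l1 l2) (HomT l0 l1)) \<rightarrow> Hom C l0 l2"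
    using cmp_Hom by auto
qed

lemma bmap_comp:
  assumes q: "q \<in> Hom C l1 l2" and p: "p \<in> Hom C l0 l1" and d: "d \<in> topspace (Cone l0)"
  shows "bmap' BX l1 l2 (q, bmap' BX l0 l1 (p, d)) = bmap' BX l0 l2 (cmap BX l0 l1 l2 (q, p), d)"
proof -
  have qM: "q \<in> Mo" "src C q = l1" "tgt C q = l2" and pM: "p \<in> Mo" "src C p = l0" "tgt C p = l1"
    using p q by (simp_all add: Hom_iff)
  \<comment> \<open>On the diagonal \<open>bmap'\<close> is the projection, and the parameter there
    can only be an identity, so composing with it changes nothing.\<close>
  consider "l0 = l1" | "l0 \<noteq> l1" "l1 = l2" | "l0 \<noteq> l1" "l1 \<noteq> l2" by blast
  then show ?thesis
  proof cases
    case 1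
    then have "p = ident C l0" using endo_ident pM by blast
    then have "cmp C q p = q" using cmp_ident_right qM 1 by simp
    then show ?thesis using 1 by (simp add: bmap'_def)
  next
    case 2
    then have "q = ident C l1" using endo_ident qM by blast
    then have "cmp C q p = p" using cmp_ident_left pM by simp
    then show ?thesis using 2 by (simp add: bmap'_def)
  next
    case 3
    have l01: "(l0, l1) \<in> leq" and l12: "(l1, l2) \<in> leq" using p q leqI by blast+
    have "l0 \<noteq> l2" using l01 l12 leq_antisym 3 by blast
    then show ?thesis
      using 3 bmap_props(4)[OF l01 3(1) p d] attach_attach[OF p 3(1) q 3(2) join_in_star[OF _ d]] leq_in[OF l01]
      by (simp add: bmap'_def)
  qed
qed

lemma cylindrical_BX: "cylindrical_structure BX"
proof -
  have 1: "\<exists>p. topspace (par BX l l) = {p}" if "l \<in> Ob" for l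
  proof -
    have "Hom C l l = {ident C l}" using acyclic that by (simp add: acyclic_category_def)
    then show ?thesis unfolding BX_simps(7) topspace_HomT by blast
  qed
  have 2: "bmap BX m l ` (topspace (par BX m l) \<times> ast BX m) \<subseteq> aster_boundary (ast BX l)"
    if "(m, l) \<in> leq" "m \<noteq> l" for m l
    using bmap_props(2)[OF that] by (auto simp: aster_boundary_cone simp del: BX_simps(8))
  have 5: "char_map BX l (bmap BX m l (f, d)) = char_map BX m d"
    if ml: "(m, l) \<in> leq" "m \<noteq> l" and f: "f \<in> topspace (par BX m l)" and d: "d \<in> ast BX m" for m l f d
  proof -
    have f': "f \<in> Hom C m l" and d': "d \<in> topspace (Cone m)" using f d by simp_all
    have "chr l (join l (bmap BX m l (f, d))) = chr m (join m d)"
      unfolding bmap_props(4)[OF ml f' d'] by (rule attach_props(3)[OF f' ml(2) join_in_star[OF m_in[OF ml] d']])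
    then show ?thesis by (simp only: BX_simps(6) phi_def)
  qed
  have 8: "aster_boundary (ast BX l) =
      (\<Union>m \<in> {m. bd_face BX m l}. bmap BX m l ` (topspace (par BX m l) \<times> aster_interior (ast BX m)))" (is "?B = ?U")
    if l: "l \<in> Ob" for l
  proof (intro equalityI subsetI)
    fix z assume "z \<in> ?B"
    then have "z \<in> base l" by (simp add: aster_boundary_cone)
    then obtain m f d where "(m, l) \<in> leq" "m \<noteq> l" "f \<in> Hom C m l" "d \<in> cone_int m" "bmap BX m l (f, d) = z"
      using base_covered by blast
    then show "z \<in> ?U" unfolding bd_face_BX BX_simps(5,7) topspace_HomT aster_interior_cone by blast
  next
    fix z assume "z \<in> ?U"
    then obtain m f d where ml: "(m, l) \<in> leq" "m \<noteq> l" and f: "f \<in> Hom C m l" "d \<in> cone_int m" and z: "z = bmap BX m l (f, d)"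
      unfolding bd_face_BX BX_simps(5,7) topspace_HomT aster_interior_cone by blast
    have "d \<in> topspace (Cone m)" using f(2) by (simp add: cone_int_def)
    then show "z \<in> ?B" unfolding z BX_simps(5) aster_boundary_cone by (rule bmap_props(2)[OF ml f(1)])
  qed
  have cyl: "stratum (cylinder (par BX m l) (ast_int_strat BX m)) k = {(f, d). f \<in> Hom C m l \<and> d \<in> cone_int m \<and> kind m d = k}"
    "k \<in> faces (cylinder (par BX m l) (ast_int_strat BX m)) \<longleftrightarrow> (\<exists>f\<in>Hom C m l. \<exists>d\<in>cone_int m. k = kind m d)" for m l k
  proof -
    have "topspace (Cone m) \<inter> cone_int m = cone_int m" by (auto simp: cone_int_def)
    then have top: "topspace (sspace (cylinder (par BX m l) (ast_int_strat BX m))) = Hom C m l \<times> cone_int m"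
      by (simp add: cylinder_def ast_int_strat_BX)
    have sm: "smap (cylinder (par BX m l) (ast_int_strat BX m)) = (\<lambda>a. kind m (snd a))"
      by (simp add: cylinder_def ast_int_strat_BX o_def)
    show "stratum (cylinder (par BX m l) (ast_int_strat BX m)) k = {(f, d). f \<in> Hom C m l \<and> d \<in> cone_int m \<and> kind m d = k}"
      unfolding stratum_def top sm by auto
    show "k \<in> faces (cylinder (par BX m l) (ast_int_strat BX m)) \<longleftrightarrow> (\<exists>f\<in>Hom C m l. \<exists>d\<in>cone_int m. k = kind m d)"
      unfolding faces_def top sm by force
  qed
  have bd: "stratum (ast_bd_strat BX l) k = {z \<in> base l. kind l z = k}"
    "k \<in> faces (ast_bd_strat BX l) \<longleftrightarrow> (\<exists>z\<in>base l. k = kind l z)" for l k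
  proof -
    have "topspace (Cone l) \<inter> base l = base l" using base_sub by blast
    then have "topspace (sspace (ast_bd_strat BX l)) = base l" by (simp add: ast_bd_strat_BX)
    then show "stratum (ast_bd_strat BX l) k = {z \<in> base l. kind l z = k}"
      "k \<in> faces (ast_bd_strat BX l) \<longleftrightarrow> (\<exists>z\<in>base l. k = kind l z)"
      unfolding stratum_def faces_def ast_bd_strat_BX(3) by blast+
  qed
  have 9: "stratum (ast_bd_strat BX l) ` faces (ast_bd_strat BX l) =
      (\<Union>m \<in> {m. bd_face BX m l}.
         (\<lambda>k. bmap BX m l ` stratum (cylinder (par BX m l) (ast_int_strat BX m)) k) `
           faces (cylinder (par BX m l) (ast_int_strat BX m)))" (is "?S = ?T") for l
  proof (intro equalityI subsetI)
    fix A assume "A \<in> ?S"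
    then obtain k where k: "k \<in> faces (ast_bd_strat BX l)" "A = stratum (ast_bd_strat BX l) k" by (elim imageE)
    obtain z where "z \<in> base l" "k = kind l z"
      using k(1) unfolding bd(2) by (elim bexE)
    with k(2) have z: "z \<in> base l" "A = stratum (ast_bd_strat BX l) (kind l z)" by simp_all
    obtain m f d where ml: "(m, l) \<in> leq" "m \<noteq> l" and fd: "f \<in> Hom C m l" "d \<in> cone_int m"
      "kind l z = Base (cone_supp m (kind m d))"
      by (rule base_covered[OF z(1)]) blast
    have "A = bmap BX m l ` stratum (cylinder (par BX m l) (ast_int_strat BX m)) (kind m d)"
      unfolding z(2) bd(1) cyl(1) fd(3) by (rule stratum_base[OF ml, symmetric]) (use fd in blast)
    moreover have "kind m d \<in> faces (cylinder (par BX m l) (ast_int_strat BX m))" unfolding cyl(2) using fd by blast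
    moreover have "m \<in> {m. bd_face BX m l}" using ml by (simp add: bd_face_BX)
    ultimately show "A \<in> ?T" by (intro UN_I[of m] image_eqI)
  next
    fix A assume "A \<in> ?T"
    then obtain m k where m: "m \<in> {m. bd_face BX m l}" and k: "k \<in> faces (cylinder (par BX m l) (ast_int_strat BX m))"
      "A = bmap BX m l ` stratum (cylinder (par BX m l) (ast_int_strat BX m)) k"
      by (elim UN_E imageE)
    have ml: "(m, l) \<in> leq" "m \<noteq> l" using m by (simp_all add: bd_face_BX)
    obtain f d where fd: "f \<in> Hom C m l" "d \<in> cone_int m" "k = kind m d" using k(1) unfolding cyl(2) by (elim bexE)
    have "d \<in> topspace (Cone m)" using fd(2) by (simp add: cone_int_def)
    note b = bmap_props(2,3)[OF ml fd(1) this]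
    have "A = stratum (ast_bd_strat BX l) (Base (cone_supp m k))"
      unfolding k(2) bd(1) cyl(1) by (rule stratum_base[OF ml]) (use fd in blast)
    moreover have "Base (cone_supp m k) \<in> faces (ast_bd_strat BX l)"
      unfolding bd(2) fd(3) using b by (intro bexI[OF _ b(1)]) simp
    ultimately show "A \<in> ?S" by (intro image_eqI)
  qed
  show ?thesis
    unfolding cylindrical_structure_def
  proof (intro conjI allI impI ballI)
    fix m l assume "bd_face BX m l"
    then have ml: "(m, l) \<in> leq" "m \<noteq> l" by (simp_all add: bd_face_BX)
    show "bmap BX m l ` (topspace (par BX m l) \<times> ast BX m) \<subseteq> aster_boundary (ast BX l)" by (rule 2[OF ml])
    show "strict_morphism (cylinder (par BX m l) (ast_strat BX m))
          (substrat (ast_bd_strat BX l) (bmap BX m l ` (topspace (par BX m l) \<times> ast BX m))) (bmap BX m l)"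
      by (rule strict_bmap[OF ml])
    show "embedding_map (prod_topology (par BX m l) (sspace (ast_int_strat BX m))) (sspace (ast_bd_strat BX l)) (bmap BX m l)"
      using embedding_bmap[OF ml] by (simp add: ast_int_strat_BX ast_bd_strat_BX)
    show "char_map BX l (bmap BX m l (p, d)) = char_map BX m d" if "p \<in> topspace (par BX m l)" "d \<in> ast BX m" for p d
      by (rule 5[OF ml that])
  next
    fix l0 l1 l2
    show "continuous_map (prod_topology (par BX l1 l2) (par BX l0 l1)) (par BX l0 l2) (cmap BX l0 l1 l2)"
      using continuous_cmp_Hom by simp
    show "bmap' BX l1 l2 (q, bmap' BX l0 l1 (p, d)) = bmap' BX l0 l2 (cmap BX l0 l1 l2 (q, p), d)"
      if "q \<in> topspace (par BX l1 l2)" "p \<in> topspace (par BX l0 l1)" "d \<in> ast BX l0" for q p d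
      using bmap_comp that by (simp del: BX_simps(8,9))
  next
    fix l0 l1 l2 l3 r q p
    assume "r \<in> topspace (par BX l2 l3)" "q \<in> topspace (par BX l1 l2)" "p \<in> topspace (par BX l0 l1)"
    then show "cmap BX l0 l1 l3 (cmap BX l1 l2 l3 (r, q), p) = cmap BX l0 l2 l3 (r, cmap BX l0 l1 l2 (q, p))"
      using cmp_assoc by (simp add: Hom_iff)
  qed (use 1 8 9 in \<open>simp_all add: faces_BX\<close>)
qed

lemma CNSSS_BX: "CNSSS BX"
  unfolding CNSSS_def using stellar_stratified_space_BX normal_BX cylindrical_BX by blast

text \<open>Objects are discrete, so each \<open>Hom C m l\<close> is open in \<open>Mor C\<close>.
  Forgetting the recorded ends is therefore an open bijection from the disjoint sum onto
  \<open>Mor C\<close>.\<close>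

lemma face_category_BX: "topcat_isomorphic (face_category BX) C"
proof -
  let ?D = "face_category BX" and ?I = "{(m, l). cl_face BX m l}"
  have D: "Obj ?D = Obj C" "Mor ?D = sum_topology (\<lambda>(m, l). HomT m l) ?I"
    using discrete by (simp_all add: face_category_def faces_BX)
  have mem: "((m, l), f) \<in> topspace (Mor ?D) \<longleftrightarrow> f \<in> Hom C m l" for m l f
    unfolding D(2) using leqI by (auto simp: cl_face_BX Hom_iff)
  have bij: "snd ` topspace (Mor ?D) = Mo" "inj_on snd (topspace (Mor ?D))"
  proof -
    show "snd ` topspace (Mor ?D) = Mo"
    proof (intro equalityI subsetI)
      fix f assume "f \<in> Mo"
      then have "((src C f, tgt C f), f) \<in> topspace (Mor ?D)" unfolding mem by (simp add: Hom_iff)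
      then show "f \<in> snd ` topspace (Mor ?D)" by force
    next
      fix f assume "f \<in> snd ` topspace (Mor ?D)"
      then obtain m l where "((m, l), f) \<in> topspace (Mor ?D)" by auto
      then show "f \<in> Mo" unfolding mem by (simp add: Hom_iff)
    qed
    show "inj_on snd (topspace (Mor ?D))"
    proof (rule inj_onI)
      fix a b assume a: "a \<in> topspace (Mor ?D)" and b: "b \<in> topspace (Mor ?D)" and ab: "snd a = snd b"
      obtain m l f where "a = ((m, l), f)" by (metis surj_pair)
      moreover obtain m' l' f' where "b = ((m', l'), f')" by (metis surj_pair)
      ultimately show "a = b" using a b ab mem by (auto simp: Hom_iff)
    qed
  qed
  have cont: "continuous_map (Mor ?D) (Mor C) snd"
    unfolding continuous_map_def
  proof (intro conjI allI impI)
    show "snd \<in> topspace (Mor ?D) \<rightarrow> Mo" using bij(1) by blast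
    fix U assume U: "openin (Mor C) U"
    show "openin (Mor ?D) {a \<in> topspace (Mor ?D). snd a \<in> U}"
      unfolding D(2) openin_sum_topology
    proof (intro conjI ballI)
      show "{a \<in> topspace (sum_topology (\<lambda>(m, l). HomT m l) ?I). snd a \<in> U} \<subseteq> Sigma ?I (topspace \<circ> (\<lambda>(m, l). HomT m l))"
        by auto
      fix i assume i: "i \<in> ?I"
      obtain m l where ml: "i = (m, l)" by (cases i)
      have "{f. (i, f) \<in> {a \<in> topspace (sum_topology (\<lambda>(m, l). HomT m l) ?I). snd a \<in> U}} = U \<inter> Hom C m l"
        using mem[unfolded D(2)] ml by auto
      moreover have "openin (HomT m l) (U \<inter> Hom C m l)" using U unfolding openin_subtopology by blast
      ultimately show "openin (case i of (m, l) \<Rightarrow> HomT m l) {f. (i, f) \<in> {a \<in> topspace (sum_topology (\<lambda>(m, l). HomT m l) ?I). snd a \<in> U}}"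
        by (simp only: ml prod.case)
    qed
  qed
  have opn: "open_map (Mor ?D) (Mor C) snd"
    unfolding open_map_def
  proof (intro allI impI)
    fix V assume V: "openin (Mor ?D) V"
    have "openin (Mor C) {f. ((m, l), f) \<in> V}" for m l
    proof (cases "(m, l) \<in> leq")
      case True
      then have "openin (HomT m l) {f. ((m, l), f) \<in> V}"
        using V unfolding D(2) openin_sum_topology by (auto simp: cl_face_BX)
      then show ?thesis using openin_Hom openin_trans_full by blast
    next
      case False
      have "{f. ((m, l), f) \<in> V} = {}"
        using openin_subset[OF V] mem False leqI by blast
      then show ?thesis by simp
    qed
    then have "openin (Mor C) (\<Union>{{f. ((m, l), f) \<in> V} | m l. True})" by (intro openin_Union) blast
    moreover have "snd ` V = \<Union>{{f. ((m, l), f) \<in> V} | m l. True}"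
    proof (intro equalityI subsetI)
      fix f assume "f \<in> snd ` V"
      then obtain m l where "((m, l), f) \<in> V" by auto
      then show "f \<in> \<Union>{{f. ((m, l), f) \<in> V} | m l. True}" by blast
    next
      fix f assume "f \<in> \<Union>{{f. ((m, l), f) \<in> V} | m l. True}"
      then obtain m l where "((m, l), f) \<in> V" by blast
      then show "f \<in> snd ` V" by (rule image_eqI[rotated]) simp
    qed
    ultimately show "openin (Mor C) (snd ` V)" by simp
  qed
  have hom: "homeomorphic_map (Mor ?D) (Mor C) snd"
    by (rule bijective_open_imp_homeomorphic_map[OF cont opn bij])
  show ?thesis
    unfolding topcat_isomorphic_def
  proof (intro exI conjI ballI impI)
    show "homeomorphic_map (Obj ?D) (Obj C) (\<lambda>x. x)"
      unfolding D(1) by (intro bijective_open_imp_homeomorphic_map) (auto simp: open_map_def)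
    show "homeomorphic_map (Mor ?D) (Mor C) snd" by (rule hom)
    fix a assume a: "a \<in> topspace (Mor ?D)"
    obtain m l f where af: "a = ((m, l), f)" by (metis surj_pair)
    then have f: "f \<in> Hom C m l" using a mem by simp
    then show "src C (snd a) = src ?D a" "tgt C (snd a) = tgt ?D a"
      by (simp_all add: af face_category_def Hom_iff)
    fix b assume b: "b \<in> topspace (Mor ?D)"
    obtain m' l' g where bg: "b = ((m', l'), g)" by (metis surj_pair)
    show "snd (cmp ?D b a) = cmp C (snd b) (snd a)"
      by (simp add: af bg face_category_def)
  next
    fix x assume "x \<in> topspace (Obj ?D)"
    then have "Hom C x x = {ident C x}" using acyclic unfolding D(1) by (simp add: acyclic_category_def)
    then show "snd (ident ?D x) = ident C x" by (simp add: face_category_def)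
  qed
qed

end

theorem theorem1p5:
  fixes C :: "('o, 'm) topcat"
  assumes "acyclic_category C"
    and "Obj C = discrete_topology (topspace (Obj C))"
    and "\<And>x y. x \<in> topspace (Obj C) \<Longrightarrow> y \<in> topspace (Obj C) \<Longrightarrow>
           compact_space (subtopology (Mor C) (Hom C x y)) \<and>
           Hausdorff_space (subtopology (Mor C) (Hom C x y))"
    and "\<And>x. x \<in> topspace (Obj C) \<Longrightarrow> finite (strictly_below C x)"
  shows "\<exists>X :: (('o, 'm) bpoint, 'o, ('o, 'm) bpoint, 'o set, 'm) cyl.
           sspace X = classifying_space C \<and> CNSSS X \<and> topcat_isomorphic (face_category X) C"
proof -
  interpret compact_acyclic_category C using assms by unfold_locales
  show ?thesis using CNSSS_BX face_category_BX BX_simps(1) by blast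
qed

end
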